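(* Every free bias is residually finite. In particular, the variety of all biases is generated by all finite symmetric biases $\mathfrak I_N$ ($N$ ranging over the positive integers), and the word problem for free biases is decidable.
   Context: A semigroup $S$ is inverse if every $x\in S$ has a unique $x^{-1}$ with $x=xx^{-1}x$ and $x^{-1}=x^{-1}xx^{-1}$. Put $\mathbf d(x)=x^{-1}x$, $\mathbf r(x)=xx^{-1}$; $\operatorname{Idp}S$ is the set of idempotents; the natural ordering is $x\le y$ iff $x=y\,\mathbf d(x)$. In an inverse semigroup with zero, $x,y$ are orthogonal if $x^{-1}y=xy^{-1}=0$. A Boolean inverse semigroup is an inverse semigroup $S$ with zero such that $\operatorname{Idp}S$ is a generalized Boolean algebra and any two orthogonal $x,y$ have a join $x\oplus y$ for the natural ordering. On a Boolean inverse semigroup define $x\oslash y=(\mathbf r(x)\smallsetminus\mathbf r(y))\,x\,(\mathbf d(x)\smallsetminus\mathbf d(y))$ and $x\triangledown y=(x\oslash y)\oplus y$. Boolean inverse semigroups, viewed as algebras $(S,0,{}^{-1},\cdot,\oslash,\triangledown)$, are exactly the models of a finite set of identities; these algebras are called biases, so a bias is the same as a Boolean inverse semigroup. Bias homomorphisms (homomorphisms for all five operations) are exactly the semigroup homomorphisms $f$ with $f(0)=0$ and $f(x\oplus y)=f(x)\oplus f(y)$ for orthogonal $x,y$. A variety of biases is the class of all biases satisfying some set of identities in this similarity type. A free bias is a free algebra $\operatorname{F_{bis}}(\Sigma)$, on a set $\Sigma$, in the variety of all biases. A bias $S$ is residually finite if for any distinct $x,y\in S$ there is a bias homomorphism from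 $S$ to a finite bias separating $x$ and $y$. $\mathfrak I_N$ is the bias of all partial one-to-one functions on $\{1,\dots,N\}$ under composition. The word problem for free biases asks, given two terms in finitely many variables in the similarity type $(0,{}^{-1},\cdot,\oslash,\triangledown)$, whether they represent the same element of the free bias on those variables. *)

theory Defs
  imports "HOL-Algebra.Lattice" "HOL-Library.Nat_Bijection"
begin

section \<open>Generalized Boolean algebras\<close>

text \<open>
  A generalized Boolean algebra is a distributive lattice with a least element in which all
  intervals with lower end point the least element are complemented.
\<close>

locale generalized_boolean_algebra = lattice L + weak_partial_order_bottom L
  for L (structure) +
  assumes meet_join_distrib:
      "\<lbrakk>a \<in> carrier L; b \<in> carrier L; c \<in> carrier L\<rbrakk>
        \<Longrightarrow> a \<sqinter> (b \<squnion> c) = (a \<sqinter> b) \<squnion> (a \<sqinter> c)"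
    and sectionally_complemented:
      "\<lbrakk>a \<in> carrier L; b \<in> carrier L; a \<sqsubseteq> b\<rbrakk>
        \<Longrightarrow> \<exists>c\<in>carrier L. a \<sqinter> c = \<bottom> \<and> a \<squnion> c = b"

definition bool_diff :: "('a, 'm) gorder_scheme \<Rightarrow> 'a \<Rightarrow> 'a \<Rightarrow> 'a" where
  "bool_diff L a b =
    (THE c. c \<in> carrier L \<and> b \<sqinter>\<^bsub>L\<^esub> c = \<bottom>\<^bsub>L\<^esub> \<and> (a \<sqinter>\<^bsub>L\<^esub> b) \<squnion>\<^bsub>L\<^esub> c = a)"


section \<open>Boolean inverse semigroups\<close>

record 'a semigroup_str = "'a partial_object" +
  mult :: "'a \<Rightarrow> 'a \<Rightarrow> 'a"  (infixl \<open>\<cdot>\<index>\<close> 70)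

definition is_inverse :: "('a, 'm) semigroup_str_scheme \<Rightarrow> 'a \<Rightarrow> 'a \<Rightarrow> bool" where
  "is_inverse S x y \<longleftrightarrow> x = x \<cdot>\<^bsub>S\<^esub> y \<cdot>\<^bsub>S\<^esub> x \<and> y = y \<cdot>\<^bsub>S\<^esub> x \<cdot>\<^bsub>S\<^esub> y"

locale inverse_semigroup =
  fixes S :: "('a, 'm) semigroup_str_scheme" (structure)
  assumes mult_closed: "\<lbrakk>x \<in> carrier S; y \<in> carrier S\<rbrakk> \<Longrightarrow> x \<cdot> y \<in> carrier S"
    and mult_assoc:
      "\<lbrakk>x \<in> carrier S; y \<in> carrier S; z \<in> carrier S\<rbrakk> \<Longrightarrow> (x \<cdot> y) \<cdot> z = x \<cdot> (y \<cdot> z)"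
    and ex1_inverse: "x \<in> carrier S \<Longrightarrow> \<exists>!y. y \<in> carrier S \<and> is_inverse S x y"

definition sinv :: "('a, 'm) semigroup_str_scheme \<Rightarrow> 'a \<Rightarrow> 'a" where
  "sinv S x = (THE y. y \<in> carrier S \<and> is_inverse S x y)"

definition dom_idp :: "('a, 'm) semigroup_str_scheme \<Rightarrow> 'a \<Rightarrow> 'a" where
  "dom_idp S x = sinv S x \<cdot>\<^bsub>S\<^esub> x"

definition ran_idp :: "('a, 'm) semigroup_str_scheme \<Rightarrow> 'a \<Rightarrow> 'a" where
  "ran_idp S x = x \<cdot>\<^bsub>S\<^esub> sinv S x"

definition Idp :: "('a, 'm) semigroup_str_scheme \<Rightarrow> 'a set" where
  "Idp S = {e \<in> carrier S. e \<cdot>\<^bsub>S\<^esub> e = e}"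

text \<open>
  The natural ordering on the subset \<open>A\<close> of an inverse semigroup, as an order structure;
  it is used for \<open>A\<close> the whole semigroup and for \<open>A\<close> the set of all idempotents.
\<close>

definition nat_order :: "('a, 'm) semigroup_str_scheme \<Rightarrow> 'a set \<Rightarrow> 'a gorder" where
  "nat_order S A = \<lparr>carrier = A, eq = (=), le = (\<lambda>x y. x = y \<cdot>\<^bsub>S\<^esub> dom_idp S x)\<rparr>"

definition is_zero :: "('a, 'm) semigroup_str_scheme \<Rightarrow> 'a \<Rightarrow> bool" where
  "is_zero S z \<longleftrightarrow> z \<in> carrier S \<and> (\<forall>x\<in>carrier S. z \<cdot>\<^bsub>S\<^esub> x = z \<and> x \<cdot>\<^bsub>S\<^esub> z = z)"

definition szero :: "('a, 'm) semigroup_str_scheme \<Rightarrow> 'a" where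
  "szero S = (THE z. is_zero S z)"

definition orthogonal :: "('a, 'm) semigroup_str_scheme \<Rightarrow> 'a \<Rightarrow> 'a \<Rightarrow> bool" where
  "orthogonal S x y \<longleftrightarrow> sinv S x \<cdot>\<^bsub>S\<^esub> y = szero S \<and> x \<cdot>\<^bsub>S\<^esub> sinv S y = szero S"

locale boolean_inverse_semigroup = inverse_semigroup +
  assumes zero_exists: "\<exists>z. is_zero S z"
    and Idp_generalized_boolean: "generalized_boolean_algebra (nat_order S (Idp S))"
    and orthogonal_join_exists:
      "\<lbrakk>x \<in> carrier S; y \<in> carrier S; orthogonal S x y\<rbrakk>
        \<Longrightarrow> \<exists>s. is_lub (nat_order S (carrier S)) s {x, y}"

definition orth_join :: "('a, 'm) semigroup_str_scheme \<Rightarrow> 'a \<Rightarrow> 'a \<Rightarrow> 'a" where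
  "orth_join S x y = x \<squnion>\<^bsub>nat_order S (carrier S)\<^esub> y"

definition can_skew_diff :: "('a, 'm) semigroup_str_scheme \<Rightarrow> 'a \<Rightarrow> 'a \<Rightarrow> 'a" where
  "can_skew_diff S x y =
    bool_diff (nat_order S (Idp S)) (ran_idp S x) (ran_idp S y) \<cdot>\<^bsub>S\<^esub> x \<cdot>\<^bsub>S\<^esub>
    bool_diff (nat_order S (Idp S)) (dom_idp S x) (dom_idp S y)"

definition can_skew_add :: "('a, 'm) semigroup_str_scheme \<Rightarrow> 'a \<Rightarrow> 'a \<Rightarrow> 'a" where
  "can_skew_add S x y = orth_join S (can_skew_diff S x y) y"


section \<open>Biases\<close>

record 'a bias_str = "'a semigroup_str" +
  bzero :: 'a  (\<open>\<zero>\<index>\<close>)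
  binv :: "'a \<Rightarrow> 'a"
  skew_diff :: "'a \<Rightarrow> 'a \<Rightarrow> 'a"  (infixl \<open>\<oslash>\<index>\<close> 65)
  skew_add :: "'a \<Rightarrow> 'a \<Rightarrow> 'a"  (infixl \<open>\<nabla>\<index>\<close> 65)

text \<open>
  A bias is a Boolean inverse semigroup whose further operations are the ones determined by the
  multiplication.  The operations are constrained on the carrier only.
\<close>

locale bias = boolean_inverse_semigroup S
  for S :: "'a bias_str" (structure) +
  assumes bzero_eq: "\<zero> = szero S"
    and binv_eq: "x \<in> carrier S \<Longrightarrow> binv S x = sinv S x"
    and skew_diff_eq:
      "\<lbrakk>x \<in> carrier S; y \<in> carrier S\<rbrakk> \<Longrightarrow> x \<oslash> y = can_skew_diff S x y"
    and skew_add_eq: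
      "\<lbrakk>x \<in> carrier S; y \<in> carrier S\<rbrakk> \<Longrightarrow> x \<nabla> y = can_skew_add S x y"

definition bias_of :: "'a semigroup_str \<Rightarrow> 'a bias_str" where
  "bias_of S = \<lparr>carrier = carrier S, mult = mult S, bzero = szero S, binv = sinv S,
    skew_diff = can_skew_diff S, skew_add = can_skew_add S\<rparr>"

definition bias_hom :: "'a bias_str \<Rightarrow> 'b bias_str \<Rightarrow> ('a \<Rightarrow> 'b) set" where
  "bias_hom S T = {f \<in> carrier S \<rightarrow> carrier T.
     f \<zero>\<^bsub>S\<^esub> = \<zero>\<^bsub>T\<^esub> \<and>
     (\<forall>x\<in>carrier S. f (binv S x) = binv T (f x)) \<and>
     (\<forall>x\<in>carrier S. \<forall>y\<in>carrier S.
        f (x \<cdot>\<^bsub>S\<^esub> y) = f x \<cdot>\<^bsub>T\<^esub> f y \<and>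
        f (x \<oslash>\<^bsub>S\<^esub> y) = f x \<oslash>\<^bsub>T\<^esub> f y \<and>
        f (x \<nabla>\<^bsub>S\<^esub> y) = f x \<nabla>\<^bsub>T\<^esub> f y)}"

text \<open>
  The finite test biases are carried by sets of natural numbers, which is no restriction as every
  finite bias is isomorphic to such a bias.
\<close>

definition residually_finite :: "'a bias_str \<Rightarrow> bool" where
  "residually_finite S \<longleftrightarrow> (\<forall>x\<in>carrier S. \<forall>y\<in>carrier S. x \<noteq> y \<longrightarrow>
    (\<exists>(T :: nat bias_str) f. bias T \<and> finite (carrier T) \<and> f \<in> bias_hom S T \<and> f x \<noteq> f y))"

text \<open>The symmetric inverse semigroup of all partial one-to-one functions on \<open>{1..N}\<close>.\<close>

definition sym_semigroup :: "nat \<Rightarrow> (nat \<rightharpoonup> nat) semigroup_str" where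
  "sym_semigroup N =
    \<lparr>carrier = {f. dom f \<subseteq> {1..N} \<and> ran f \<subseteq> {1..N} \<and> inj_on f (dom f)}, mult = (\<circ>\<^sub>m)\<rparr>"

definition sym_bias :: "nat \<Rightarrow> (nat \<rightharpoonup> nat) bias_str" where
  "sym_bias N = bias_of (sym_semigroup N)"


section \<open>Terms, identities, varieties\<close>

datatype (vars: 'v) bterm =
    Var 'v
  | Zero
  | Inv "'v bterm"
  | Mult "'v bterm" "'v bterm"
  | SDiff "'v bterm" "'v bterm"
  | SAdd "'v bterm" "'v bterm"

primrec eval_term :: "'a bias_str \<Rightarrow> ('v \<Rightarrow> 'a) \<Rightarrow> 'v bterm \<Rightarrow> 'a" where
  "eval_term S a (Var v) = a v"
| "eval_term S a Zero = \<zero>\<^bsub>S\<^esub>"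
| "eval_term S a (Inv t) = binv S (eval_term S a t)"
| "eval_term S a (Mult s t) = eval_term S a s \<cdot>\<^bsub>S\<^esub> eval_term S a t"
| "eval_term S a (SDiff s t) = eval_term S a s \<oslash>\<^bsub>S\<^esub> eval_term S a t"
| "eval_term S a (SAdd s t) = eval_term S a s \<nabla>\<^bsub>S\<^esub> eval_term S a t"

text \<open>Identities are pairs of terms in the countably many variables indexed by \<open>nat\<close>.\<close>

definition satisfies :: "'a bias_str \<Rightarrow> (nat bterm \<times> nat bterm) set \<Rightarrow> bool" where
  "satisfies S E \<longleftrightarrow>
    (\<forall>(s, t)\<in>E. \<forall>a. range a \<subseteq> carrier S \<longrightarrow> eval_term S a s = eval_term S a t)"

definition bias_variety :: "(nat bterm \<times> nat bterm) set \<Rightarrow> 'a bias_str set" where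
  "bias_variety E = {S. bias S \<and> satisfies S E}"

text \<open>
  The members, with elements of type \<open>'b\<close>, of the smallest variety of biases containing the
  class \<open>K\<close>.
\<close>

definition generated_variety :: "'a bias_str set \<Rightarrow> 'b bias_str set" where
  "generated_variety K = \<Inter>{bias_variety E | E. K \<subseteq> bias_variety E}"


section \<open>Free biases\<close>

definition term_algebra :: "'v set \<Rightarrow> 'v bterm bias_str" where
  "term_algebra X = \<lparr>carrier = {t. vars t \<subseteq> X}, mult = Mult, bzero = Zero, binv = Inv,
    skew_diff = SDiff, skew_add = SAdd\<rparr>"

definition congruence :: "'a bias_str \<Rightarrow> ('a \<times> 'a) set \<Rightarrow> bool" where
  "congruence S \<theta> \<longleftrightarrow> equiv (carrier S) \<theta> \<and>
    (\<forall>(x, x')\<in>\<theta>. (binv S x, binv S x') \<in> \<theta>) \<and>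
    (\<forall>(x, x')\<in>\<theta>. \<forall>(y, y')\<in>\<theta>.
      (x \<cdot>\<^bsub>S\<^esub> y, x' \<cdot>\<^bsub>S\<^esub> y') \<in> \<theta> \<and> (x \<oslash>\<^bsub>S\<^esub> y, x' \<oslash>\<^bsub>S\<^esub> y') \<in> \<theta> \<and> (x \<nabla>\<^bsub>S\<^esub> y, x' \<nabla>\<^bsub>S\<^esub> y') \<in> \<theta>)"

definition quotient_algebra :: "'a bias_str \<Rightarrow> ('a \<times> 'a) set \<Rightarrow> 'a set bias_str" where
  "quotient_algebra S \<theta> =
    \<lparr>carrier = carrier S // \<theta>,
     mult = (\<lambda>A B. \<Union>x\<in>A. \<Union>y\<in>B. \<theta> `` {x \<cdot>\<^bsub>S\<^esub> y}),
     bzero = \<theta> `` {\<zero>\<^bsub>S\<^esub>},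
     binv = (\<lambda>A. \<Union>x\<in>A. \<theta> `` {binv S x}),
     skew_diff = (\<lambda>A B. \<Union>x\<in>A. \<Union>y\<in>B. \<theta> `` {x \<oslash>\<^bsub>S\<^esub> y}),
     skew_add = (\<lambda>A B. \<Union>x\<in>A. \<Union>y\<in>B. \<theta> `` {x \<nabla>\<^bsub>S\<^esub> y})\<rparr>"

text \<open>
  The usual construction of the free algebra on \<open>X\<close> in a variety: the quotient of the term
  algebra by the intersection of all congruences whose quotient lies in the variety.
  Working with congruences of the term algebra avoids a quantification over biases of all types.
\<close>

definition free_congruence :: "'v set \<Rightarrow> ('v bterm \<times> 'v bterm) set" where
  "free_congruence X =
    \<Inter>{\<theta>. congruence (term_algebra X) \<theta> \<and> bias (quotient_algebra (term_algebra X) \<theta>)}"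

definition free_bias :: "'v set \<Rightarrow> 'v bterm set bias_str" where
  "free_bias X = quotient_algebra (term_algebra X) (free_congruence X)"

definition free_gen :: "'v set \<Rightarrow> 'v \<Rightarrow> 'v bterm set" where
  "free_gen X v = free_congruence X `` {Var v}"


section \<open>Decidability\<close>

text \<open>
  The general recursive functions of \<open>k\<close> arguments, the arguments being given as a list of
  length \<open>k\<close>: the closure of the initial functions under composition, primitive recursion and
  minimization of regular functions.  The rule \<open>extensional\<close> expresses that the
  values at lists of any other length are irrelevant.
\<close>

inductive recursive :: "nat \<Rightarrow> (nat list \<Rightarrow> nat) \<Rightarrow> bool" where
  zero: "recursive k (\<lambda>xs. 0)"
| successor: "recursive 1 (\<lambda>xs. Suc (xs ! 0))"
| projection: "i < k \<Longrightarrow> recursive k (\<lambda>xs. xs ! i)"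
| composition:
    "\<lbrakk>recursive (length gs) f; \<And>g. g \<in> set gs \<Longrightarrow> recursive k g\<rbrakk>
      \<Longrightarrow> recursive k (\<lambda>xs. f (map (\<lambda>g. g xs) gs))"
| primitive_recursion:
    "\<lbrakk>recursive k g; recursive (k + 2) h\<rbrakk>
      \<Longrightarrow> recursive (k + 1)
            (\<lambda>xs. rec_nat (g (tl xs)) (\<lambda>n r. h (n # r # tl xs)) (hd xs))"
| minimization:
    "\<lbrakk>recursive (k + 1) f; \<And>xs. length xs = k \<Longrightarrow> \<exists>n. f (n # xs) = 0\<rbrakk>
      \<Longrightarrow> recursive k (\<lambda>xs. LEAST n. f (n # xs) = 0)"
| extensional:
    "\<lbrakk>recursive k f; \<And>xs. length xs = k \<Longrightarrow> f xs = g xs\<rbrakk> \<Longrightarrow> recursive k g"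

definition decidable :: "nat set \<Rightarrow> bool" where
  "decidable A \<longleftrightarrow> (\<exists>f. recursive 1 f \<and> (\<forall>n. f [n] = (if n \<in> A then 1 else 0)))"

primrec term_code :: "nat bterm \<Rightarrow> nat" where
  "term_code (Var v) = prod_encode (0, v)"
| "term_code Zero = prod_encode (1, 0)"
| "term_code (Inv t) = prod_encode (2, term_code t)"
| "term_code (Mult s t) = prod_encode (3, prod_encode (term_code s, term_code t))"
| "term_code (SDiff s t) = prod_encode (4, prod_encode (term_code s, term_code t))"
| "term_code (SAdd s t) = prod_encode (5, prod_encode (term_code s, term_code t))"

text \<open>
  The instances are triples consisting of a number \<open>n\<close> of variables and two terms in the
  variables \<open>0, \<dots>, n - 1\<close>; the set consists of the codes of the instances with answer ``yes''.
\<close>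

definition free_bias_word_problem :: "nat set" where
  "free_bias_word_problem =
    {prod_encode (n, prod_encode (term_code s, term_code t)) | n s t.
      vars s \<subseteq> {..<n} \<and> vars t \<subseteq> {..<n} \<and>
      eval_term (free_bias {..<n}) (free_gen {..<n}) s =
      eval_term (free_bias {..<n}) (free_gen {..<n}) t}"

end

theory Submission
  imports Defs
begin

text \<open>
  The proof compares abstract biases with concrete ones, whose elements are partial injections of
  a set \<open>\<Omega>\<close>.  On partial injections the operations are elementary: \<open>x \<oslash> y\<close> consists of the arrows
  of \<open>x\<close> that share neither source nor target with an arrow of \<open>y\<close>, and \<open>x \<nabla> y\<close> is the union
  of \<open>x \<oslash> y\<close> and \<open>y\<close>.  Every set of partial injections that is closed under the operations is a
  bias (\<open>faithful_rel_hom_bias\<close>).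

  Conversely, biases have enough such representations.  Fix a prime filter \<open>\<xi>\<close> of idempotents of
  a bias \<open>S\<close>, and identify \<open>x\<close> and \<open>y\<close> if \<open>x \<cdot> e = y \<cdot> e\<close> for some \<open>e \<in> \<xi>\<close>.  Then \<open>S\<close> acts by left
  multiplication on the germs obtained from the elements with domain in \<open>\<xi>\<close>, and this is a bias
  homomorphism into the partial injections on the set of germs.  Given \<open>x \<noteq> y\<close>, say
  \<open>x \<noteq> y \<cdot> d(x)\<close>, the idempotents below \<open>d(x)\<close> on which \<open>x\<close> and \<open>y\<close> agree form an ideal that does
  not contain \<open>d(x)\<close>; a prime filter that contains \<open>d(x)\<close> and avoids this ideal yields a
  representation that separates \<open>x\<close> from \<open>y\<close> (\<open>separating_rel_hom\<close>).

  The second idea is locality.  Whether the value of a term \<open>t\<close> at partial injections contains an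
  arrow starting or ending at \<open>p\<close> depends only on the points that are reached from \<open>p\<close> by at most
  as many steps along the given partial injections or their inverses as \<open>t\<close> has occurrences of
  variables.  If two terms differ at \<open>p\<close>, cutting the partial injections down to this finite ball
  keeps the difference.  So an identity \<open>s = t\<close> that fails in some bias fails in \<open>\<I>\<^sub>N\<close>, where \<open>N\<close>
  has an explicit bound in terms of \<open>s\<close> and \<open>t\<close> (\<open>finite_counterexample\<close>).

  All three claims follow.  The identities of the \<open>\<I>\<^sub>N\<close> are those of all biases.  The congruence
  defining a free bias consists of the pairs of terms that have equal values at all finite systems
  of partial injections (\<open>free_congruence_subset\<close>, \<open>free_congruence_counterexample\<close>), hence free
  biases are residually finite.  And two terms in \<open>n\<close> variables can be compared by running through
  the finitely many systems of \<open>n\<close> partial injections on a set of bounded size; the last sections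
  carry this out with recursive functions.
\<close>

section \<open>Partial injections as relations\<close>

definition pinj :: "'p rel \<Rightarrow> bool" where
  "pinj R \<longleftrightarrow> single_valued R \<and> single_valued (R\<inverse>)"

definition rdiff :: "'p rel \<Rightarrow> 'p rel \<Rightarrow> 'p rel" where
  "rdiff A B = {(p, q) \<in> A. p \<notin> Domain B \<and> q \<notin> Range B}"

definition radd :: "'p rel \<Rightarrow> 'p rel \<Rightarrow> 'p rel" where
  "radd A B = rdiff A B \<union> B"

lemma pinjD: "pinj R \<Longrightarrow> (p, q) \<in> R \<Longrightarrow> (p, q') \<in> R \<Longrightarrow> q = q'"
  and pinjD': "pinj R \<Longrightarrow> (p, q) \<in> R \<Longrightarrow> (p', q) \<in> R \<Longrightarrow> p = p'"
  unfolding pinj_def single_valued_def by blast+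

lemma pinjI:
  "(\<And>p q q'. (p, q) \<in> R \<Longrightarrow> (p, q') \<in> R \<Longrightarrow> q = q') \<Longrightarrow>
   (\<And>p p' q. (p, q) \<in> R \<Longrightarrow> (p', q) \<in> R \<Longrightarrow> p = p') \<Longrightarrow> pinj R"
  unfolding pinj_def single_valued_def by blast

lemma pinj_empty: "pinj {}"
  by (rule pinjI) auto

lemma pinj_subset: "pinj R \<Longrightarrow> Q \<subseteq> R \<Longrightarrow> pinj Q"
  unfolding pinj_def single_valued_def by blast

lemma pinj_converse: "pinj R \<Longrightarrow> pinj (R\<inverse>)"
  by (simp add: pinj_def)

lemma pinj_relcomp: "pinj R \<Longrightarrow> pinj Q \<Longrightarrow> pinj (R O Q)"
  by (rule pinjI) (blast dest: pinjD pinjD')+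

lemma pinj_rdiff: "pinj R \<Longrightarrow> pinj (rdiff R Q)"
  by (erule pinj_subset) (auto simp: rdiff_def)

lemma pinj_radd: "pinj R \<Longrightarrow> pinj Q \<Longrightarrow> pinj (radd R Q)"
  by (rule pinjI; clarsimp simp: radd_def rdiff_def) (blast dest: pinjD pinjD')+

lemma pinj_O_converse: "pinj R \<Longrightarrow> R O R\<inverse> = Id_on (Domain R)"
  by (auto dest: pinjD')

lemma pinj_converse_O: "pinj R \<Longrightarrow> R\<inverse> O R = Id_on (Range R)"
  by (auto dest: pinjD)

lemma Id_on_O: "Id_on A O R = {(p, q) \<in> R. p \<in> A}"
  by auto

lemma O_Id_on: "R O Id_on A = {(p, q) \<in> R. q \<in> A}"
  by auto

text \<open>
  The equation \<open>x = y \<cdot> d(x)\<close> that defines the natural ordering says that \<open>x\<close> is the restriction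
  of \<open>y\<close> to the domain of \<open>x\<close>; for partial injections this is inclusion.
\<close>

lemma pinj_subset_iff: "pinj R \<Longrightarrow> Q = Id_on (Domain Q) O R \<longleftrightarrow> Q \<subseteq> R"
  unfolding Id_on_O by (auto dest: pinjD)

text \<open>
  An arrow of an idempotent \<open>R\<close> from \<open>p\<close> to \<open>q\<close> factors through some \<open>r\<close>.  As \<open>R\<close> is single-valued,
  \<open>r = q\<close>, so \<open>q\<close> is fixed by \<open>R\<close>, and \<open>p = q\<close> by injectivity.
\<close>

lemma pinj_idem_iff:
  assumes "pinj R" shows "R O R = R \<longleftrightarrow> R \<subseteq> Id"
proof
  assume eq: "R O R = R"
  show "R \<subseteq> Id"
  proof clarify
    fix p q assume pq: "(p, q) \<in> R"
    then obtain r where "(p, r) \<in> R" "(r, q) \<in> R" using eq by blast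
    with pq assms have "(q, q) \<in> R" by (auto dest: pinjD)
    with pq assms show "p = q" by (blast dest: pinjD')
  qed
qed auto

lemma pinj_inverse_unique:
  assumes "pinj R" "pinj Q" "R = R O Q O R" "Q = Q O R O Q"
  shows "Q = R\<inverse>"
proof -
  have sub: "B \<subseteq> A\<inverse>" if "pinj A" "pinj B" "B = B O A O B" for A B :: "'a rel"
  proof
    fix x assume "x \<in> B"
    then obtain p q where x: "x = (p, q)" "(p, q) \<in> B" by (cases x) auto
    with that(3) have "(p, q) \<in> B O A O B" by blast
    then obtain r s where "(p, r) \<in> B" "(r, s) \<in> A" "(s, q) \<in> B" by blast
    with x that show "x \<in> A\<inverse>" by (auto dest: pinjD pinjD')
  qed
  from sub[of R Q] sub[of Q R] assms show ?thesis by blast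
qed

text \<open>
  A subrelation of the identity amounts to a set of points, and the operations become those on sets.
\<close>

lemma subid_relcomp: "E \<subseteq> Id \<Longrightarrow> F \<subseteq> Id \<Longrightarrow> F O E = E \<inter> F"
  by auto

lemma subid_rdiff: "E \<subseteq> Id \<Longrightarrow> F \<subseteq> Id \<Longrightarrow> rdiff E F = E - F"
  by (auto simp: rdiff_def)

lemma subid_radd: "E \<subseteq> Id \<Longrightarrow> F \<subseteq> Id \<Longrightarrow> radd E F = E \<union> F"
  by (auto simp: radd_def rdiff_def)

section \<open>Semigroups of partial injections are Boolean inverse semigroups\<close>

text \<open>
  The map \<open>\<phi>\<close> turns products into compositions; the order is reversed, as \<open>O\<close> applies its left
  argument first.  The other operations of a bias are determined by the product, so it is enough
  that the image of \<open>\<phi>\<close> is closed under their concrete versions.  This form covers both structures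
  with given operations and structures such as \<open>sym_semigroup\<close> that only have a product.
\<close>

locale pinj_semigroup =
  fixes S :: "('a, 'm) semigroup_str_scheme" (structure) and \<phi> :: "'a \<Rightarrow> 'p rel"
  assumes rep_inj: "inj_on \<phi> (carrier S)"
    and rep_pinj: "x \<in> carrier S \<Longrightarrow> pinj (\<phi> x)"
    and mult_closed: "x \<in> carrier S \<Longrightarrow> y \<in> carrier S \<Longrightarrow> x \<cdot> y \<in> carrier S"
    and rep_mult: "x \<in> carrier S \<Longrightarrow> y \<in> carrier S \<Longrightarrow> \<phi> (x \<cdot> y) = \<phi> y O \<phi> x"
    and rep_zero_ex: "\<exists>z\<in>carrier S. \<phi> z = {}"
    and rep_inv_ex: "x \<in> carrier S \<Longrightarrow> \<exists>y\<in>carrier S. \<phi> y = (\<phi> x)\<inverse>"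
    and rep_diff_ex:
      "x \<in> carrier S \<Longrightarrow> y \<in> carrier S \<Longrightarrow> \<exists>z\<in>carrier S. \<phi> z = rdiff (\<phi> x) (\<phi> y)"
    and rep_add_ex:
      "x \<in> carrier S \<Longrightarrow> y \<in> carrier S \<Longrightarrow> \<exists>z\<in>carrier S. \<phi> z = radd (\<phi> x) (\<phi> y)"
begin

lemma rep_eq_iff: "x \<in> carrier S \<Longrightarrow> y \<in> carrier S \<Longrightarrow> \<phi> x = \<phi> y \<longleftrightarrow> x = y"
  using rep_inj by (auto dest: inj_onD)

lemma mult_assoc:
  "\<lbrakk>x \<in> carrier S; y \<in> carrier S; z \<in> carrier S\<rbrakk> \<Longrightarrow> (x \<cdot> y) \<cdot> z = x \<cdot> (y \<cdot> z)"
  by (subst rep_eq_iff[symmetric]) (simp_all add: mult_closed rep_mult O_assoc)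

lemma is_inverse_iff:
  assumes "x \<in> carrier S" "y \<in> carrier S"
  shows "is_inverse S x y \<longleftrightarrow> \<phi> y = (\<phi> x)\<inverse>"
proof -
  have "is_inverse S x y \<longleftrightarrow> \<phi> x = \<phi> x O \<phi> y O \<phi> x \<and> \<phi> y = \<phi> y O \<phi> x O \<phi> y"
    unfolding is_inverse_def using assms
    by (subst (1 2) rep_eq_iff[symmetric]) (simp_all add: mult_closed rep_mult)
  also have "\<dots> \<longleftrightarrow> \<phi> y = (\<phi> x)\<inverse>"
  proof
    assume "\<phi> x = \<phi> x O \<phi> y O \<phi> x \<and> \<phi> y = \<phi> y O \<phi> x O \<phi> y"
    then show "\<phi> y = (\<phi> x)\<inverse>" using pinj_inverse_unique rep_pinj assms by blast
  next
    assume eq: "\<phi> y = (\<phi> x)\<inverse>"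
    have "R = R O R\<inverse> O R" if "pinj R" for R :: "'p rel"
      by (simp only: pinj_converse_O[OF that] O_Id_on) auto
    from this[of "\<phi> x"] this[of "\<phi> y"]
    show "\<phi> x = \<phi> x O \<phi> y O \<phi> x \<and> \<phi> y = \<phi> y O \<phi> x O \<phi> y"
      using rep_pinj[OF assms(1)] by (simp add: eq pinj_converse)
  qed
  finally show ?thesis .
qed

lemma inverse_semigroup: "inverse_semigroup S"
proof
  fix x assume x: "x \<in> carrier S"
  with rep_inv_ex obtain y where y: "y \<in> carrier S" "\<phi> y = (\<phi> x)\<inverse>" by blast
  show "\<exists>!y. y \<in> carrier S \<and> is_inverse S x y"
  proof (rule ex1I[of _ y])
    fix y' assume "y' \<in> carrier S \<and> is_inverse S x y'"
    with x y show "y' = y" using is_inverse_iff[of x y'] rep_eq_iff[of y' y] by simp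
  qed (use x y is_inverse_iff in auto)
qed (rule mult_closed mult_assoc; assumption)+

lemma sinv: assumes "x \<in> carrier S"
  shows sinv_closed: "sinv S x \<in> carrier S" and rep_sinv: "\<phi> (sinv S x) = (\<phi> x)\<inverse>"
proof -
  have "sinv S x \<in> carrier S \<and> is_inverse S x (sinv S x)"
    unfolding sinv_def
    by (rule theI') (rule inverse_semigroup.ex1_inverse[OF inverse_semigroup assms])
  with assms is_inverse_iff show "sinv S x \<in> carrier S" "\<phi> (sinv S x) = (\<phi> x)\<inverse>" by auto
qed

lemma dom_idp_closed: "x \<in> carrier S \<Longrightarrow> dom_idp S x \<in> carrier S"
  and ran_idp_closed: "x \<in> carrier S \<Longrightarrow> ran_idp S x \<in> carrier S"
  by (simp_all add: dom_idp_def ran_idp_def mult_closed sinv_closed)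

lemma rep_dom_idp: "x \<in> carrier S \<Longrightarrow> \<phi> (dom_idp S x) = Id_on (Domain (\<phi> x))"
  and rep_ran_idp: "x \<in> carrier S \<Longrightarrow> \<phi> (ran_idp S x) = Id_on (Range (\<phi> x))"
  by (simp_all add: dom_idp_def ran_idp_def rep_mult sinv_closed rep_sinv rep_pinj
      pinj_O_converse pinj_converse_O)

lemma Idp_iff: "e \<in> Idp S \<longleftrightarrow> e \<in> carrier S \<and> \<phi> e \<subseteq> Id"
proof (cases "e \<in> carrier S")
  case True
  then show ?thesis
    using rep_eq_iff[of "e \<cdot> e" e] pinj_idem_iff[of "\<phi> e"]
    by (simp add: Idp_def mult_closed rep_mult rep_pinj)
qed (simp add: Idp_def)

lemma Idp_carrier: "e \<in> Idp S \<Longrightarrow> e \<in> carrier S"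
  by (simp add: Idp_def)

lemma Idp_subset: "Idp S \<subseteq> carrier S"
  by (auto simp: Idp_def)

lemma nat_order_simps [simp]:
  "carrier (nat_order S A) = A" "x .=\<^bsub>nat_order S A\<^esub> y \<longleftrightarrow> x = y"
  by (simp_all add: nat_order_def)

lemma nat_order_le_iff:
  assumes "x \<in> carrier S" "y \<in> carrier S"
  shows "x \<sqsubseteq>\<^bsub>nat_order S A\<^esub> y \<longleftrightarrow> \<phi> x \<subseteq> \<phi> y"
proof -
  have "x \<sqsubseteq>\<^bsub>nat_order S A\<^esub> y \<longleftrightarrow> \<phi> x = Id_on (Domain (\<phi> x)) O \<phi> y"
    using assms rep_eq_iff[of x "y \<cdot> dom_idp S x"]
    by (simp add: nat_order_def mult_closed dom_idp_closed rep_mult rep_dom_idp)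
  then show ?thesis using pinj_subset_iff[of "\<phi> y" "\<phi> x"] rep_pinj assms by simp
qed

lemma partial_order_nat_order:
  assumes "A \<subseteq> carrier S" shows "partial_order (nat_order S A)"
proof
  note le = nat_order_le_iff[OF subsetD[OF assms] subsetD[OF assms]]
  show "x .=\<^bsub>nat_order S A\<^esub> y"
    if "x \<sqsubseteq>\<^bsub>nat_order S A\<^esub> y" "y \<sqsubseteq>\<^bsub>nat_order S A\<^esub> x"
      "x \<in> carrier (nat_order S A)" "y \<in> carrier (nat_order S A)" for x y
  proof -
    have "\<phi> x = \<phi> y" using that by (simp add: le subset_antisym)
    with that assms show ?thesis using rep_eq_iff[of x y] by auto
  qed
  show "x \<sqsubseteq>\<^bsub>nat_order S A\<^esub> z"
    if "x \<sqsubseteq>\<^bsub>nat_order S A\<^esub> y" "y \<sqsubseteq>\<^bsub>nat_order S A\<^esub> z"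
      "x \<in> carrier (nat_order S A)" "y \<in> carrier (nat_order S A)" "z \<in> carrier (nat_order S A)"
    for x y z
    using that by (auto simp: le)
qed (simp_all add: fun_eq_iff nat_order_le_iff[OF subsetD[OF assms] subsetD[OF assms]])

lemma least_nat_order:
  assumes "A \<subseteq> carrier S" "x \<in> A" "y \<in> A" "z \<in> A" "\<phi> z = \<phi> x \<union> \<phi> y"
  shows "least (nat_order S A) z (Upper (nat_order S A) {x, y})"
proof -
  have "u \<in> Upper (nat_order S A) {x, y} \<longleftrightarrow>
      u \<in> A \<and> x \<sqsubseteq>\<^bsub>nat_order S A\<^esub> u \<and> y \<sqsubseteq>\<^bsub>nat_order S A\<^esub> u" for u
    using assms(2,3) by (auto simp: Upper_def)
  then have U: "Upper (nat_order S A) {x, y} = {u \<in> A. \<phi> x \<subseteq> \<phi> u \<and> \<phi> y \<subseteq> \<phi> u}"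
    using assms(2,3)
    by (simp add: set_eq_iff nat_order_le_iff[OF subsetD[OF assms(1)] subsetD[OF assms(1)]]
        cong: conj_cong)
  show ?thesis using assms(2-5)
    by (simp add: U least_def nat_order_le_iff[OF subsetD[OF assms(1)] subsetD[OF assms(1)]])
qed

lemma greatest_nat_order:
  assumes "A \<subseteq> carrier S" "x \<in> A" "y \<in> A" "z \<in> A" "\<phi> z = \<phi> x \<inter> \<phi> y"
  shows "greatest (nat_order S A) z (Lower (nat_order S A) {x, y})"
proof -
  have "u \<in> Lower (nat_order S A) {x, y} \<longleftrightarrow>
      u \<in> A \<and> u \<sqsubseteq>\<^bsub>nat_order S A\<^esub> x \<and> u \<sqsubseteq>\<^bsub>nat_order S A\<^esub> y" for u
    using assms(2,3) by (auto simp: Lower_def)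
  then have U: "Lower (nat_order S A) {x, y} = {u \<in> A. \<phi> u \<subseteq> \<phi> x \<and> \<phi> u \<subseteq> \<phi> y}"
    using assms(2,3)
    by (simp add: set_eq_iff nat_order_le_iff[OF subsetD[OF assms(1)] subsetD[OF assms(1)]]
        cong: conj_cong)
  show ?thesis using assms(2-5)
    by (simp add: U greatest_def nat_order_le_iff[OF subsetD[OF assms(1)] subsetD[OF assms(1)]])
qed

lemma join_nat_order:
  assumes "A \<subseteq> carrier S" "x \<in> A" "y \<in> A" "z \<in> A" "\<phi> z = \<phi> x \<union> \<phi> y"
  shows "x \<squnion>\<^bsub>nat_order S A\<^esub> y = z"
proof -
  interpret partial_order "nat_order S A" using assms(1) by (rule partial_order_nat_order)
  note l = least_nat_order[OF assms]
  show ?thesis unfolding join_def sup_def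
    by (rule some_equality, rule l) (rule least_unique[OF _ l])
qed

lemma meet_nat_order:
  assumes "A \<subseteq> carrier S" "x \<in> A" "y \<in> A" "z \<in> A" "\<phi> z = \<phi> x \<inter> \<phi> y"
  shows "x \<sqinter>\<^bsub>nat_order S A\<^esub> y = z"
proof -
  interpret partial_order "nat_order S A" using assms(1) by (rule partial_order_nat_order)
  note l = greatest_nat_order[OF assms]
  show ?thesis unfolding meet_def inf_def
    by (rule some_equality, rule l) (rule greatest_unique[OF _ l])
qed

lemma Idp_meet:
  assumes "e \<in> Idp S" "f \<in> Idp S"
  shows "e \<cdot> f \<in> Idp S" "\<phi> (e \<cdot> f) = \<phi> e \<inter> \<phi> f" "e \<sqinter>\<^bsub>nat_order S (Idp S)\<^esub> f = e \<cdot> f"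
proof -
  show 1: "\<phi> (e \<cdot> f) = \<phi> e \<inter> \<phi> f"
    using assms by (simp add: Idp_iff rep_mult subid_relcomp)
  then show 2: "e \<cdot> f \<in> Idp S" using assms by (auto simp: Idp_iff mult_closed)
  show "e \<sqinter>\<^bsub>nat_order S (Idp S)\<^esub> f = e \<cdot> f"
    by (rule meet_nat_order[OF Idp_subset assms 2 1])
qed

lemma Idp_join:
  assumes "e \<in> Idp S" "f \<in> Idp S"
  shows "e \<squnion>\<^bsub>nat_order S (Idp S)\<^esub> f \<in> Idp S" "\<phi> (e \<squnion>\<^bsub>nat_order S (Idp S)\<^esub> f) = \<phi> e \<union> \<phi> f"
proof -
  obtain z where z: "z \<in> carrier S" "\<phi> z = radd (\<phi> e) (\<phi> f)"
    using rep_add_ex assms Idp_iff by blast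
  then have z': "z \<in> Idp S" "\<phi> z = \<phi> e \<union> \<phi> f" using assms by (auto simp: Idp_iff subid_radd)
  then show "e \<squnion>\<^bsub>nat_order S (Idp S)\<^esub> f \<in> Idp S" "\<phi> (e \<squnion>\<^bsub>nat_order S (Idp S)\<^esub> f) = \<phi> e \<union> \<phi> f"
    using join_nat_order[OF Idp_subset assms z'] by simp_all
qed

lemma Idp_diff:
  assumes "e \<in> Idp S" "f \<in> Idp S"
  obtains z where "z \<in> Idp S" "\<phi> z = \<phi> e - \<phi> f"
proof -
  obtain z where z: "z \<in> carrier S" "\<phi> z = rdiff (\<phi> e) (\<phi> f)"
    using rep_diff_ex assms Idp_iff by blast
  then have "z \<in> Idp S" "\<phi> z = \<phi> e - \<phi> f" using assms by (auto simp: Idp_iff subid_rdiff)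
  then show ?thesis by (rule that)
qed

lemma is_zero_iff:
  assumes "z \<in> carrier S" shows "is_zero S z \<longleftrightarrow> \<phi> z = {}"
proof
  assume "is_zero S z"
  moreover obtain y where y: "y \<in> carrier S" "\<phi> y = {}" using rep_zero_ex by blast
  ultimately have "z = z \<cdot> y" by (auto simp: is_zero_def)
  then have "\<phi> z = \<phi> (z \<cdot> y)" by simp
  with y assms show "\<phi> z = {}" by (simp add: rep_mult)
next
  assume "\<phi> z = {}"
  then show "is_zero S z"
    unfolding is_zero_def using assms
    by (auto simp: rep_eq_iff[symmetric] mult_closed rep_mult)
qed

lemma szero: shows szero_closed: "szero S \<in> carrier S" and rep_szero: "\<phi> (szero S) = {}"
proof -
  obtain y where y: "y \<in> carrier S" "\<phi> y = {}" using rep_zero_ex by blast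
  have "szero S = y" unfolding szero_def
  proof (rule the_equality)
    show "is_zero S y" using y is_zero_iff by simp
    show "z = y" if "is_zero S z" for z
    proof -
      from that have "z \<in> carrier S" by (simp add: is_zero_def)
      with that y show ?thesis using is_zero_iff[of z] rep_eq_iff[of z y] by simp
    qed
  qed
  with y show "szero S \<in> carrier S" "\<phi> (szero S) = {}" by simp_all
qed

lemma bottom_Idp: "\<bottom>\<^bsub>nat_order S (Idp S)\<^esub> = szero S"
  and weak_partial_order_bottom_Idp: "weak_partial_order_bottom (nat_order S (Idp S))"
proof -
  interpret partial_order "nat_order S (Idp S)"
    by (rule partial_order_nat_order[OF Idp_subset])
  have l: "least (nat_order S (Idp S)) (szero S) (carrier (nat_order S (Idp S)))"
    using Idp_subset by (auto simp: least_def szero_closed rep_szero Idp_iff nat_order_le_iff)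
  then show "weak_partial_order_bottom (nat_order S (Idp S))"
    by unfold_locales blast
  show "\<bottom>\<^bsub>nat_order S (Idp S)\<^esub> = szero S"
    unfolding bottom_def by (rule some_equality, rule l) (rule least_unique[OF _ l])
qed

lemma lattice_Idp: "lattice (nat_order S (Idp S))"
proof -
  interpret partial_order "nat_order S (Idp S)"
    by (rule partial_order_nat_order[OF Idp_subset])
  show ?thesis
  proof
    fix e f assume *: "e \<in> carrier (nat_order S (Idp S))" "f \<in> carrier (nat_order S (Idp S))"
    then show "\<exists>s. is_lub (nat_order S (Idp S)) s {e, f}"
      using least_nat_order[OF Idp_subset _ _ Idp_join] by auto
    show "\<exists>s. is_glb (nat_order S (Idp S)) s {e, f}"
      using * greatest_nat_order[OF Idp_subset _ _ Idp_meet(1,2)] by auto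
  qed
qed

text \<open>
  The idempotents are the subrelations of the identity in the image of \<open>\<phi>\<close>, which form a ring of
  sets: distributivity and relative complements are those of sets.
\<close>

lemma generalized_boolean_algebra_Idp: "generalized_boolean_algebra (nat_order S (Idp S))"
proof -
  interpret lattice "nat_order S (Idp S)" by (rule lattice_Idp)
  interpret weak_partial_order_bottom "nat_order S (Idp S)"
    by (rule weak_partial_order_bottom_Idp)
  note inj = rep_eq_iff[THEN iffD1, OF Idp_subset[THEN subsetD] Idp_subset[THEN subsetD]]
  show ?thesis
  proof
    fix a b c
    assume "a \<in> carrier (nat_order S (Idp S))" "b \<in> carrier (nat_order S (Idp S))"
      "c \<in> carrier (nat_order S (Idp S))"
    then show "a \<sqinter>\<^bsub>nat_order S (Idp S)\<^esub> (b \<squnion>\<^bsub>nat_order S (Idp S)\<^esub> c) =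
      a \<sqinter>\<^bsub>nat_order S (Idp S)\<^esub> b \<squnion>\<^bsub>nat_order S (Idp S)\<^esub> a \<sqinter>\<^bsub>nat_order S (Idp S)\<^esub> c"
      by (intro inj) (auto simp: Idp_meet Idp_join)
  next
    fix a b
    assume *: "a \<in> carrier (nat_order S (Idp S))" "b \<in> carrier (nat_order S (Idp S))"
      "a \<sqsubseteq>\<^bsub>nat_order S (Idp S)\<^esub> b"
    then obtain c where c: "c \<in> Idp S" "\<phi> c = \<phi> b - \<phi> a" by (auto elim: Idp_diff)
    have le: "\<phi> a \<subseteq> \<phi> b" using * by (simp add: nat_order_le_iff Idp_carrier)
    have "a \<sqinter>\<^bsub>nat_order S (Idp S)\<^esub> c = szero S"
      by (intro inj) (use c * in \<open>auto simp: Idp_meet rep_szero Idp_iff[of "szero S"] szero_closed\<close>)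
    moreover have "a \<squnion>\<^bsub>nat_order S (Idp S)\<^esub> c = b"
      by (intro inj) (use c * le in \<open>auto simp: Idp_join\<close>)
    ultimately show "\<exists>c\<in>carrier (nat_order S (Idp S)).
      a \<sqinter>\<^bsub>nat_order S (Idp S)\<^esub> c = \<bottom>\<^bsub>nat_order S (Idp S)\<^esub> \<and>
      a \<squnion>\<^bsub>nat_order S (Idp S)\<^esub> c = b"
      using c by (auto simp: bottom_Idp)
  qed
qed

lemma orthogonal_iff:
  assumes "x \<in> carrier S" "y \<in> carrier S"
  shows "orthogonal S x y \<longleftrightarrow> \<phi> y O (\<phi> x)\<inverse> = {} \<and> (\<phi> y)\<inverse> O \<phi> x = {}"
  unfolding orthogonal_def using assms
  by (simp add: rep_eq_iff[symmetric] mult_closed sinv_closed szero_closed rep_mult rep_sinv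
      rep_szero)

lemma orth_radd:
  "\<phi> y O (\<phi> x)\<inverse> = {} \<Longrightarrow> (\<phi> y)\<inverse> O \<phi> x = {} \<Longrightarrow> radd (\<phi> x) (\<phi> y) = \<phi> x \<union> \<phi> y"
  unfolding radd_def rdiff_def by blast

lemma orth_join:
  assumes "x \<in> carrier S" "y \<in> carrier S" "orthogonal S x y"
  obtains z where "z \<in> carrier S" "\<phi> z = \<phi> x \<union> \<phi> y" "orth_join S x y = z"
    "is_lub (nat_order S (carrier S)) z {x, y}"
proof -
  obtain z where z: "z \<in> carrier S" "\<phi> z = radd (\<phi> x) (\<phi> y)"
    using rep_add_ex assms by blast
  then have z': "\<phi> z = \<phi> x \<union> \<phi> y" using assms orthogonal_iff orth_radd by simp
  show ?thesis
    by (rule that[OF z(1) z'])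
      (simp_all add: orth_join_def join_nat_order[OF _ _ _ _ z'] least_nat_order[OF _ _ _ _ z'] assms z)
qed

theorem boolean_inverse_semigroup: "boolean_inverse_semigroup S"
proof (intro boolean_inverse_semigroup.intro boolean_inverse_semigroup_axioms.intro)
  show "\<exists>z. is_zero S z" using szero is_zero_iff by blast
  show "\<exists>s. is_lub (nat_order S (carrier S)) s {x, y}"
    if "x \<in> carrier S" "y \<in> carrier S" "orthogonal S x y" for x y
    using orth_join[OF that] by metis
qed (rule inverse_semigroup generalized_boolean_algebra_Idp)+

lemma rep_bool_diff:
  assumes "e \<in> Idp S" "f \<in> Idp S"
  shows bool_diff_closed: "bool_diff (nat_order S (Idp S)) e f \<in> Idp S"
    and rep_bool_diff_eq: "\<phi> (bool_diff (nat_order S (Idp S)) e f) = \<phi> e - \<phi> f"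
proof -
  note inj = rep_eq_iff[OF Idp_subset[THEN subsetD] Idp_subset[THEN subsetD], symmetric]
  obtain c where c: "c \<in> Idp S" "\<phi> c = \<phi> e - \<phi> f" using assms by (rule Idp_diff)
  have zero: "szero S \<in> Idp S" by (simp add: Idp_iff szero_closed rep_szero)
  have "bool_diff (nat_order S (Idp S)) e f = c"
    unfolding bool_diff_def
  proof (rule the_equality)
    show "c \<in> carrier (nat_order S (Idp S)) \<and>
      f \<sqinter>\<^bsub>nat_order S (Idp S)\<^esub> c = \<bottom>\<^bsub>nat_order S (Idp S)\<^esub> \<and>
      e \<sqinter>\<^bsub>nat_order S (Idp S)\<^esub> f \<squnion>\<^bsub>nat_order S (Idp S)\<^esub> c = e"
      using assms c zero by (auto simp: bottom_Idp Idp_meet Idp_join inj rep_szero)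
    show "c' = c" if c': "c' \<in> carrier (nat_order S (Idp S)) \<and>
      f \<sqinter>\<^bsub>nat_order S (Idp S)\<^esub> c' = \<bottom>\<^bsub>nat_order S (Idp S)\<^esub> \<and>
      e \<sqinter>\<^bsub>nat_order S (Idp S)\<^esub> f \<squnion>\<^bsub>nat_order S (Idp S)\<^esub> c' = e" for c'
    proof -
      from c' have 1: "c' \<in> Idp S" "f \<sqinter>\<^bsub>nat_order S (Idp S)\<^esub> c' = szero S"
        "e \<sqinter>\<^bsub>nat_order S (Idp S)\<^esub> f \<squnion>\<^bsub>nat_order S (Idp S)\<^esub> c' = e"
        by (simp_all add: bottom_Idp)
      have "\<phi> f \<inter> \<phi> c' = \<phi> (f \<sqinter>\<^bsub>nat_order S (Idp S)\<^esub> c')"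
        using assms 1(1) by (simp add: Idp_meet)
      moreover have "\<phi> e \<inter> \<phi> f \<union> \<phi> c' =
          \<phi> (e \<sqinter>\<^bsub>nat_order S (Idp S)\<^esub> f \<squnion>\<^bsub>nat_order S (Idp S)\<^esub> c')"
        using assms 1(1) by (simp add: Idp_meet Idp_join)
      ultimately have "\<phi> c' = \<phi> c" using c(2) unfolding 1 rep_szero by blast
      then show ?thesis using 1(1) c(1) by (simp add: inj)
    qed
  qed
  with c show "bool_diff (nat_order S (Idp S)) e f \<in> Idp S"
    "\<phi> (bool_diff (nat_order S (Idp S)) e f) = \<phi> e - \<phi> f" by simp_all
qed

lemma rep_skew_diff:
  assumes "x \<in> carrier S" "y \<in> carrier S"
  shows can_skew_diff_closed: "can_skew_diff S x y \<in> carrier S"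
    and rep_can_skew_diff: "\<phi> (can_skew_diff S x y) = rdiff (\<phi> x) (\<phi> y)"
proof -
  have "dom_idp S x \<in> Idp S" "ran_idp S x \<in> Idp S" "dom_idp S y \<in> Idp S" "ran_idp S y \<in> Idp S"
    using assms by (auto simp: Idp_iff dom_idp_closed ran_idp_closed rep_dom_idp rep_ran_idp)
  note d = rep_bool_diff[OF this(1,3)] rep_bool_diff[OF this(2,4)]
  with Idp_subset assms show "can_skew_diff S x y \<in> carrier S"
    unfolding can_skew_diff_def by (blast intro: mult_closed)
  show "\<phi> (can_skew_diff S x y) = rdiff (\<phi> x) (\<phi> y)"
    using d Idp_subset assms
    by (auto simp: can_skew_diff_def rep_mult mult_closed rep_dom_idp rep_ran_idp subset_iff[of "Idp S"]
        rdiff_def)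
qed

text \<open>
  The summands \<open>x \<oslash> y\<close> and \<open>y\<close> are orthogonal since \<open>x \<oslash> y\<close> has no source or target in common with
  \<open>y\<close>; hence the orthogonal join is the union.
\<close>

lemma rep_skew_add:
  assumes "x \<in> carrier S" "y \<in> carrier S"
  shows can_skew_add_closed: "can_skew_add S x y \<in> carrier S"
    and rep_can_skew_add: "\<phi> (can_skew_add S x y) = radd (\<phi> x) (\<phi> y)"
proof -
  note d = rep_skew_diff[OF assms]
  have "orthogonal S (can_skew_diff S x y) y"
    using d assms by (auto simp: orthogonal_iff rdiff_def)
  then obtain z where "z \<in> carrier S" "\<phi> z = \<phi> (can_skew_diff S x y) \<union> \<phi> y"
    "orth_join S (can_skew_diff S x y) y = z"
    using orth_join d(1) assms(2) by metis
  with d show "can_skew_add S x y \<in> carrier S"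
    "\<phi> (can_skew_add S x y) = radd (\<phi> x) (\<phi> y)"
    by (simp_all add: can_skew_add_def radd_def)
qed

end

section \<open>Inverse semigroups\<close>

context inverse_semigroup
begin

lemma inverse_props:
  assumes "x \<in> carrier S"
  shows sinv_closed: "sinv S x \<in> carrier S"
    and mult_sinv_mult: "x \<cdot> (sinv S x \<cdot> x) = x"
    and sinv_mult_sinv: "sinv S x \<cdot> (x \<cdot> sinv S x) = sinv S x"
proof -
  have *: "sinv S x \<in> carrier S \<and> is_inverse S x (sinv S x)"
    unfolding sinv_def by (rule theI') (rule ex1_inverse[OF assms])
  then show c: "sinv S x \<in> carrier S" ..
  from * show "x \<cdot> (sinv S x \<cdot> x) = x" "sinv S x \<cdot> (x \<cdot> sinv S x) = sinv S x"
    using assms c by (metis is_inverse_def mult_assoc)+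
qed

lemma sinv_eqI:
  assumes "x \<in> carrier S" "y \<in> carrier S" "x \<cdot> (y \<cdot> x) = x" "y \<cdot> (x \<cdot> y) = y"
  shows "sinv S x = y"
proof -
  have "is_inverse S x y" using assms by (simp add: is_inverse_def mult_assoc)
  moreover have "is_inverse S x (sinv S x)"
    using inverse_props[OF assms(1)] assms(1) by (simp add: is_inverse_def mult_assoc)
  ultimately show ?thesis using ex1_inverse[OF assms(1)] assms(2) sinv_closed[OF assms(1)] by blast
qed

lemma sinv_sinv: "x \<in> carrier S \<Longrightarrow> sinv S (sinv S x) = x"
  by (rule sinv_eqI) (simp_all add: inverse_props)

lemma IdpD: "e \<in> Idp S \<Longrightarrow> e \<in> carrier S" "e \<in> Idp S \<Longrightarrow> e \<cdot> e = e"
  by (simp_all add: Idp_def)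

lemma idem_left: "e \<in> Idp S \<Longrightarrow> x \<in> carrier S \<Longrightarrow> e \<cdot> (e \<cdot> x) = e \<cdot> x"
  by (simp add: mult_assoc[symmetric] IdpD)

lemma sinv_idem: "e \<in> Idp S \<Longrightarrow> sinv S e = e"
  by (rule sinv_eqI) (simp_all add: IdpD)

text \<open>
  The classical argument: the inverse \<open>x\<close> of a product \<open>e \<cdot> f\<close> of idempotents equals \<open>f \<cdot> x \<cdot> e\<close>,
  hence is idempotent, hence so is \<open>e \<cdot> f\<close>; and then \<open>f \<cdot> e\<close> is also an inverse of \<open>e \<cdot> f\<close>.
\<close>

lemma Idp_mult_closed:
  assumes e: "e \<in> Idp S" and f: "f \<in> Idp S" shows "e \<cdot> f \<in> Idp S"
proof -
  note c = IdpD(1)[OF e] IdpD(1)[OF f]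
  define x where "x = sinv S (e \<cdot> f)"
  have x: "x \<in> carrier S" by (simp add: x_def sinv_closed mult_closed c)
  have 1: "e \<cdot> (f \<cdot> (x \<cdot> (e \<cdot> f))) = e \<cdot> f"
    using mult_sinv_mult[of "e \<cdot> f"] c x by (simp add: x_def mult_assoc mult_closed)
  have 2: "x \<cdot> (e \<cdot> (f \<cdot> x)) = x"
    using sinv_mult_sinv[of "e \<cdot> f"] c x by (simp add: x_def mult_assoc mult_closed)
  have 3: "x \<cdot> (e \<cdot> (f \<cdot> (x \<cdot> z))) = x \<cdot> z" if "z \<in> carrier S" for z
    using arg_cong[OF 2, of "\<lambda>t. t \<cdot> z"] c x that by (simp add: mult_assoc mult_closed)
  have "sinv S (e \<cdot> f) = f \<cdot> (x \<cdot> e)"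
    by (rule sinv_eqI) (simp_all add: mult_assoc mult_closed c x idem_left e f 1 3)
  then have fxe: "x = f \<cdot> (x \<cdot> e)" by (simp add: x_def)
  have "x \<cdot> x = (f \<cdot> (x \<cdot> e)) \<cdot> (f \<cdot> (x \<cdot> e))" by (simp flip: fxe)
  also have "\<dots> = f \<cdot> (x \<cdot> e)" by (simp add: mult_assoc mult_closed c x 3)
  finally have "x \<in> Idp S" using fxe x by (simp add: Idp_def)
  then have "sinv S x = x" by (rule sinv_idem)
  moreover have "sinv S x = e \<cdot> f" by (simp add: x_def sinv_sinv mult_closed c)
  ultimately show ?thesis using \<open>x \<in> Idp S\<close> by simp
qed

lemma Idp_commute:
  assumes e: "e \<in> Idp S" and f: "f \<in> Idp S" shows "e \<cdot> f = f \<cdot> e"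
proof -
  note c = IdpD(1)[OF e] IdpD(1)[OF f]
  note ef = IdpD(2)[OF Idp_mult_closed[OF e f]] IdpD(2)[OF Idp_mult_closed[OF f e]]
  have "sinv S (e \<cdot> f) = f \<cdot> e"
    by (rule sinv_eqI) (use ef in \<open>simp_all add: mult_assoc mult_closed c idem_left e f\<close>)
  then show ?thesis using sinv_idem[OF Idp_mult_closed[OF e f]] by simp
qed

lemma Idp_left_commute:
  assumes "e \<in> Idp S" "f \<in> Idp S" "x \<in> carrier S"
  shows "e \<cdot> (f \<cdot> x) = f \<cdot> (e \<cdot> x)"
  using assms by (simp add: mult_assoc[symmetric] IdpD Idp_commute[of e f])

lemma dom_Idp: "x \<in> carrier S \<Longrightarrow> dom_idp S x \<in> Idp S"
  and ran_Idp: "x \<in> carrier S \<Longrightarrow> ran_idp S x \<in> Idp S"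
  by (simp_all add: dom_idp_def ran_idp_def Idp_def mult_closed mult_assoc sinv_closed inverse_props)

lemma mult_dom: "x \<in> carrier S \<Longrightarrow> x \<cdot> dom_idp S x = x"
  by (simp add: dom_idp_def inverse_props)

lemma ran_mult: "x \<in> carrier S \<Longrightarrow> ran_idp S x \<cdot> x = x"
  by (simp add: ran_idp_def inverse_props mult_assoc sinv_closed)

lemma dom_sinv: "x \<in> carrier S \<Longrightarrow> dom_idp S x \<cdot> sinv S x = sinv S x"
  by (simp add: dom_idp_def inverse_props mult_assoc sinv_closed)

lemma sinv_ran: "x \<in> carrier S \<Longrightarrow> sinv S x \<cdot> ran_idp S x = sinv S x"
  by (simp add: ran_idp_def inverse_props)

lemma dom_of_Idp: "e \<in> Idp S \<Longrightarrow> dom_idp S e = e"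
  by (simp add: dom_idp_def sinv_idem IdpD)

lemma sinv_mult:
  assumes x: "x \<in> carrier S" and y: "y \<in> carrier S"
  shows "sinv S (x \<cdot> y) = sinv S y \<cdot> sinv S x"
proof (rule sinv_eqI)
  note s = x y sinv_closed[OF x] sinv_closed[OF y]
  note xx = dom_Idp[OF x] ran_Idp[OF y]
  have "x \<cdot> y \<cdot> (sinv S y \<cdot> sinv S x \<cdot> (x \<cdot> y)) = x \<cdot> (ran_idp S y \<cdot> (dom_idp S x \<cdot> y))"
    using s by (simp add: dom_idp_def ran_idp_def mult_assoc mult_closed)
  also have "\<dots> = (x \<cdot> dom_idp S x) \<cdot> (ran_idp S y \<cdot> y)"
    using s by (simp add: Idp_left_commute[OF xx(2) xx(1)] mult_assoc mult_closed IdpD(1) xx)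
  finally show "x \<cdot> y \<cdot> (sinv S y \<cdot> sinv S x \<cdot> (x \<cdot> y)) = x \<cdot> y" by (simp add: mult_dom ran_mult s)
  have "sinv S y \<cdot> sinv S x \<cdot> (x \<cdot> y \<cdot> (sinv S y \<cdot> sinv S x)) =
      sinv S y \<cdot> (dom_idp S x \<cdot> (ran_idp S y \<cdot> sinv S x))"
    using s by (simp add: dom_idp_def ran_idp_def mult_assoc mult_closed)
  also have "\<dots> = (sinv S y \<cdot> ran_idp S y) \<cdot> (dom_idp S x \<cdot> sinv S x)"
    using s by (simp add: Idp_left_commute[OF xx(1) xx(2)] mult_assoc mult_closed IdpD(1) xx)
  finally show "sinv S y \<cdot> sinv S x \<cdot> (x \<cdot> y \<cdot> (sinv S y \<cdot> sinv S x)) = sinv S y \<cdot> sinv S x"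
    by (simp add: dom_sinv sinv_ran s)
qed (simp_all add: x y mult_closed sinv_closed)

lemma dom_mult:
  assumes "x \<in> carrier S" "y \<in> carrier S"
  shows "dom_idp S (x \<cdot> y) = sinv S y \<cdot> (dom_idp S x \<cdot> y)"
  using assms by (simp add: dom_idp_def sinv_mult mult_assoc mult_closed sinv_closed)

lemma dom_mult_Idp:
  assumes "x \<in> carrier S" "e \<in> Idp S"
  shows "dom_idp S (x \<cdot> e) = dom_idp S x \<cdot> e"
  using assms Idp_left_commute[of e "dom_idp S x" e]
  by (simp add: dom_mult IdpD sinv_idem dom_Idp)

lemma dom_Idp_mult:
  assumes "e \<in> Idp S" "x \<in> carrier S"
  shows "dom_idp S (e \<cdot> x) = sinv S x \<cdot> (e \<cdot> x)"
  using assms by (simp add: dom_mult IdpD dom_of_Idp)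

text \<open>
  An idempotent moves across \<open>x\<close> by conjugation: \<open>e \<cdot> x = x \<cdot> (x\<inverse> \<cdot> e \<cdot> x)\<close>, and the conjugate is
  the domain of \<open>e \<cdot> x\<close>.
\<close>

lemma Idp_mult_eq_mult_dom:
  assumes "e \<in> Idp S" "x \<in> carrier S"
  shows "e \<cdot> x = x \<cdot> dom_idp S (e \<cdot> x)"
proof -
  have "x \<cdot> dom_idp S (e \<cdot> x) = ran_idp S x \<cdot> (e \<cdot> x)"
    using assms by (simp add: dom_Idp_mult ran_idp_def mult_assoc mult_closed sinv_closed IdpD)
  also have "\<dots> = e \<cdot> x"
    using assms by (simp add: Idp_left_commute[OF ran_Idp] ran_mult)
  finally show ?thesis ..
qed

lemma dom_mult_le:
  assumes "a \<in> carrier S" "x \<in> carrier S"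
  shows "dom_idp S (a \<cdot> x) = dom_idp S x \<cdot> dom_idp S (a \<cdot> x)"
  using assms dom_mult_Idp[of "a \<cdot> x" "dom_idp S x"]
  by (simp add: mult_assoc dom_Idp mult_dom IdpD mult_closed Idp_commute[of "dom_idp S x"])

lemma nat_order_le: "x \<sqsubseteq>\<^bsub>nat_order S A\<^esub> y \<longleftrightarrow> x = y \<cdot> dom_idp S x"
  by (simp add: nat_order_def)

end

section \<open>Idempotents and orthogonal joins in a Boolean inverse semigroup\<close>

context boolean_inverse_semigroup
begin

abbreviation jn :: "'a \<Rightarrow> 'a \<Rightarrow> 'a" where "jn \<equiv> join (nat_order S (Idp S))"
abbreviation df :: "'a \<Rightarrow> 'a \<Rightarrow> 'a" where "df \<equiv> bool_diff (nat_order S (Idp S))"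

lemma szero_is_zero: "is_zero S (szero S)"
proof -
  obtain z where z: "is_zero S z" using zero_exists by blast
  then have "z' = z" if "is_zero S z'" for z' using that by (metis is_zero_def)
  with z show ?thesis unfolding szero_def by (metis theI)
qed

lemma szero_closed: "szero S \<in> carrier S"
  and szero_mult: "x \<in> carrier S \<Longrightarrow> szero S \<cdot> x = szero S"
  and mult_szero: "x \<in> carrier S \<Longrightarrow> x \<cdot> szero S = szero S"
  using szero_is_zero by (auto simp: is_zero_def)

lemma szero_Idp: "szero S \<in> Idp S"
  by (simp add: Idp_def szero_closed szero_mult)

interpretation gba: generalized_boolean_algebra "nat_order S (Idp S)"
  by (rule Idp_generalized_boolean)

lemma carrier_nat_order: "carrier (nat_order S A) = A"
  by (simp add: nat_order_def)

lemma Idp_le: "e \<in> Idp S \<Longrightarrow> e \<sqsubseteq>\<^bsub>nat_order S A\<^esub> f \<longleftrightarrow> e = f \<cdot> e"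
  by (simp add: nat_order_le dom_of_Idp)

lemma lub_nat_order:
  assumes "x \<in> carrier S" "y \<in> carrier S" "is_lub (nat_order S (carrier S)) z {x, y}"
  shows "z \<in> carrier S" "x = z \<cdot> dom_idp S x" "y = z \<cdot> dom_idp S y"
    "\<lbrakk>u \<in> carrier S; x = u \<cdot> dom_idp S x; y = u \<cdot> dom_idp S y\<rbrakk> \<Longrightarrow> z = u \<cdot> dom_idp S z"
  using assms by (auto simp: least_def Upper_def carrier_nat_order nat_order_le)

lemma join_Idp:
  assumes "e \<in> Idp S" "f \<in> Idp S"
  shows jn_closed: "jn e f \<in> Idp S"
    and jn_left: "jn e f \<cdot> e = e" and jn_right: "jn e f \<cdot> f = f"
    and jn_least: "g \<in> Idp S \<Longrightarrow> g \<cdot> e = e \<Longrightarrow> g \<cdot> f = f \<Longrightarrow> g \<cdot> jn e f = jn e f"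
proof -
  show c: "jn e f \<in> Idp S" using gba.join_closed assms by (simp add: carrier_nat_order)
  show "jn e f \<cdot> e = e" "jn e f \<cdot> f = f"
    using gba.join_left[of e f] gba.join_right[of e f] assms by (simp_all add: carrier_nat_order Idp_le)
  show "g \<cdot> jn e f = jn e f" if "g \<in> Idp S" "g \<cdot> e = e" "g \<cdot> f = f"
    using gba.join_le[of e g f] that assms c by (simp add: carrier_nat_order Idp_le)
qed

lemma meet_Idp:
  assumes "e \<in> Idp S" "f \<in> Idp S"
  shows "e \<sqinter>\<^bsub>nat_order S (Idp S)\<^esub> f = e \<cdot> f"
proof -
  note ef = Idp_mult_closed[OF assms] and c = assms[THEN IdpD(1)]
  have "e \<cdot> f \<sqsubseteq>\<^bsub>nat_order S (Idp S)\<^esub> e \<sqinter>\<^bsub>nat_order S (Idp S)\<^esub> f"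
    using ef assms c Idp_left_commute[of f e f]
    by (intro gba.meet_le) (simp_all add: Idp_le carrier_nat_order idem_left IdpD)
  moreover have "e \<sqinter>\<^bsub>nat_order S (Idp S)\<^esub> f \<sqsubseteq>\<^bsub>nat_order S (Idp S)\<^esub> e \<cdot> f"
  proof -
    have m: "e \<sqinter>\<^bsub>nat_order S (Idp S)\<^esub> f \<in> Idp S"
      using gba.meet_closed[of e f] assms by (simp add: carrier_nat_order)
    then have "e \<sqinter>\<^bsub>nat_order S (Idp S)\<^esub> f = e \<cdot> (e \<sqinter>\<^bsub>nat_order S (Idp S)\<^esub> f)"
      "e \<sqinter>\<^bsub>nat_order S (Idp S)\<^esub> f = f \<cdot> (e \<sqinter>\<^bsub>nat_order S (Idp S)\<^esub> f)"
      using gba.meet_left[of e f] gba.meet_right[of e f] assms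
      by (simp_all add: carrier_nat_order Idp_le)
    then show ?thesis using m c by (simp add: Idp_le mult_assoc IdpD)
  qed
  ultimately show ?thesis
    using gba.le_antisym ef gba.meet_closed[of e f] assms by (metis carrier_nat_order)
qed

lemma jn_distrib:
  assumes "e \<in> Idp S" "f \<in> Idp S" "g \<in> Idp S"
  shows "e \<cdot> jn f g = jn (e \<cdot> f) (e \<cdot> g)"
  using gba.meet_join_distrib[of e f g] assms
  by (simp add: carrier_nat_order meet_Idp jn_closed)

lemma bottom_eq: "\<bottom>\<^bsub>nat_order S (Idp S)\<^esub> = szero S"
proof (rule gba.le_antisym)
  show "\<bottom>\<^bsub>nat_order S (Idp S)\<^esub> \<sqsubseteq>\<^bsub>nat_order S (Idp S)\<^esub> szero S"
    using gba.bottom_lower[of "szero S"] by (simp add: carrier_nat_order szero_Idp)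
  show "szero S \<sqsubseteq>\<^bsub>nat_order S (Idp S)\<^esub> \<bottom>\<^bsub>nat_order S (Idp S)\<^esub>"
    using gba.bottom_closed by (simp add: carrier_nat_order Idp_le szero_Idp mult_szero IdpD)
qed (use gba.bottom_closed szero_Idp in \<open>simp_all add: carrier_nat_order\<close>)

lemma jn_szero: "e \<in> Idp S \<Longrightarrow> jn (szero S) e = e" "e \<in> Idp S \<Longrightarrow> jn e (szero S) = e"
proof -
  assume e: "e \<in> Idp S"
  have "e \<cdot> jn (szero S) e = jn (szero S) e" "e \<cdot> jn e (szero S) = jn e (szero S)"
    using e by (simp_all add: jn_least szero_Idp IdpD mult_szero)
  then show "jn (szero S) e = e" "jn e (szero S) = e"
    using e jn_left[OF e szero_Idp] jn_right[OF szero_Idp e] szero_Idp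
    by (metis Idp_commute jn_closed)+
qed

lemma relative_complement:
  assumes "e \<in> Idp S" "f \<in> Idp S" "f \<cdot> e = e"
  obtains c where "c \<in> Idp S" "e \<cdot> c = szero S" "jn e c = f"
  using gba.sectionally_complemented[of e f] assms
  by (auto simp: carrier_nat_order Idp_le bottom_eq meet_Idp)

text \<open>
  Two candidates \<open>c\<close> and \<open>c'\<close> for the difference satisfy \<open>c = c \<cdot> c'\<close> by distributivity, so they
  agree; a candidate is a complement of \<open>e \<cdot> f\<close> below \<open>e\<close>.
\<close>

lemma bool_diff_Idp:
  assumes e: "e \<in> Idp S" and f: "f \<in> Idp S"
  shows df_closed: "df e f \<in> Idp S" and df_disjoint: "f \<cdot> df e f = szero S"
    and jn_df: "jn (e \<cdot> f) (df e f) = e"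
proof -
  note ef = Idp_mult_closed[OF e f]
  let ?P = "\<lambda>c. c \<in> Idp S \<and> f \<cdot> c = szero S \<and> jn (e \<cdot> f) c = e"
  have uniq: "c = c \<cdot> c'" if c: "?P c" and c': "?P c'" for c c'
  proof -
    from c have "e \<cdot> c = c" using jn_right[of "e \<cdot> f" c] ef by simp
    then have "c = c \<cdot> jn (e \<cdot> f) c'" using c c' e Idp_commute[of c e] by simp
    also have "\<dots> = jn (c \<cdot> (e \<cdot> f)) (c \<cdot> c')" by (rule jn_distrib) (use c c' ef in auto)
    also have "c \<cdot> (e \<cdot> f) = szero S"
      using c e f Idp_left_commute[of c e f] Idp_commute[of c f] by (simp add: IdpD mult_szero)
    finally show ?thesis using c c' by (simp add: jn_szero Idp_mult_closed)
  qed
  have ex: "\<exists>c. ?P c"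
  proof -
    obtain c where c: "c \<in> Idp S" "e \<cdot> f \<cdot> c = szero S" "jn (e \<cdot> f) c = e"
      by (rule relative_complement[of "e \<cdot> f" e]) (use ef e f in \<open>simp_all add: IdpD idem_left\<close>)
    then have "e \<cdot> c = c" using jn_right[of "e \<cdot> f" c] ef by simp
    then have "f \<cdot> c = szero S"
      using c e f Idp_left_commute[of e f c] by (simp add: mult_assoc IdpD)
    with c show ?thesis by blast
  qed
  have "\<exists>!c. ?P c" using ex
    by (rule ex_ex1I) (metis uniq Idp_commute)
  then have "?P (THE c. ?P c)" by (rule theI')
  moreover have "df e f = (THE c. ?P c)"
    unfolding bool_diff_def carrier_nat_order bottom_eq
    by (rule arg_cong[where f = The]) (use e f in \<open>auto simp: fun_eq_iff meet_Idp\<close>)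
  ultimately show "df e f \<in> Idp S" "f \<cdot> df e f = szero S" "jn (e \<cdot> f) (df e f) = e" by simp_all
qed

text \<open>
  The outer factors of \<open>x \<oslash> y\<close> are disjoint from the range and from the domain of \<open>y\<close>.
\<close>

lemma orthogonal_skew_diff:
  assumes x: "x \<in> carrier S" and y: "y \<in> carrier S"
  shows "can_skew_diff S x y \<in> carrier S" "orthogonal S (can_skew_diff S x y) y"
proof -
  define A where "A = df (ran_idp S x) (ran_idp S y)"
  define B where "B = df (dom_idp S x) (dom_idp S y)"
  have A: "A \<in> Idp S" "A \<in> carrier S" "A \<cdot> ran_idp S y = szero S"
    using df_disjoint[OF ran_Idp[OF x] ran_Idp[OF y]] df_closed[OF ran_Idp[OF x] ran_Idp[OF y]]
    by (simp_all add: A_def Idp_commute[OF _ ran_Idp[OF y]] IdpD)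
  have B: "B \<in> Idp S" "B \<in> carrier S" "B \<cdot> dom_idp S y = szero S"
    using df_disjoint[OF dom_Idp[OF x] dom_Idp[OF y]] df_closed[OF dom_Idp[OF x] dom_Idp[OF y]]
    by (simp_all add: B_def Idp_commute[OF _ dom_Idp[OF y]] IdpD)
  have eq: "can_skew_diff S x y = A \<cdot> x \<cdot> B"
    by (simp add: can_skew_diff_def A_def B_def)
  then show "can_skew_diff S x y \<in> carrier S" using x A B by (simp add: mult_closed)
  have "A \<cdot> y = A \<cdot> ran_idp S y \<cdot> y"
    using mult_assoc[OF A(2) IdpD(1)[OF ran_Idp[OF y]] y] y by (simp add: ran_mult)
  then have Ay: "A \<cdot> y = szero S" using y A by (simp add: szero_mult)
  have "B \<cdot> sinv S y = B \<cdot> dom_idp S y \<cdot> sinv S y"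
    using mult_assoc[OF B(2) IdpD(1)[OF dom_Idp[OF y]] sinv_closed[OF y]] y
    by (simp add: dom_sinv)
  then have By: "B \<cdot> sinv S y = szero S" using y B by (simp add: szero_mult sinv_closed)
  show "orthogonal S (can_skew_diff S x y) y"
    using x y A B Ay By
    by (simp add: orthogonal_def eq sinv_mult sinv_idem mult_assoc mult_closed sinv_closed mult_szero)
qed

lemma skew_add_lub:
  assumes x: "x \<in> carrier S" and y: "y \<in> carrier S"
  shows "is_lub (nat_order S (carrier S)) (can_skew_add S x y) {can_skew_diff S x y, y}"
  unfolding can_skew_add_def orth_join_def join_def sup_def
  by (rule someI_ex)
    (rule orthogonal_join_exists[OF orthogonal_skew_diff(1)[OF x y] y orthogonal_skew_diff(2)[OF x y]])

lemma skew_add_closed: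
  assumes x: "x \<in> carrier S" and y: "y \<in> carrier S"
  shows "can_skew_add S x y \<in> carrier S"
  by (rule lub_nat_order(1)[OF orthogonal_skew_diff(1)[OF x y] y skew_add_lub[OF x y]])

end

section \<open>The action on germs at a prime filter of idempotents\<close>

locale idp_prime_filter = boolean_inverse_semigroup +
  fixes \<xi> :: "'a set"
  assumes filter_Idp: "\<xi> \<subseteq> Idp S"
    and filter_mult: "\<lbrakk>e \<in> \<xi>; f \<in> \<xi>\<rbrakk> \<Longrightarrow> e \<cdot> f \<in> \<xi>"
    and filter_up: "\<lbrakk>e \<in> \<xi>; f \<in> Idp S; f \<cdot> e = e\<rbrakk> \<Longrightarrow> f \<in> \<xi>"
    and filter_proper: "szero S \<notin> \<xi>"
    and filter_prime: "\<lbrakk>e \<in> Idp S; f \<in> Idp S; jn e f \<in> \<xi>\<rbrakk> \<Longrightarrow> e \<in> \<xi> \<or> f \<in> \<xi>"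
begin

text \<open>
  All elements of \<open>S\<close> are admitted here, but only germs of elements whose domain lies in \<open>\<xi>\<close> occur
  in \<open>act\<close>: \<open>\<xi>\<close> contains \<open>d(x)\<close> as soon as it contains \<open>d(a \<cdot> x)\<close>.
\<close>

definition germ :: "'a \<Rightarrow> 'a set" where
  "germ x = {y \<in> carrier S. \<exists>e\<in>\<xi>. x \<cdot> e = y \<cdot> e}"

definition act :: "'a \<Rightarrow> 'a set rel" where
  "act a = {(germ x, germ (a \<cdot> x)) | x. x \<in> carrier S \<and> dom_idp S (a \<cdot> x) \<in> \<xi>}"

lemma filterD: "e \<in> \<xi> \<Longrightarrow> e \<in> Idp S" "e \<in> \<xi> \<Longrightarrow> e \<in> carrier S"
  using filter_Idp by (auto simp: IdpD)

lemma filter_dom_mult: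
  assumes "a \<in> carrier S" "x \<in> carrier S" "dom_idp S (a \<cdot> x) \<in> \<xi>"
  shows "dom_idp S x \<in> \<xi>"
  using assms(3) dom_Idp[OF assms(2)] dom_mult_le[OF assms(1,2), symmetric] by (rule filter_up)

lemma germ_eqI:
  assumes "x \<in> carrier S" "y \<in> carrier S" "e \<in> \<xi>" "x \<cdot> e = y \<cdot> e"
  shows "germ x = germ y"
proof -
  have sub: "germ u \<subseteq> germ v" if uv: "u \<in> carrier S" "v \<in> carrier S" "u \<cdot> e = v \<cdot> e" for u v
  proof
    fix z assume "z \<in> germ u"
    then obtain f where z: "z \<in> carrier S" "f \<in> \<xi>" "u \<cdot> f = z \<cdot> f" by (auto simp: germ_def)
    have "v \<cdot> (e \<cdot> f) = u \<cdot> (f \<cdot> e)"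
      using uv z filterD[OF assms(3)] filterD[OF z(2)]
      by (simp add: mult_assoc[symmetric] Idp_commute[of f e])
    also have "\<dots> = z \<cdot> (e \<cdot> f)"
      using uv z filterD[OF assms(3)] filterD[OF z(2)]
      by (simp add: Idp_commute[of e f]) (simp add: mult_assoc[symmetric])
    finally show "z \<in> germ v" using filter_mult[OF assms(3) z(2)] z(1) by (auto simp: germ_def)
  qed
  from assms sub[of x y] sub[of y x] show ?thesis by auto
qed

lemma germ_eqD:
  assumes "x \<in> carrier S" "y \<in> carrier S" "dom_idp S x \<in> \<xi>" "germ x = germ y"
  obtains e where "e \<in> \<xi>" "x \<cdot> e = y \<cdot> e"
proof -
  have "x \<in> germ x" using assms by (auto simp: germ_def)
  with assms(4) have "x \<in> germ y" by simp
  then obtain e where "e \<in> \<xi>" "y \<cdot> e = x \<cdot> e" by (auto simp: germ_def)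
  then show thesis by (intro that) auto
qed

text \<open>
  The action does not depend on the representative of the germ: if \<open>x \<cdot> e = y \<cdot> e\<close> with \<open>e \<in> \<xi>\<close>, then
  \<open>a \<cdot> x\<close> and \<open>a \<cdot> y\<close> agree on \<open>e\<close>, and so do their domains.
\<close>

lemma act_iff:
  assumes a: "a \<in> carrier S" and x: "x \<in> carrier S" and dx: "dom_idp S x \<in> \<xi>"
  shows "(germ x, q) \<in> act a \<longleftrightarrow> dom_idp S (a \<cdot> x) \<in> \<xi> \<and> q = germ (a \<cdot> x)"
proof
  assume "(germ x, q) \<in> act a"
  then obtain y where y: "y \<in> carrier S" "dom_idp S (a \<cdot> y) \<in> \<xi>" "germ x = germ y"
    "q = germ (a \<cdot> y)" by (auto simp: act_def)
  obtain e where e: "e \<in> \<xi>" "x \<cdot> e = y \<cdot> e" using germ_eqD[OF x y(1) dx y(3)] .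
  note eI = filterD[OF e(1)]
  have eq: "a \<cdot> x \<cdot> e = a \<cdot> y \<cdot> e" using a x y(1) eI e(2) by (simp add: mult_assoc)
  then have "germ (a \<cdot> x) = germ (a \<cdot> y)"
    by (intro germ_eqI[OF _ _ e(1)]) (simp_all add: a x y(1) mult_closed)
  moreover have deq: "dom_idp S (a \<cdot> x) \<cdot> e = dom_idp S (a \<cdot> y) \<cdot> e"
    using arg_cong[OF eq, of "dom_idp S"] a x y(1) eI by (simp add: dom_mult_Idp mult_closed)
  have "dom_idp S (a \<cdot> x) \<in> \<xi>"
  proof (rule filter_up)
    show "dom_idp S (a \<cdot> x) \<cdot> e \<in> \<xi>" unfolding deq by (rule filter_mult[OF y(2) e(1)])
  qed (use a x eI in \<open>simp_all add: dom_Idp mult_closed idem_left\<close>)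
  ultimately show "dom_idp S (a \<cdot> x) \<in> \<xi> \<and> q = germ (a \<cdot> x)" using y(4) by simp
qed (use x in \<open>auto simp: act_def\<close>)

lemma actE:
  assumes "a \<in> carrier S" "(p, q) \<in> act a"
  obtains x where "x \<in> carrier S" "dom_idp S x \<in> \<xi>" "dom_idp S (a \<cdot> x) \<in> \<xi>"
    "p = germ x" "q = germ (a \<cdot> x)"
  using assms by (auto simp: act_def dest: filter_dom_mult)

lemma act_mult:
  assumes a: "a \<in> carrier S" and b: "b \<in> carrier S"
  shows "act (a \<cdot> b) = act b O act a"
proof -
  have "(p, q) \<in> act (a \<cdot> b) \<longleftrightarrow> (p, q) \<in> act b O act a" for p q
  proof
    assume "(p, q) \<in> act (a \<cdot> b)"
    then obtain x where x: "x \<in> carrier S" "dom_idp S x \<in> \<xi>" "dom_idp S (a \<cdot> (b \<cdot> x)) \<in> \<xi>"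
      "p = germ x" "q = germ (a \<cdot> (b \<cdot> x))"
      using actE[of "a \<cdot> b"] a b by (metis mult_assoc mult_closed)
    then have "dom_idp S (b \<cdot> x) \<in> \<xi>" using filter_dom_mult a b mult_closed by blast
    with x a b have "(p, germ (b \<cdot> x)) \<in> act b" "(germ (b \<cdot> x), q) \<in> act a"
      by (simp_all add: act_iff mult_closed)
    then show "(p, q) \<in> act b O act a" by blast
  next
    assume "(p, q) \<in> act b O act a"
    then obtain r where "(p, r) \<in> act b" and r: "(r, q) \<in> act a" by blast
    then obtain x where x: "x \<in> carrier S" "dom_idp S x \<in> \<xi>" "dom_idp S (b \<cdot> x) \<in> \<xi>"
      "p = germ x" "r = germ (b \<cdot> x)" using actE[OF b] by blast
    with r a b show "(p, q) \<in> act (a \<cdot> b)" by (simp add: act_iff mult_closed mult_assoc)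
  qed
  then show ?thesis by (simp add: set_eq_iff)
qed

text \<open>
  Applying \<open>a\<close> and then its inverse leads back to the same germ, since
  \<open>a\<inverse> \<cdot> a \<cdot> x = d(a) \<cdot> x = x \<cdot> d(a \<cdot> x)\<close> and \<open>d(a \<cdot> x) \<in> \<xi>\<close>.
\<close>

lemma act_sinv_subset:
  assumes a: "a \<in> carrier S" and pq: "(p, q) \<in> act a"
  shows "(q, p) \<in> act (sinv S a)"
proof -
  obtain x where x: "x \<in> carrier S" "dom_idp S x \<in> \<xi>" "dom_idp S (a \<cdot> x) \<in> \<xi>"
    "p = germ x" "q = germ (a \<cdot> x)" using actE[OF a pq] .
  let ?e = "dom_idp S (a \<cdot> x)"
  have e: "?e \<in> Idp S" "?e \<in> carrier S" using filterD x by auto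
  have eq: "sinv S a \<cdot> (a \<cdot> x) = dom_idp S a \<cdot> x"
    using a x by (simp add: dom_idp_def mult_assoc sinv_closed)
  have d: "dom_idp S (dom_idp S a \<cdot> x) = ?e"
    using a x by (simp add: dom_mult dom_of_Idp dom_Idp IdpD)
  have "dom_idp S a \<cdot> x = x \<cdot> ?e"
    using Idp_mult_eq_mult_dom[OF dom_Idp[OF a] x(1)] by (simp add: d)
  then have "germ (dom_idp S a \<cdot> x) = germ x"
    by (intro germ_eqI[OF _ _ x(3)]) (use x e in \<open>simp_all add: mult_closed mult_assoc IdpD\<close>)
  with x a show ?thesis by (simp add: act_iff mult_closed sinv_closed eq d)
qed

lemma act_sinv:
  assumes "a \<in> carrier S" shows "act (sinv S a) = (act a)\<inverse>"
  using act_sinv_subset[OF assms] act_sinv_subset[OF sinv_closed[OF assms]] assms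
  by (auto simp: sinv_sinv)

lemma pinj_act:
  assumes a: "a \<in> carrier S" shows "pinj (act a)"
proof -
  have "single_valued (act b)" if "b \<in> carrier S" for b
    unfolding single_valued_def using that by (metis actE act_iff)
  from this[OF a] this[OF sinv_closed[OF a]] a show ?thesis by (simp add: pinj_def act_sinv)
qed

lemma act_szero: "act (szero S) = {}"
  using filter_proper by (auto simp: act_def szero_mult dom_of_Idp szero_Idp)

lemma act_Idp:
  assumes "e \<in> Idp S" shows "act e \<subseteq> Id"
  using act_mult[of e e] pinj_idem_iff[OF pinj_act, of e] assms by (simp add: IdpD)

lemma act_Idp_mult:
  assumes "e \<in> Idp S" "f \<in> Idp S" shows "act (e \<cdot> f) = act e \<inter> act f"
  using assms by (simp add: act_mult IdpD subid_relcomp act_Idp)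

text \<open>
  Conjugation by \<open>x\<close>, which sends an idempotent \<open>e\<close> to \<open>x\<inverse> \<cdot> e \<cdot> x = d(e \<cdot> x)\<close>, sends joins below the
  joins of the images.  Namely, it is monotone, and so is conjugation by \<open>x\<inverse>\<close>, which sends an upper
  bound \<open>h\<close> of the images to an upper bound \<open>h'\<close> of \<open>r(x) \<cdot> e\<close> and \<open>r(x) \<cdot> f\<close>, hence of \<open>r(x) \<cdot> (e \<squnion> f)\<close>.
\<close>

lemma conj_jn_le:
  assumes e: "e \<in> Idp S" and f: "f \<in> Idp S" and x: "x \<in> carrier S"
  defines "h \<equiv> jn (dom_idp S (e \<cdot> x)) (dom_idp S (f \<cdot> x))"
  shows "h \<cdot> dom_idp S (jn e f \<cdot> x) = dom_idp S (jn e f \<cdot> x)"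
proof -
  let ?x = "sinv S x" and ?k = "jn e f"
  note c = IdpD(1)[OF e] IdpD(1)[OF f] x sinv_closed[OF x]
  have k: "?k \<in> Idp S" using e f by (rule jn_closed)
  have dI: "dom_idp S (e \<cdot> x) \<in> Idp S" "dom_idp S (f \<cdot> x) \<in> Idp S"
    by (simp_all add: dom_Idp mult_closed c)
  have h: "h \<in> Idp S" unfolding h_def using dI by (rule jn_closed)
  define h' where "h' = x \<cdot> (h \<cdot> ?x)"
  have h': "h' \<in> Idp S"
    using dom_Idp_mult[OF h c(4)] dom_Idp[of "h \<cdot> ?x"] c h
    by (simp add: h'_def sinv_sinv IdpD mult_closed)
  have r: "ran_idp S x \<in> Idp S" by (rule ran_Idp[OF x])
  have conj: "h' \<cdot> (ran_idp S x \<cdot> g) = ran_idp S x \<cdot> g"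
    if g: "g \<in> Idp S" and hg: "h \<cdot> dom_idp S (g \<cdot> x) = dom_idp S (g \<cdot> x)" for g
  proof -
    note gc = IdpD(1)[OF g] IdpD(1)[OF h] IdpD(1)[OF r]
    have rg: "x \<cdot> (dom_idp S (g \<cdot> x) \<cdot> ?x) = ran_idp S x \<cdot> g"
    proof -
      have "x \<cdot> (dom_idp S (g \<cdot> x) \<cdot> ?x) = (x \<cdot> dom_idp S (g \<cdot> x)) \<cdot> ?x"
        using c gc by (simp add: mult_assoc dom_Idp mult_closed IdpD)
      also have "\<dots> = g \<cdot> ran_idp S x"
        using Idp_mult_eq_mult_dom[OF g x] c gc by (simp add: ran_idp_def mult_assoc)
      finally show ?thesis using g r by (simp add: Idp_commute[of g])
    qed
    have "h' \<cdot> (ran_idp S x \<cdot> g) = x \<cdot> (h \<cdot> (?x \<cdot> (x \<cdot> (dom_idp S (g \<cdot> x) \<cdot> ?x))))"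
      unfolding rg[symmetric] h'_def using c gc
      by (simp add: mult_assoc mult_closed dom_Idp IdpD)
    also have "\<dots> = x \<cdot> (h \<cdot> (dom_idp S x \<cdot> (dom_idp S (g \<cdot> x) \<cdot> ?x)))"
      using c gc by (simp add: dom_idp_def mult_assoc mult_closed sinv_closed)
    also have "dom_idp S x \<cdot> (dom_idp S (g \<cdot> x) \<cdot> ?x) = dom_idp S (g \<cdot> x) \<cdot> ?x"
      using c gc dom_mult_le[OF gc(1) x, symmetric]
      by (simp add: mult_assoc[symmetric] dom_Idp IdpD mult_closed)
    also have "x \<cdot> (h \<cdot> (dom_idp S (g \<cdot> x) \<cdot> ?x)) = x \<cdot> ((h \<cdot> dom_idp S (g \<cdot> x)) \<cdot> ?x)"
      using c gc by (simp add: mult_assoc mult_closed dom_Idp IdpD)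
    finally show ?thesis unfolding hg rg .
  qed
  have "h' \<cdot> jn (ran_idp S x \<cdot> e) (ran_idp S x \<cdot> f) = jn (ran_idp S x \<cdot> e) (ran_idp S x \<cdot> f)"
    using dI by (intro jn_least Idp_mult_closed r e f h' conj) (simp_all add: h_def jn_left jn_right)
  then have hk: "h' \<cdot> (ran_idp S x \<cdot> ?k) = ran_idp S x \<cdot> ?k"
    using e f r by (simp add: jn_distrib)
  note kc = IdpD(1)[OF k] IdpD(1)[OF h] IdpD(1)[OF r] IdpD(1)[OF h']
  have "dom_idp S (?k \<cdot> x) = ?x \<cdot> ((ran_idp S x \<cdot> ?k) \<cdot> x)"
    using c kc k by (simp add: dom_Idp_mult mult_assoc[symmetric] mult_closed sinv_ran)
  also have "\<dots> = ?x \<cdot> (h' \<cdot> (ran_idp S x \<cdot> ?k) \<cdot> x)" by (simp add: hk)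
  also have "\<dots> = (?x \<cdot> x) \<cdot> (h \<cdot> ((?x \<cdot> ran_idp S x) \<cdot> (?k \<cdot> x)))"
    unfolding h'_def using c kc by (simp add: mult_assoc mult_closed)
  also have "\<dots> = dom_idp S x \<cdot> (h \<cdot> dom_idp S (?k \<cdot> x))"
    using c k by (simp add: sinv_ran dom_Idp_mult) (simp add: dom_idp_def)
  also have "\<dots> = h \<cdot> (dom_idp S x \<cdot> dom_idp S (?k \<cdot> x))"
    using c k h kc by (intro Idp_left_commute) (simp_all add: dom_Idp mult_closed IdpD)
  also have "dom_idp S x \<cdot> dom_idp S (?k \<cdot> x) = dom_idp S (?k \<cdot> x)"
    using dom_mult_le[OF kc(1) x] by simp
  finally show ?thesis by simp
qed

text \<open>
  This is the place where primality of the filter enters: \<open>e \<squnion> f\<close> is defined at the germ of \<open>x\<close> only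
  if the join of \<open>d(e \<cdot> x)\<close> and \<open>d(f \<cdot> x)\<close> belongs to \<open>\<xi>\<close>.
\<close>

lemma act_jn:
  assumes e: "e \<in> Idp S" and f: "f \<in> Idp S"
  shows "act (jn e f) = act e \<union> act f"
proof -
  have k: "jn e f \<in> Idp S" using e f by (rule jn_closed)
  have mono: "act g \<subseteq> act (jn e f)" if "g \<in> Idp S" "jn e f \<cdot> g = g" for g
    using act_Idp_mult[OF k that(1)] that(2) by auto
  have "act (jn e f) \<subseteq> act e \<union> act f"
  proof
    fix z assume "z \<in> act (jn e f)"
    moreover obtain p q where z: "z = (p, q)" by (cases z)
    ultimately have pq: "(p, q) \<in> act (jn e f)" by simp
    then have q: "q = p" using act_Idp[OF k] by auto
    obtain x where x: "x \<in> carrier S" "dom_idp S x \<in> \<xi>" "dom_idp S (jn e f \<cdot> x) \<in> \<xi>"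
      "p = germ x" using actE[OF IdpD(1)[OF k] pq] .
    have dI: "dom_idp S (e \<cdot> x) \<in> Idp S" "dom_idp S (f \<cdot> x) \<in> Idp S"
      using x e f by (simp_all add: dom_Idp mult_closed IdpD)
    have "jn (dom_idp S (e \<cdot> x)) (dom_idp S (f \<cdot> x)) \<in> \<xi>"
      using x(3) jn_closed[OF dI] conj_jn_le[OF e f x(1)] by (rule filter_up)
    with filter_prime dI have "dom_idp S (e \<cdot> x) \<in> \<xi> \<or> dom_idp S (f \<cdot> x) \<in> \<xi>" by blast
    then have "\<exists>g\<in>{e, f}. (p, germ (g \<cdot> x)) \<in> act g"
      using x e f by (auto simp: act_iff IdpD)
    then show "z \<in> act e \<union> act f"
      using act_Idp[OF e] act_Idp[OF f] z q by auto
  qed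
  with mono[OF e] mono[OF f] e f show ?thesis by (auto simp: jn_left jn_right)
qed

lemma act_df:
  assumes e: "e \<in> Idp S" and f: "f \<in> Idp S"
  shows "act (df e f) = act e - act f"
proof -
  note d = bool_diff_Idp[OF e f]
  have "act e = act (e \<cdot> f) \<union> act (df e f)"
    using act_jn[OF Idp_mult_closed[OF e f] d(1)] d(3) by simp
  moreover have "act f \<inter> act (df e f) = {}"
    using act_Idp_mult[OF f d(1)] d(2) act_szero by simp
  ultimately show ?thesis using act_Idp_mult[OF e f] by blast
qed

lemma act_dom: "x \<in> carrier S \<Longrightarrow> act (dom_idp S x) = Id_on (Domain (act x))"
  and act_ran: "x \<in> carrier S \<Longrightarrow> act (ran_idp S x) = Id_on (Range (act x))"
  by (simp_all add: dom_idp_def ran_idp_def act_mult sinv_closed act_sinv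
      pinj_O_converse pinj_converse_O pinj_act)

lemma act_skew_diff:
  assumes x: "x \<in> carrier S" and y: "y \<in> carrier S"
  shows "act (can_skew_diff S x y) = rdiff (act x) (act y)"
proof -
  note I = dom_Idp[OF x] dom_Idp[OF y] ran_Idp[OF x] ran_Idp[OF y]
  have "act (can_skew_diff S x y) = act (df (dom_idp S x) (dom_idp S y)) O act x O
      act (df (ran_idp S x) (ran_idp S y))"
    using x y I by (simp add: can_skew_diff_def act_mult mult_closed df_closed IdpD)
  also have "\<dots> = rdiff (act x) (act y)"
    using x y I by (auto simp: act_df act_dom act_ran rdiff_def)
  finally show ?thesis .
qed

text \<open>
  Let \<open>g = d(x) \<squnion> d(y)\<close>.  The restriction \<open>z \<cdot> g\<close> is still an upper bound of \<open>x\<close> and \<open>y\<close>, hence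
  \<open>z = z \<cdot> g\<close>, and the action of \<open>g\<close> is the union of those of \<open>d(x)\<close> and \<open>d(y)\<close>.
\<close>

lemma act_lub:
  assumes x: "x \<in> carrier S" and y: "y \<in> carrier S"
    and lub: "is_lub (nat_order S (carrier S)) z {x, y}"
  shows "act z = act x \<union> act y"
proof -
  let ?g = "jn (dom_idp S x) (dom_idp S y)"
  note I = dom_Idp[OF x] dom_Idp[OF y]
  have g: "?g \<in> Idp S" using I by (rule jn_closed)
  note z = lub_nat_order(1-3)[OF x y lub] and least = lub_nat_order(4)[OF x y lub]
  have "z = z \<cdot> ?g \<cdot> dom_idp S z"
    using z g I jn_left[OF I] jn_right[OF I]
    by (intro least) (simp_all add: mult_closed mult_assoc IdpD)
  also have "\<dots> = z \<cdot> dom_idp S z \<cdot> ?g"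
    using z g dom_Idp[OF z(1)] by (simp add: mult_assoc IdpD Idp_commute[of ?g])
  finally have "z = z \<cdot> ?g" by (simp add: z(1) mult_dom)
  then have "act z = act ?g O act z" using act_mult[OF z(1) IdpD(1)[OF g]] by simp
  also have "\<dots> = act (dom_idp S x) O act z \<union> act (dom_idp S y) O act z"
    by (simp add: act_jn[OF I] relcomp_distrib2)
  also have "\<dots> = act (z \<cdot> dom_idp S x) \<union> act (z \<cdot> dom_idp S y)"
    by (simp only: act_mult[OF z(1) IdpD(1)[OF I(1)]] act_mult[OF z(1) IdpD(1)[OF I(2)]])
  finally show ?thesis by (simp only: z(2,3)[symmetric])
qed

lemma act_skew_add:
  assumes x: "x \<in> carrier S" and y: "y \<in> carrier S"
  shows "act (can_skew_add S x y) = radd (act x) (act y)"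
  using act_lub[OF orthogonal_skew_diff(1)[OF x y] y skew_add_lub[OF x y]]
  by (simp add: act_skew_diff[OF x y] radd_def)

text \<open>
  If \<open>x\<close> and \<open>y\<close> act alike on the germ of \<open>d(x)\<close>, which \<open>x\<close> sends to the germ of \<open>x\<close>, then \<open>x\<close> and
  \<open>y\<close> agree on some member of the filter below \<open>d(x)\<close>.
\<close>

lemma act_distinguishes:
  assumes x: "x \<in> carrier S" and y: "y \<in> carrier S" and dx: "dom_idp S x \<in> \<xi>"
    and ne: "\<And>e. e \<in> \<xi> \<Longrightarrow> dom_idp S x \<cdot> e = e \<Longrightarrow> x \<cdot> e \<noteq> y \<cdot> e"
  shows "act x \<noteq> act y"
proof
  assume eq: "act x = act y"
  let ?d = "dom_idp S x"
  have d: "?d \<in> Idp S" "?d \<in> carrier S" "dom_idp S ?d = ?d"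
    using x by (simp_all add: dom_Idp IdpD dom_of_Idp)
  have "(germ ?d, germ x) \<in> act x" using x d dx by (simp add: act_iff mult_dom)
  with eq have "(germ ?d, germ x) \<in> act y" by simp
  with y d dx have "germ x = germ (y \<cdot> ?d)" by (simp add: act_iff)
  then obtain e where e: "e \<in> \<xi>" "x \<cdot> e = y \<cdot> ?d \<cdot> e"
    using germ_eqD[OF x _ dx] y d by (metis mult_closed)
  note eI = filterD[OF e(1)]
  have "x \<cdot> (?d \<cdot> e) = x \<cdot> ?d \<cdot> e" using x d eI by (simp only: mult_assoc)
  also have "\<dots> = x \<cdot> e" using x by (simp add: mult_dom)
  also have "\<dots> = y \<cdot> (?d \<cdot> e)" using e(2) y d eI by (simp add: mult_assoc)
  finally show False
    using ne[OF filter_mult[OF dx e(1)]] d eI by (simp add: idem_left)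
qed

end

section \<open>Separating elements by prime filters\<close>

context boolean_inverse_semigroup
begin

lemma jn_mono:
  assumes "e \<in> Idp S" "f \<in> Idp S" "g \<in> Idp S" "f \<cdot> e = e"
  shows "jn f g \<cdot> jn e g = jn e g"
proof (rule jn_least)
  have "jn f g \<cdot> e = (jn f g \<cdot> f) \<cdot> e"
    using assms jn_closed[of f g] by (simp only: mult_assoc IdpD(1) assms(4))
  then show "jn f g \<cdot> e = e" using assms by (simp add: jn_left)
qed (use assms in \<open>simp_all add: jn_closed jn_right\<close>)

text \<open>
  By distributivity \<open>(k \<squnion> e) \<sqinter> (k \<squnion> f) = k \<squnion> (e \<sqinter> f)\<close>, so an
  element below both factors is below the right-hand side.
\<close>

lemma le_jn_mult:
  assumes I: "u \<in> Idp S" "k \<in> Idp S" "e \<in> Idp S" "f \<in> Idp S"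
    and ue: "jn k e \<cdot> u = u" and uf: "jn k f \<cdot> u = u"
  shows "jn k (e \<cdot> f) \<cdot> u = u"
proof -
  let ?w = "jn k (e \<cdot> f)"
  note c = I[THEN IdpD(1)]
  have w: "?w \<in> Idp S" "?w \<in> carrier S" using I by (simp_all add: jn_closed Idp_mult_closed IdpD)
  have wk: "?w \<cdot> k = k" "?w \<cdot> (e \<cdot> f) = e \<cdot> f"
    using I by (simp_all add: jn_left jn_right Idp_mult_closed)
  have 1: "?w \<cdot> (u \<cdot> k) = u \<cdot> k"
    using Idp_left_commute[OF w(1) I(1) c(2)] wk by simp
  have "?w \<cdot> (u \<cdot> (f \<cdot> e)) = u \<cdot> (f \<cdot> e)"
    using Idp_left_commute[OF w(1) I(1), of "e \<cdot> f"] wk c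
    by (simp add: Idp_commute[OF I(4,3)] mult_closed)
  then have 2: "?w \<cdot> (u \<cdot> f \<cdot> e) = u \<cdot> f \<cdot> e" using c by (simp add: mult_assoc)
  have "u \<cdot> f = u \<cdot> f \<cdot> jn k e"
    using Idp_left_commute[of "u" f "jn k e"] ue I c
    by (simp add: mult_assoc IdpD jn_closed Idp_commute[of u] Idp_mult_closed)
  also have "\<dots> = jn (u \<cdot> f \<cdot> k) (u \<cdot> f \<cdot> e)"
    using I by (simp add: jn_distrib Idp_mult_closed)
  also have "?w \<cdot> \<dots> = \<dots>"
  proof (rule jn_least)
    have "u \<cdot> f \<cdot> k = f \<cdot> (u \<cdot> k)"
      using Idp_left_commute[OF I(4,1) c(2)] c by (simp add: mult_assoc)
    then show "?w \<cdot> (u \<cdot> f \<cdot> k) = u \<cdot> f \<cdot> k"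
      using Idp_left_commute[OF w(1) I(4), of "u \<cdot> k"] 1 c by (simp add: mult_closed)
  qed (use I w 2 in \<open>simp_all add: Idp_mult_closed\<close>)
  finally have 3: "?w \<cdot> (u \<cdot> f) = u \<cdot> f"
    using \<open>u \<cdot> f \<cdot> jn k e = jn (u \<cdot> f \<cdot> k) (u \<cdot> f \<cdot> e)\<close> \<open>u \<cdot> f = u \<cdot> f \<cdot> jn k e\<close> by simp
  have "u = u \<cdot> jn k f" using uf I by (simp add: Idp_commute[of u] jn_closed)
  also have "\<dots> = jn (u \<cdot> k) (u \<cdot> f)" using I by (simp add: jn_distrib)
  finally have u: "u = jn (u \<cdot> k) (u \<cdot> f)" .
  have "?w \<cdot> jn (u \<cdot> k) (u \<cdot> f) = jn (u \<cdot> k) (u \<cdot> f)"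
    using I w 1 3 by (intro jn_least) (simp_all add: Idp_mult_closed)
  then show ?thesis by (simp flip: u)
qed

definition Idp_ideal :: "'a set \<Rightarrow> bool" where
  "Idp_ideal J \<longleftrightarrow> J \<subseteq> Idp S \<and> szero S \<in> J \<and>
    (\<forall>e\<in>J. \<forall>f\<in>Idp S. e \<cdot> f = f \<longrightarrow> f \<in> J) \<and> (\<forall>e\<in>J. \<forall>f\<in>J. jn e f \<in> J)"

lemma Idp_idealD:
  assumes "Idp_ideal J"
  shows "J \<subseteq> Idp S" "szero S \<in> J" "e \<in> J \<Longrightarrow> f \<in> Idp S \<Longrightarrow> e \<cdot> f = f \<Longrightarrow> f \<in> J"
    "e \<in> J \<Longrightarrow> f \<in> J \<Longrightarrow> jn e f \<in> J"
  using assms unfolding Idp_ideal_def by blast+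

text \<open>
  The set \<open>K\<close> is the ideal generated by \<open>J\<close> and \<open>g\<close>.
\<close>

lemma Idp_ideal_extend:
  assumes J: "Idp_ideal J" and g: "g \<in> Idp S"
  defines "K \<equiv> {h \<in> Idp S. \<exists>m\<in>J. jn m g \<cdot> h = h}"
  shows "Idp_ideal K" "J \<subseteq> K" "g \<in> K"
proof -
  note JD = Idp_idealD[OF J]
  have JI: "m \<in> Idp S" if "m \<in> J" for m using that JD(1) by blast
  have KI: "h \<in> K" if "h \<in> Idp S" "m \<in> J" "jn m g \<cdot> h = h" for h m
    unfolding K_def using that by blast
  show "J \<subseteq> K" using KI JI g jn_left by blast
  with JD(2) have z: "szero S \<in> K" by blast
  show "g \<in> K" using KI[OF g JD(2)] JI[OF JD(2)] g by (simp add: jn_right)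
  have down: "f \<in> K" if "e \<in> K" "f \<in> Idp S" "e \<cdot> f = f" for e f
  proof -
    from that(1) obtain m where m: "m \<in> J" "jn m g \<cdot> e = e" "e \<in> Idp S"
      unfolding K_def by blast
    have "jn m g \<cdot> f = jn m g \<cdot> e \<cdot> f"
      by (simp only: that(3) mult_assoc[OF IdpD(1)[OF jn_closed[OF JI[OF m(1)] g]]
            IdpD(1)[OF m(3)] IdpD(1)[OF that(2)]])
    also have "\<dots> = f" by (simp only: m(2) that(3))
    finally show ?thesis by (rule KI[OF that(2) m(1)])
  qed
  have join: "jn e f \<in> K" if "e \<in> K" "f \<in> K" for e f
  proof -
    from that obtain m n where m: "m \<in> J" "jn m g \<cdot> e = e" "e \<in> Idp S"
      and n: "n \<in> J" "jn n g \<cdot> f = f" "f \<in> Idp S"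
      unfolding K_def by blast
    have I: "m \<in> Idp S" "n \<in> Idp S" "jn m n \<in> Idp S" "jn (jn m n) g \<in> Idp S"
      using m n g by (simp_all add: JI jn_closed)
    have *: "jn (jn m n) g \<cdot> e' = e'"
      if "m' \<in> Idp S" "jn m n \<cdot> m' = m'" "jn m' g \<cdot> e' = e'" "e' \<in> Idp S" for m' e'
    proof -
      have "jn (jn m n) g \<cdot> e' = jn (jn m n) g \<cdot> jn m' g \<cdot> e'"
        using that g I by (simp only: mult_assoc IdpD(1) jn_closed that(3))
      also have "\<dots> = jn m' g \<cdot> e'" using that g I by (simp add: jn_mono)
      finally show ?thesis using that by simp
    qed
    have "jn (jn m n) g \<cdot> jn e f = jn e f"
      using I m n by (intro jn_least *[of m e] *[of n f]) (simp_all add: jn_left jn_right)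
    then show ?thesis by (rule KI[OF jn_closed[OF m(3) n(3)] JD(4)[OF m(1) n(1)]])
  qed
  have "K \<subseteq> Idp S" unfolding K_def by blast
  with z down join show "Idp_ideal K" unfolding Idp_ideal_def by blast
qed

text \<open>
  The prime filter is the complement of an ideal \<open>M\<close> that is maximal among those containing \<open>I\<close> but
  not \<open>u\<close>.  If \<open>e\<close> and \<open>f\<close> are outside \<open>M\<close>, maximality gives \<open>u \<le> m \<squnion> e\<close> and \<open>u \<le> n \<squnion> f\<close> with
  \<open>m, n \<in> M\<close>, so \<open>u \<le> m \<squnion> n \<squnion> (e \<sqinter> f)\<close> and \<open>e \<sqinter> f\<close> is outside \<open>M\<close>.
\<close>

lemma prime_filter_exists:
  assumes I: "Idp_ideal I" and u: "u \<in> Idp S" "u \<notin> I"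
  obtains \<xi> where "idp_prime_filter S \<xi>" "u \<in> \<xi>" "\<xi> \<inter> I = {}"
proof -
  define \<J> where "\<J> = {J. Idp_ideal J \<and> I \<subseteq> J \<and> u \<notin> J}"
  have "\<J> \<noteq> {}" using I u by (auto simp: \<J>_def)
  moreover have "\<Union>C \<in> \<J>" if C: "C \<noteq> {}" "subset.chain \<J> C" for C
  proof -
    have CJ: "J \<in> \<J>" if "J \<in> C" for J using C that by (auto simp: subset_chain_def)
    have id: "Idp_ideal J" if "J \<in> C" for J using CJ[OF that] by (simp add: \<J>_def)
    have "jn e f \<in> \<Union>C" if ef: "e \<in> \<Union>C" "f \<in> \<Union>C" for e f
    proof -
      from ef obtain J K where JK: "J \<in> C" "e \<in> J" "K \<in> C" "f \<in> K" by blast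
      then have "J \<subseteq> K \<or> K \<subseteq> J" using C by (auto simp: subset_chain_def)
      then obtain L where "L \<in> C" "e \<in> L" "f \<in> L" using JK by blast
      then show ?thesis using Idp_idealD(4)[OF id] by blast
    qed
    moreover have "\<Union>C \<subseteq> Idp S" using Idp_idealD(1)[OF id] by blast
    moreover have "szero S \<in> \<Union>C" using Idp_idealD(2)[OF id] C(1) by blast
    moreover have "f \<in> \<Union>C" if "e \<in> \<Union>C" "f \<in> Idp S" "e \<cdot> f = f" for e f
      using Idp_idealD(3)[OF id] that by blast
    ultimately have "Idp_ideal (\<Union>C)" unfolding Idp_ideal_def by blast
    moreover have "I \<subseteq> \<Union>C" "u \<notin> \<Union>C" using CJ C(1) unfolding \<J>_def by blast+
    ultimately show ?thesis unfolding \<J>_def by blast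
  qed
  ultimately obtain M where M: "M \<in> \<J>" and max: "\<And>J. J \<in> \<J> \<Longrightarrow> M \<subseteq> J \<Longrightarrow> J = M"
    using subset_Zorn_nonempty[of \<J>] by blast
  have MI: "Idp_ideal M" "I \<subseteq> M" "u \<notin> M" using M by (simp_all add: \<J>_def)
  note MD = Idp_idealD[OF MI(1)]
  have ext: "\<exists>m\<in>M. jn m g \<cdot> u = u" if g: "g \<in> Idp S" "g \<notin> M" for g
  proof (rule ccontr)
    assume *: "\<not> ?thesis"
    note E = Idp_ideal_extend[OF MI(1) g(1)]
    have "{h \<in> Idp S. \<exists>m\<in>M. jn m g \<cdot> h = h} = M"
      using E MI * by (intro max) (auto simp: \<J>_def)
    with E(3) g(2) show False by simp
  qed
  have "idp_prime_filter S (Idp S - M)"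
  proof (intro idp_prime_filter.intro idp_prime_filter_axioms.intro boolean_inverse_semigroup_axioms)
    fix e f assume ef: "e \<in> Idp S - M" "f \<in> Idp S - M"
    then have efI: "e \<in> Idp S" "f \<in> Idp S" by simp_all
    obtain m n where m: "m \<in> M" "jn m e \<cdot> u = u" and n: "n \<in> M" "jn n f \<cdot> u = u"
      using ext ef by blast
    define k where "k = jn m n"
    have k: "k \<in> M" unfolding k_def using MD(4) m n by blast
    have I': "m \<in> Idp S" "n \<in> Idp S" "k \<in> Idp S" using MD(1) m n k by auto
    have km: "k \<cdot> m = m" "k \<cdot> n = n" using I' by (simp_all add: k_def jn_left jn_right)
    have le: "jn k g \<cdot> u = u" if "m' \<in> Idp S" "k \<cdot> m' = m'" "jn m' g \<cdot> u = u" "g \<in> Idp S" for m' g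
    proof -
      have "jn k g \<cdot> u = jn k g \<cdot> jn m' g \<cdot> u"
        using that I' u(1) by (simp only: mult_assoc IdpD(1) jn_closed that(3))
      also have "\<dots> = jn m' g \<cdot> u" using that I' by (simp add: jn_mono)
      finally show ?thesis using that by simp
    qed
    have "jn k (e \<cdot> f) \<cdot> u = u"
      using le_jn_mult[OF u(1) I'(3) efI le[OF I'(1) km(1) m(2) efI(1)] le[OF I'(2) km(2) n(2) efI(2)]] .
    moreover have "jn k (e \<cdot> f) \<in> M" if "e \<cdot> f \<in> M" using MD(4) k that by blast
    ultimately have "e \<cdot> f \<notin> M" using MD(3)[of "jn k (e \<cdot> f)" u] u(1) MI(3) by blast
    then show "e \<cdot> f \<in> Idp S - M" using efI by (simp add: Idp_mult_closed)
  qed (use MD in blast)+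
  moreover have "u \<in> Idp S - M" "(Idp S - M) \<inter> I = {}" using u MI by auto
  ultimately show thesis by (rule that)
qed

text \<open>
  Write \<open>e \<squnion> f\<close> as a disjoint join of \<open>e\<close> and \<open>c \<le> f\<close>.  Then \<open>x \<cdot> e = y \<cdot> e\<close> and \<open>x \<cdot> c = y \<cdot> c\<close> are
  orthogonal, and their join \<open>s\<close> equals both \<open>x \<cdot> (e \<squnion> f)\<close> and \<open>y \<cdot> (e \<squnion> f)\<close>: these are upper bounds
  whose restrictions to \<open>d(s) \<ge> e \<squnion> f\<close> are \<open>s\<close>.
\<close>

lemma agree_on_jn:
  assumes x: "x \<in> carrier S" and y: "y \<in> carrier S" and e: "e \<in> Idp S" and f: "f \<in> Idp S"
    and dx: "dom_idp S x \<cdot> e = e" "dom_idp S x \<cdot> f = f"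
    and eq: "x \<cdot> e = y \<cdot> e" "x \<cdot> f = y \<cdot> f"
  shows "x \<cdot> jn e f = y \<cdot> jn e f"
proof -
  define g where "g = jn e f"
  have g: "g \<in> Idp S" "g \<cdot> e = e" "g \<cdot> f = f"
    unfolding g_def using e f by (rule jn_closed jn_left jn_right)+
  obtain c where c: "c \<in> Idp S" "e \<cdot> c = szero S" "jn e c = g"
    using relative_complement[OF e g(1,2)] .
  note cc = IdpD(1)[OF e] IdpD(1)[OF f] IdpD(1)[OF g(1)] IdpD(1)[OF c(1)] IdpD(1)[OF dom_Idp[OF x]]
  have gc: "g \<cdot> c = c" using jn_right[OF e c(1)] c(3) by simp
  have fc: "f \<cdot> c = c"
  proof -
    have "c = c \<cdot> jn e f" using gc c g by (simp add: g_def Idp_commute[of c])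
    also have "\<dots> = jn (c \<cdot> e) (c \<cdot> f)" using c e f by (simp add: jn_distrib)
    also have "\<dots> = c \<cdot> f" using c e f by (simp add: Idp_commute[of c e] jn_szero Idp_mult_closed)
    finally show ?thesis using c f by (simp add: Idp_commute[of f])
  qed
  have dc: "dom_idp S x \<cdot> c = c"
  proof -
    have "dom_idp S x \<cdot> c = (dom_idp S x \<cdot> f) \<cdot> c" using cc by (simp only: mult_assoc fc)
    then show ?thesis by (simp add: dx fc)
  qed
  have eqc: "x \<cdot> c = y \<cdot> c"
  proof -
    have "x \<cdot> c = (x \<cdot> f) \<cdot> c" "y \<cdot> c = (y \<cdot> f) \<cdot> c" using cc x y by (simp_all only: mult_assoc fc)
    then show ?thesis by (simp add: eq)
  qed
  have d: "dom_idp S (x \<cdot> e) = e" "dom_idp S (x \<cdot> c) = c"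
    using x e c by (simp_all add: dom_mult_Idp dx dc)
  have ce: "c \<cdot> e = szero S" using c e by (simp add: Idp_commute[of c])
  have xc: "x \<cdot> e \<in> carrier S" "x \<cdot> c \<in> carrier S" using x cc by (simp_all add: mult_closed)
  have "orthogonal S (x \<cdot> e) (x \<cdot> c)"
  proof -
    have "sinv S (x \<cdot> e) \<cdot> (x \<cdot> c) = e \<cdot> (dom_idp S x \<cdot> c)"
      using x cc e by (simp add: sinv_mult sinv_idem dom_idp_def mult_assoc mult_closed sinv_closed)
    moreover have "(x \<cdot> e) \<cdot> sinv S (x \<cdot> c) = x \<cdot> ((e \<cdot> c) \<cdot> sinv S x)"
      using x cc c(1) by (simp add: sinv_mult sinv_idem mult_assoc mult_closed sinv_closed)
    ultimately show ?thesis
      using x c dc by (simp add: orthogonal_def szero_mult mult_szero sinv_closed)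
  qed
  then obtain s where "is_lub (nat_order S (carrier S)) s {x \<cdot> e, x \<cdot> c}"
    using orthogonal_join_exists xc by blast
  note lub = lub_nat_order[OF xc this]
  have s: "s \<in> carrier S" "x \<cdot> e = s \<cdot> e" "x \<cdot> c = s \<cdot> c"
    using lub(1-3) by (simp_all add: d)
  have least: "s = w \<cdot> dom_idp S s"
    if "w \<in> carrier S" "x \<cdot> e = w \<cdot> e" "x \<cdot> c = w \<cdot> c" for w
    using lub(4)[unfolded d, OF that] .
  note ds = dom_Idp[OF s(1)]
  have "dom_idp S s \<cdot> e = e" "dom_idp S s \<cdot> c = c"
    using arg_cong[OF s(2), of "dom_idp S"] arg_cong[OF s(3), of "dom_idp S"] s(1) e c
    by (simp_all add: d dom_mult_Idp)
  then have dg: "dom_idp S s \<cdot> g = g"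
    using jn_least[OF e c(1) ds] c(3) by simp
  have "w \<cdot> g = s" if w: "w \<in> carrier S" "x \<cdot> e = w \<cdot> e" "x \<cdot> c = w \<cdot> c" for w
  proof -
    have "s = w \<cdot> g \<cdot> dom_idp S s"
      by (rule least) (use w cc g gc in \<open>simp_all add: mult_closed mult_assoc\<close>)
    also have "\<dots> = w \<cdot> (dom_idp S s \<cdot> g)"
      using w cc ds g by (simp add: mult_assoc IdpD Idp_commute[of g])
    finally show ?thesis by (simp add: dg)
  qed
  from this[OF x] this[OF y eq(1) eqc] show ?thesis by (simp add: g_def)
qed

text \<open>
  By antisymmetry of the natural ordering, one of \<open>x\<close> and \<open>y\<close> is not below the other.  If it is
  \<open>a\<close>, then \<open>d(a)\<close> is outside the ideal \<open>I\<close> of all idempotents below \<open>d(a)\<close> on which the two agree.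
\<close>

theorem separating_prime_filter:
  assumes x: "x \<in> carrier S" and y: "y \<in> carrier S" and ne: "x \<noteq> y"
  obtains \<xi> where "idp_prime_filter S \<xi>" "idp_prime_filter.act S \<xi> x \<noteq> idp_prime_filter.act S \<xi> y"
proof -
  have sep: "\<exists>\<xi>. idp_prime_filter S \<xi> \<and> idp_prime_filter.act S \<xi> a \<noteq> idp_prime_filter.act S \<xi> b"
    if a: "a \<in> carrier S" and b: "b \<in> carrier S" and ab: "a \<noteq> b \<cdot> dom_idp S a" for a b
  proof -
    define I where "I = {e \<in> Idp S. dom_idp S a \<cdot> e = e \<and> a \<cdot> e = b \<cdot> e}"
    note da = dom_Idp[OF a]
    have "Idp_ideal I"
      unfolding Idp_ideal_def
    proof (intro conjI ballI impI)
      show "szero S \<in> I" using a b da by (simp add: I_def szero_Idp mult_szero IdpD)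
      show "jn e f \<in> I" if "e \<in> I" "f \<in> I" for e f
        using that agree_on_jn[OF a b, of e f] jn_least[of e f "dom_idp S a"] da
        by (simp add: I_def jn_closed)
      show "f \<in> I" if e: "e \<in> I" and f: "f \<in> Idp S" "e \<cdot> f = f" for e f
      proof -
        from e have e': "e \<in> carrier S" "dom_idp S a \<cdot> e = e" "a \<cdot> e = b \<cdot> e"
          by (simp_all add: I_def IdpD)
        have "t \<cdot> f = t \<cdot> e \<cdot> f" if "t \<in> carrier S" for t
          using that e' IdpD(1)[OF f(1)] by (simp only: mult_assoc f(2))
        from this[OF a] this[OF b] this[OF IdpD(1)[OF da]] e' f show ?thesis by (simp add: I_def)
      qed
    qed (auto simp: I_def)
    moreover have "dom_idp S a \<notin> I" using ab a by (simp add: I_def mult_dom)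
    ultimately obtain \<xi> where \<xi>: "idp_prime_filter S \<xi>" "dom_idp S a \<in> \<xi>" "\<xi> \<inter> I = {}"
      using prime_filter_exists da by blast
    interpret idp_prime_filter S \<xi> by (rule \<xi>(1))
    have "act a \<noteq> act b"
      using a b \<xi>(2)
    proof (rule act_distinguishes)
      fix e assume "e \<in> \<xi>" "dom_idp S a \<cdot> e = e"
      then show "a \<cdot> e \<noteq> b \<cdot> e" using \<xi>(3) filterD(1) by (auto simp: I_def)
    qed
    with \<xi>(1) show ?thesis by blast
  qed
  have "x \<noteq> y \<cdot> dom_idp S x \<or> y \<noteq> x \<cdot> dom_idp S y"
  proof (rule ccontr)
    assume "\<not> ?thesis"
    then have 1: "y \<cdot> dom_idp S x = x" and 2: "x \<cdot> dom_idp S y = y" by simp_all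
    note d = dom_Idp[OF x] dom_Idp[OF y]
    have "x = x \<cdot> dom_idp S y \<cdot> dom_idp S x" by (simp add: 1 2)
    also have "\<dots> = x \<cdot> dom_idp S x \<cdot> dom_idp S y"
      using x d by (simp add: mult_assoc IdpD Idp_commute[of "dom_idp S y"])
    also have "\<dots> = y" using x by (simp add: mult_dom 2)
    finally show False using ne by simp
  qed
  then show thesis using sep[OF x y] sep[OF y x] that by metis
qed

end

section \<open>Representations of biases by partial injections\<close>

primrec rel_eval :: "('v \<Rightarrow> 'p rel) \<Rightarrow> 'v bterm \<Rightarrow> 'p rel" where
  "rel_eval R (Var v) = R v"
| "rel_eval R Zero = {}"
| "rel_eval R (Inv t) = (rel_eval R t)\<inverse>"
| "rel_eval R (Mult s t) = rel_eval R t O rel_eval R s"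
| "rel_eval R (SDiff s t) = rdiff (rel_eval R s) (rel_eval R t)"
| "rel_eval R (SAdd s t) = radd (rel_eval R s) (rel_eval R t)"

lemma pinj_rel_eval: "(\<And>v. pinj (R v)) \<Longrightarrow> pinj (rel_eval R t)"
  by (induction t) (simp_all add: pinj_empty pinj_converse pinj_relcomp pinj_rdiff pinj_radd)

lemma rel_eval_bound:
  assumes "\<And>v. R v \<subseteq> A \<times> A" shows "rel_eval R t \<subseteq> A \<times> A"
proof (induction t)
  case (Mult s t)
  then show ?case by (simp add: relcomp_subset_Sigma)
qed (use assms in \<open>auto simp: rdiff_def radd_def\<close>)

lemma eval_cong: "(\<And>v. v \<in> vars t \<Longrightarrow> a v = b v) \<Longrightarrow> eval_term S a t = eval_term S b t"
  by (induction t) auto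

lemma rel_eval_cong: "(\<And>v. v \<in> vars t \<Longrightarrow> R v = R' v) \<Longrightarrow> rel_eval R t = rel_eval R' t"
  by (induction t) auto

text \<open>
  The homomorphisms from an algebra into the algebra of all partial injections of the type \<open>'p\<close>.
  Closure of the carrier under the operations is included because the definition serves to prove
  that \<open>S\<close> is a bias.
\<close>

definition rel_hom :: "'a bias_str \<Rightarrow> ('a \<Rightarrow> 'p rel) \<Rightarrow> bool" where
  "rel_hom S \<phi> \<longleftrightarrow> \<phi> \<zero>\<^bsub>S\<^esub> = {} \<and> \<zero>\<^bsub>S\<^esub> \<in> carrier S \<and>
    (\<forall>x\<in>carrier S. pinj (\<phi> x) \<and> binv S x \<in> carrier S \<and> \<phi> (binv S x) = (\<phi> x)\<inverse>) \<and>
    (\<forall>x\<in>carrier S. \<forall>y\<in>carrier S.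
      x \<cdot>\<^bsub>S\<^esub> y \<in> carrier S \<and> \<phi> (x \<cdot>\<^bsub>S\<^esub> y) = \<phi> y O \<phi> x \<and>
      x \<oslash>\<^bsub>S\<^esub> y \<in> carrier S \<and> \<phi> (x \<oslash>\<^bsub>S\<^esub> y) = rdiff (\<phi> x) (\<phi> y) \<and>
      x \<nabla>\<^bsub>S\<^esub> y \<in> carrier S \<and> \<phi> (x \<nabla>\<^bsub>S\<^esub> y) = radd (\<phi> x) (\<phi> y))"

lemma rel_hom_eval:
  assumes "rel_hom S \<phi>" "\<And>v. v \<in> vars t \<Longrightarrow> a v \<in> carrier S"
  shows "eval_term S a t \<in> carrier S \<and> \<phi> (eval_term S a t) = rel_eval (\<lambda>v. \<phi> (a v)) t"
  using assms(2) by (induction t) (use assms(1) in \<open>simp_all add: rel_hom_def\<close>)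

text \<open>
  The operations of \<open>S\<close> and the canonical ones have the same image under \<open>\<phi>\<close>.
\<close>

theorem faithful_rel_hom_bias:
  assumes hom: "rel_hom S \<phi>" and inj: "inj_on \<phi> (carrier S)"
  shows "bias S"
proof -
  interpret pinj_semigroup S \<phi>
  proof
    fix x y assume xy: "x \<in> carrier S" "y \<in> carrier S"
    show "\<exists>z\<in>carrier S. \<phi> z = rdiff (\<phi> x) (\<phi> y)"
      by (rule bexI[of _ "x \<oslash>\<^bsub>S\<^esub> y"]) (use hom xy in \<open>simp_all add: rel_hom_def\<close>)
    show "\<exists>z\<in>carrier S. \<phi> z = radd (\<phi> x) (\<phi> y)"
      by (rule bexI[of _ "x \<nabla>\<^bsub>S\<^esub> y"]) (use hom xy in \<open>simp_all add: rel_hom_def\<close>)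
  qed (use assms in \<open>auto simp: rel_hom_def\<close>)
  have eq: "x = y" if "x \<in> carrier S" "y \<in> carrier S" "\<phi> x = \<phi> y" for x y
    using that rep_eq_iff by blast
  show ?thesis
  proof (intro bias.intro bias_axioms.intro boolean_inverse_semigroup)
    show "\<zero>\<^bsub>S\<^esub> = szero S"
      by (rule eq) (use hom szero_closed rep_szero in \<open>simp_all add: rel_hom_def\<close>)
    show "binv S x = sinv S x" if "x \<in> carrier S" for x
      by (rule eq) (use hom that sinv_closed rep_sinv in \<open>simp_all add: rel_hom_def\<close>)
    show "x \<oslash>\<^bsub>S\<^esub> y = can_skew_diff S x y" if "x \<in> carrier S" "y \<in> carrier S" for x y
      by (rule eq) (use hom that can_skew_diff_closed rep_can_skew_diff
          in \<open>simp_all add: rel_hom_def\<close>)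
    show "x \<nabla>\<^bsub>S\<^esub> y = can_skew_add S x y" if "x \<in> carrier S" "y \<in> carrier S" for x y
      by (rule eq) (use hom that can_skew_add_closed rep_can_skew_add
          in \<open>simp_all add: rel_hom_def\<close>)
  qed
qed

lemma rel_hom_bias_of:
  assumes "pinj_semigroup S \<phi>" shows "rel_hom (bias_of S) \<phi>"
proof -
  interpret pinj_semigroup S \<phi> by fact
  show ?thesis
    by (simp add: rel_hom_def bias_of_def szero_closed rep_szero rep_pinj sinv_closed rep_sinv
        mult_closed rep_mult can_skew_diff_closed rep_can_skew_diff can_skew_add_closed
        rep_can_skew_add)
qed

text \<open>
  The points of the representation are the germs at a prime filter that separates \<open>x\<close> from \<open>y\<close>.
\<close>

theorem separating_rel_hom:
  fixes S :: "'a bias_str"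
  assumes "bias S" "x \<in> carrier S" "y \<in> carrier S" "x \<noteq> y"
  obtains \<phi> :: "'a \<Rightarrow> 'a set rel" where "rel_hom S \<phi>" "\<phi> x \<noteq> \<phi> y"
proof -
  interpret bias S by fact
  obtain \<xi> where \<xi>: "idp_prime_filter S \<xi>"
    and ne: "idp_prime_filter.act S \<xi> x \<noteq> idp_prime_filter.act S \<xi> y"
    using separating_prime_filter assms(2-) by metis
  interpret idp_prime_filter S \<xi> by (rule \<xi>)
  have "rel_hom S act"
    by (simp add: rel_hom_def bzero_eq binv_eq skew_diff_eq skew_add_eq szero_closed act_szero
        pinj_act sinv_closed act_sinv mult_closed act_mult orthogonal_skew_diff(1) act_skew_diff
        skew_add_closed act_skew_add)
  with ne show thesis by (intro that)
qed

lemma bias_eval_closed: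
  assumes "bias S" "\<And>v. v \<in> vars t \<Longrightarrow> a v \<in> carrier S"
  shows "eval_term S a t \<in> carrier S"
proof -
  interpret bias S by fact
  show ?thesis
    using assms(2)
    by (induction t) (simp_all add: bzero_eq binv_eq skew_diff_eq skew_add_eq szero_closed
        sinv_closed mult_closed orthogonal_skew_diff(1) skew_add_closed)
qed

section \<open>Locality of evaluation\<close>

text \<open>
  The number of occurrences of variables bounds the distance at which the evaluation of a term looks.
\<close>

primrec leaves :: "'v bterm \<Rightarrow> nat" where
  "leaves (Var v) = 1"
| "leaves Zero = 0"
| "leaves (Inv t) = leaves t"
| "leaves (Mult s t) = leaves s + leaves t"
| "leaves (SDiff s t) = leaves s + leaves t"
| "leaves (SAdd s t) = leaves s + leaves t"

definition ball :: "('v \<Rightarrow> 'p rel) \<Rightarrow> 'v set \<Rightarrow> nat \<Rightarrow> 'p \<Rightarrow> 'p set" where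
  "ball R X r p = ((Id \<union> (\<Union>v\<in>X. R v \<union> (R v)\<inverse>)) ^^ r) `` {p}"

lemma ball_0: "ball R X 0 p = {p}"
  by (simp add: ball_def)

lemma ball_Suc: "ball R X (Suc r) p = (\<Union>q\<in>ball R X r p. {q} \<union> (\<Union>v\<in>X. R v `` {q} \<union> (R v)\<inverse> `` {q}))"
  by (auto simp: ball_def)

lemma ball_trans: "q \<in> ball R X r p \<Longrightarrow> ball R X r' q \<subseteq> ball R X (r + r') p"
  by (auto simp: ball_def relpow_add)

lemma self_in_ball: "p \<in> ball R X r p"
  by (induction r) (auto simp: ball_0 ball_Suc)

lemma ball_mono: "r \<le> r' \<Longrightarrow> ball R X r p \<subseteq> ball R X r' p"
  using ball_trans[OF self_in_ball, where r = "r' - r" and r' = r] by simp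

lemma ball_add_left: "q \<in> ball R X r p \<Longrightarrow> q \<in> ball R X (r + r') p"
  and ball_add_right: "q \<in> ball R X r' p \<Longrightarrow> q \<in> ball R X (r + r') p"
  using ball_mono[of r "r + r'" R X p] ball_mono[of r' "r + r'" R X p] by auto

lemma rel_eval_ball:
  assumes "vars t \<subseteq> X"
  shows "(p, q) \<in> rel_eval R t \<Longrightarrow> q \<in> ball R X (leaves t) p \<and> p \<in> ball R X (leaves t) q"
  using assms
proof (induction t arbitrary: p q)
  case (Var v)
  then show ?case by (auto simp: ball_Suc ball_0)
next
  case (Mult s t)
  from Mult.prems obtain r where r: "(p, r) \<in> rel_eval R t" "(r, q) \<in> rel_eval R s" by auto
  with Mult.IH(2)[OF r(1)] Mult.IH(1)[OF r(2)] Mult.prems(2)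
  have "r \<in> ball R X (leaves t) p" "p \<in> ball R X (leaves t) r"
    "q \<in> ball R X (leaves s) r" "r \<in> ball R X (leaves s) q" by auto
  then show ?case
    using ball_trans[of r R X "leaves t" p "leaves s"] ball_trans[of r R X "leaves s" q "leaves t"]
    by (auto simp: add.commute)
next
  case (SDiff s t)
  then have "q \<in> ball R X (leaves s) p \<and> p \<in> ball R X (leaves s) q" by (simp add: rdiff_def)
  then show ?case by (simp add: ball_add_left)
next
  case (SAdd s t)
  then have "(p, q) \<in> rel_eval R s \<or> (p, q) \<in> rel_eval R t" by (auto simp: radd_def rdiff_def)
  with SAdd show ?case by (auto simp: ball_add_left ball_add_right)
qed auto

lemma card_ball:
  fixes R :: "'v \<Rightarrow> 'p rel"
  assumes "finite X" "\<And>v. pinj (R v)"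
  shows "finite (ball R X r p) \<and> card (ball R X r p) \<le> (2 * card X + 1) ^ r"
proof (induction r)
  case 0
  then show ?case by (simp add: ball_0)
next
  case (Suc r)
  define B where "B q = {q} \<union> (\<Union>v\<in>X. R v `` {q} \<union> (R v)\<inverse> `` {q})" for q
  have one: "finite (Q `` {q}) \<and> card (Q `` {q}) \<le> 1" if "single_valued Q" for Q :: "'p rel" and q
  proof -
    have "Q `` {q} = {r}" if "(q, r) \<in> Q" for r
      using that \<open>single_valued Q\<close> by (auto dest: single_valuedD)
    then have "Q `` {q} = {} \<or> (\<exists>r. Q `` {q} = {r})" by blast
    then show ?thesis by auto
  qed
  have two: "finite (R v `` {q} \<union> (R v)\<inverse> `` {q}) \<and> card (R v `` {q} \<union> (R v)\<inverse> `` {q}) \<le> 2" for v q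
    using one[of "R v" q] one[of "(R v)\<inverse>" q] assms(2)[of v]
      card_Un_le[of "R v `` {q}" "(R v)\<inverse> `` {q}"] by (simp add: pinj_def)
  have B: "finite (B q) \<and> card (B q) \<le> 2 * card X + 1" for q
  proof -
    have "card (\<Union>v\<in>X. R v `` {q} \<union> (R v)\<inverse> `` {q}) \<le> (\<Sum>v\<in>X. card (R v `` {q} \<union> (R v)\<inverse> `` {q}))"
      by (rule card_UN_le[OF assms(1)])
    also have "\<dots> \<le> (\<Sum>v\<in>X. 2)" by (rule sum_mono) (use two in blast)
    finally have "card (B q) \<le> 2 * card X + 1"
      using card_Un_le[of "{q}" "\<Union>v\<in>X. R v `` {q} \<union> (R v)\<inverse> `` {q}"] by (simp add: B_def)
    then show ?thesis using assms(1) two by (auto simp: B_def)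
  qed
  have eq: "ball R X (Suc r) p = (\<Union>q\<in>ball R X r p. B q)" by (simp add: ball_Suc B_def)
  have "card (ball R X (Suc r) p) \<le> (\<Sum>q\<in>ball R X r p. card (B q))"
    unfolding eq by (rule card_UN_le) (use Suc in blast)
  also have "\<dots> \<le> (\<Sum>q\<in>ball R X r p. 2 * card X + 1)" by (rule sum_mono) (use B in blast)
  also have "\<dots> = card (ball R X r p) * (2 * card X + 1)" by simp
  also have "\<dots> \<le> (2 * card X + 1) ^ r * (2 * card X + 1)" using Suc by (intro mult_le_mono) auto
  finally have "card (ball R X (Suc r) p) \<le> (2 * card X + 1) ^ Suc r" by (simp add: mult.commute)
  moreover have "finite (ball R X (Suc r) p)" unfolding eq using Suc B by blast
  ultimately show ?case by blast
qed

text \<open>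
  Restricting all relations to a set \<open>g ` A\<close> containing the ball around \<open>g i\<close> does not change the
  arrows of the value of \<open>t\<close> that start or end at \<open>g i\<close>, and \<open>g\<close> renames the points by elements
  of \<open>A\<close>.  Arrows ending at the point are included because of inverses.  A product and a difference
  move from the given point to one at a distance of at most the number of leaves of one argument and
  evaluate the other argument there, so radii add up.
\<close>

lemma rel_eval_pullback:
  fixes R :: "'v \<Rightarrow> 'p rel" and g :: "'i \<Rightarrow> 'p"
  assumes inj: "inj_on g A"
  defines "R' \<equiv> \<lambda>v. {(i, j) \<in> A \<times> A. (g i, g j) \<in> R v}"
  assumes "vars t \<subseteq> X" "i \<in> A" "ball R X (leaves t) (g i) \<subseteq> g ` A" "j \<in> A"
  shows "((i, j) \<in> rel_eval R' t \<longleftrightarrow> (g i, g j) \<in> rel_eval R t) \<and>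
    ((j, i) \<in> rel_eval R' t \<longleftrightarrow> (g j, g i) \<in> rel_eval R t)"
proof -
  have bound: "rel_eval R' u \<subseteq> A \<times> A" for u by (rule rel_eval_bound) (auto simp: R'_def)
  have diff: "((i, j) \<in> rel_eval R' (SDiff s t) \<longleftrightarrow> (g i, g j) \<in> rel_eval R (SDiff s t)) \<and>
      ((j, i) \<in> rel_eval R' (SDiff s t) \<longleftrightarrow> (g j, g i) \<in> rel_eval R (SDiff s t))"
    if IHs: "\<And>i j. \<lbrakk>i \<in> A; ball R X (leaves s) (g i) \<subseteq> g ` A; j \<in> A\<rbrakk> \<Longrightarrow>
        ((i, j) \<in> rel_eval R' s \<longleftrightarrow> (g i, g j) \<in> rel_eval R s) \<and>
        ((j, i) \<in> rel_eval R' s \<longleftrightarrow> (g j, g i) \<in> rel_eval R s)"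
      and IHt: "\<And>i j. \<lbrakk>i \<in> A; ball R X (leaves t) (g i) \<subseteq> g ` A; j \<in> A\<rbrakk> \<Longrightarrow>
        ((i, j) \<in> rel_eval R' t \<longleftrightarrow> (g i, g j) \<in> rel_eval R t) \<and>
        ((j, i) \<in> rel_eval R' t \<longleftrightarrow> (g j, g i) \<in> rel_eval R t)"
      and X: "vars s \<subseteq> X" "vars t \<subseteq> X"
      and i: "i \<in> A" "ball R X (leaves s + leaves t) (g i) \<subseteq> g ` A" and j: "j \<in> A" for s t i j
  proof -
    have sub: "ball R X (leaves s) (g i) \<subseteq> g ` A" "ball R X (leaves t) (g i) \<subseteq> g ` A"
      using i(2) ball_mono[of "leaves s" "leaves s + leaves t" R X "g i"]
        ball_mono[of "leaves t" "leaves s + leaves t" R X "g i"] by auto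
    have near: "ball R X (leaves t) q \<subseteq> g ` A" if "q \<in> ball R X (leaves s) (g i)" for q
      using ball_trans[OF that, of "leaves t"] i(2) by auto
    have D: "(k \<in> Domain (rel_eval R' t) \<longleftrightarrow> g k \<in> Domain (rel_eval R t)) \<and>
        (k \<in> Range (rel_eval R' t) \<longleftrightarrow> g k \<in> Range (rel_eval R t))"
      if k: "k \<in> A" "ball R X (leaves t) (g k) \<subseteq> g ` A" for k
    proof -
      have in_A: "q \<in> g ` A" if "(g k, q) \<in> rel_eval R t \<or> (q, g k) \<in> rel_eval R t" for q
        using that rel_eval_ball[OF X(2), of "g k" q R] rel_eval_ball[OF X(2), of q "g k" R] k by auto
      have "k \<in> Domain (rel_eval R' t) \<longleftrightarrow> (\<exists>z\<in>A. (k, z) \<in> rel_eval R' t)"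
        "k \<in> Range (rel_eval R' t) \<longleftrightarrow> (\<exists>z\<in>A. (z, k) \<in> rel_eval R' t)"
        using bound[of t] by blast+
      moreover have "g k \<in> Domain (rel_eval R t) \<longleftrightarrow> (\<exists>z\<in>A. (g k, g z) \<in> rel_eval R t)"
        "g k \<in> Range (rel_eval R t) \<longleftrightarrow> (\<exists>z\<in>A. (g z, g k) \<in> rel_eval R t)"
        using in_A unfolding Domain_iff Range_iff by (metis imageE)+
      ultimately show ?thesis using IHt[OF k] by simp
    qed
    note Di = D[OF i(1) sub(2)]
    have Dj: "(j \<in> Domain (rel_eval R' t) \<longleftrightarrow> g j \<in> Domain (rel_eval R t)) \<and>
        (j \<in> Range (rel_eval R' t) \<longleftrightarrow> g j \<in> Range (rel_eval R t))"
      if "(g i, g j) \<in> rel_eval R s \<or> (g j, g i) \<in> rel_eval R s"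
      using that rel_eval_ball[OF X(1), of "g i" "g j" R] rel_eval_ball[OF X(1), of "g j" "g i" R]
        D[OF j near] by blast
    show ?thesis
      using IHs[OF i(1) sub(1) j] Di Dj by (auto simp: rdiff_def simp del: Domain_iff Range_iff)
  qed
  show ?thesis
    using assms(3-)
  proof (induction t arbitrary: i j)
    case (Var v)
    then show ?case by (auto simp: R'_def)
  next
    case Zero
    then show ?case by simp
  next
    case (Inv t)
    then show ?case by simp
  next
    case (Mult s t)
    have X: "vars s \<subseteq> X" "vars t \<subseteq> X" using Mult.prems by auto
    have sub: "ball R X (leaves s) (g i) \<subseteq> g ` A" "ball R X (leaves t) (g i) \<subseteq> g ` A"
      using Mult.prems(3) ball_mono[of "leaves s" "leaves s + leaves t" R X "g i"]
        ball_mono[of "leaves t" "leaves s + leaves t" R X "g i"] by auto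
    have near: "ball R X (leaves s) q \<subseteq> g ` A" if "q \<in> ball R X (leaves t) (g i)" for q
      using ball_trans[OF that, of "leaves s"] Mult.prems(3) by (auto simp: add.commute)
    have near': "ball R X (leaves t) q \<subseteq> g ` A" if "q \<in> ball R X (leaves s) (g i)" for q
      using ball_trans[OF that, of "leaves t"] Mult.prems(3) by auto
    have 1: "(i, z) \<in> rel_eval R' t \<and> (z, j) \<in> rel_eval R' s \<longleftrightarrow>
        (g i, g z) \<in> rel_eval R t \<and> (g z, g j) \<in> rel_eval R s" if "z \<in> A" for z
      using Mult.IH(2)[OF X(2) Mult.prems(2) sub(2) that] Mult.IH(1)[OF X(1) that near Mult.prems(4)]
        rel_eval_ball[OF X(2), of "g i" "g z" R] by blast
    have 2: "(j, z) \<in> rel_eval R' t \<and> (z, i) \<in> rel_eval R' s \<longleftrightarrow>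
        (g j, g z) \<in> rel_eval R t \<and> (g z, g i) \<in> rel_eval R s" if "z \<in> A" for z
      using Mult.IH(1)[OF X(1) Mult.prems(2) sub(1) that] Mult.IH(2)[OF X(2) that near' Mult.prems(4)]
        rel_eval_ball[OF X(1), of "g z" "g i" R] by blast
    have in_A: "q \<in> g ` A" if "(g i, q) \<in> rel_eval R t \<or> (q, g i) \<in> rel_eval R s" for q
      using that rel_eval_ball[OF X(2), of "g i" q R] rel_eval_ball[OF X(1), of q "g i" R] sub by auto
    have "(\<exists>q. (g i, q) \<in> rel_eval R t \<and> (q, g j) \<in> rel_eval R s) \<longleftrightarrow>
        (\<exists>z\<in>A. (g i, g z) \<in> rel_eval R t \<and> (g z, g j) \<in> rel_eval R s)"
      using in_A by (metis imageE)
    moreover have "(\<exists>q. (g j, q) \<in> rel_eval R t \<and> (q, g i) \<in> rel_eval R s) \<longleftrightarrow>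
        (\<exists>z\<in>A. (g j, g z) \<in> rel_eval R t \<and> (g z, g i) \<in> rel_eval R s)"
      using in_A by (metis imageE)
    moreover have "(i, j) \<in> rel_eval R' (Mult s t) \<longleftrightarrow>
        (\<exists>z\<in>A. (i, z) \<in> rel_eval R' t \<and> (z, j) \<in> rel_eval R' s)"
      "(j, i) \<in> rel_eval R' (Mult s t) \<longleftrightarrow>
        (\<exists>z\<in>A. (j, z) \<in> rel_eval R' t \<and> (z, i) \<in> rel_eval R' s)"
      using bound[of t] unfolding rel_eval.simps by blast+
    ultimately show ?case by (simp add: relcomp_unfold 1 2 cong: bex_cong)
  next
    case (SDiff s t)
    from SDiff.prems have X: "vars s \<subseteq> X" "vars t \<subseteq> X" by auto
    from SDiff.prems(3) have "ball R X (leaves s + leaves t) (g i) \<subseteq> g ` A" by simp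
    with SDiff.IH(1)[OF X(1)] SDiff.IH(2)[OF X(2)] X SDiff.prems(2)
    show ?case using SDiff.prems(4) by (rule diff)
  next
    case (SAdd s t)
    from SAdd.prems have X: "vars s \<subseteq> X" "vars t \<subseteq> X" by auto
    from SAdd.prems(3) have sub: "ball R X (leaves s + leaves t) (g i) \<subseteq> g ` A" by simp
    have "ball R X (leaves t) (g i) \<subseteq> g ` A"
      by (rule subset_trans[OF ball_mono sub]) simp
    note t = SAdd.IH(2)[OF X(2) SAdd.prems(2) this SAdd.prems(4)]
    have "((i, j) \<in> rel_eval R' (SDiff s t) \<longleftrightarrow> (g i, g j) \<in> rel_eval R (SDiff s t)) \<and>
        ((j, i) \<in> rel_eval R' (SDiff s t) \<longleftrightarrow> (g j, g i) \<in> rel_eval R (SDiff s t))"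
      using SAdd.IH(1)[OF X(1)] SAdd.IH(2)[OF X(2)] X SAdd.prems(2) sub SAdd.prems(4) by (rule diff)
    then show ?case using t by (simp add: radd_def)
  qed
qed

text \<open>
  Let the two values differ in an arrow from \<open>p\<close> to \<open>q\<close>, in a representation that separates the
  values of \<open>s\<close> and \<open>t\<close> in \<open>S\<close>.  Pull the partial injections back to \<open>{1..N}\<close> along an enumeration of
  the ball around \<open>p\<close> whose radius is large enough for both terms; every step multiplies the number
  of points by at most \<open>2 * card X + 1\<close>.
\<close>

theorem finite_counterexample:
  fixes S :: "'a bias_str"
  assumes S: "bias S" and a: "\<And>v. v \<in> vars s \<union> vars t \<Longrightarrow> a v \<in> carrier S"
    and ne: "eval_term S a s \<noteq> eval_term S a t"
    and X: "finite X" "vars s \<union> vars t \<subseteq> X"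
  obtains N and R :: "'v \<Rightarrow> nat rel"
  where "1 \<le> N" "N \<le> (2 * card X + 1) ^ (leaves s + leaves t)"
    "\<And>v. R v \<subseteq> {1..N} \<times> {1..N}" "\<And>v. pinj (R v)" "rel_eval R s \<noteq> rel_eval R t"
proof -
  \<comment> \<open>with values in the carrier for all variables, all relations below are partial injections\<close>
  define b where "b v = (if v \<in> vars s \<union> vars t then a v else \<zero>\<^bsub>S\<^esub>)" for v
  have eqs: "eval_term S b s = eval_term S a s" "eval_term S b t = eval_term S a t"
    by (rule eval_cong; simp add: b_def)+
  have closed: "eval_term S a s \<in> carrier S" "eval_term S a t \<in> carrier S"
    using bias_eval_closed[OF S, of s a] bias_eval_closed[OF S, of t a] a by simp_all
  obtain \<phi> :: "'a \<Rightarrow> 'a set rel" where hom: "rel_hom S \<phi>"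
    and \<phi>: "\<phi> (eval_term S a s) \<noteq> \<phi> (eval_term S a t)"
    using separating_rel_hom[OF S closed ne] .
  have b: "b v \<in> carrier S" for v using a hom by (simp add: b_def rel_hom_def)
  define Q where "Q = (\<lambda>v. \<phi> (b v))"
  have Q: "pinj (Q v)" for v using hom b by (simp add: Q_def rel_hom_def)
  have "rel_eval Q s \<noteq> rel_eval Q t"
    using \<phi> rel_hom_eval[OF hom, of s b] rel_hom_eval[OF hom, of t b] b eqs by (simp add: Q_def)
  then obtain p q where pq: "(p, q) \<in> rel_eval Q s \<longleftrightarrow> (p, q) \<notin> rel_eval Q t" by auto
  define B where "B = ball Q X (leaves s + leaves t) p"
  have B: "finite B" "card B \<le> (2 * card X + 1) ^ (leaves s + leaves t)"
    using card_ball[of X Q, OF X(1) Q] by (simp_all add: B_def)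
  have "q \<in> ball Q X (leaves s) p \<or> q \<in> ball Q X (leaves t) p"
    using pq rel_eval_ball[of s X p q Q] rel_eval_ball[of t X p q Q] X(2) by blast
  then have qB: "q \<in> B"
    unfolding B_def by (elim disjE) (rule ball_add_left ball_add_right, assumption)+
  have pB: "p \<in> B" unfolding B_def by (rule self_in_ball)
  define N where "N = card B"
  have "card {1..N} = card B" by (simp add: N_def)
  then obtain g where g: "bij_betw g {1..N} B"
    using finite_same_card_bij[OF finite_atLeastAtMost B(1) \<open>card {1..N} = card B\<close>] by blast
  then have g': "inj_on g {1..N}" "g ` {1..N} = B" by (simp_all add: bij_betw_def)
  then obtain i j where ij: "i \<in> {1..N}" "g i = p" "j \<in> {1..N}" "g j = q"
    using pB qB unfolding g'(2)[symmetric] by (elim imageE) simp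
  define R where "R v = {(i, j) \<in> {1..N} \<times> {1..N}. (g i, g j) \<in> Q v}" for v
  have R: "R = (\<lambda>v. {(i, j) \<in> {1..N} \<times> {1..N}. (g i, g j) \<in> Q v})" by (simp add: R_def fun_eq_iff)
  have pb: "(i, j) \<in> rel_eval R u \<longleftrightarrow> (p, q) \<in> rel_eval Q u"
    if u: "vars u \<subseteq> X" "ball Q X (leaves u) p \<subseteq> B" for u
    using rel_eval_pullback[OF g'(1) u(1) ij(1) _ ij(3), of Q, folded R, unfolded ij(2,4) g'(2)] u(2)
    by blast
  have sub: "ball Q X (leaves s) p \<subseteq> B" "ball Q X (leaves t) p \<subseteq> B"
    unfolding B_def by (rule ball_mono, simp)+
  have "(i, j) \<in> rel_eval R s \<longleftrightarrow> (i, j) \<notin> rel_eval R t"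
    using pq pb[OF _ sub(1)] pb[OF _ sub(2)] X(2) by simp
  then have R_ne: "rel_eval R s \<noteq> rel_eval R t" by auto
  have R_pinj: "pinj (R v)" for v
  proof (rule pinjI)
    show "y = y'" if "(x, y) \<in> R v" "(x, y') \<in> R v" for x y y'
      using pinjD[OF Q[of v], of "g x" "g y" "g y'"] inj_onD[OF g'(1), of y y'] that
      by (simp add: R_def)
    show "x = x'" if "(x, y) \<in> R v" "(x', y) \<in> R v" for x x' y
      using pinjD'[OF Q[of v], of "g x" "g y" "g x'"] inj_onD[OF g'(1), of x x'] that
      by (simp add: R_def)
  qed
  have "1 \<le> N" using B pB by (auto simp: N_def Suc_le_eq card_gt_0_iff)
  moreover have "R v \<subseteq> {1..N} \<times> {1..N}" for v by (auto simp: R_def)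
  ultimately show thesis using B(2) R_pinj R_ne unfolding N_def[symmetric] by (intro that)
qed

section \<open>The finite symmetric biases generate all biases\<close>

lemma graph_iff: "(p, q) \<in> Map.graph f \<longleftrightarrow> f p = Some q"
  by (simp add: Map.graph_def)

lemma graph_surj:
  assumes "pinj R" obtains f where "Map.graph f = R"
proof
  let ?f = "\<lambda>p. if p \<in> Domain R then Some (THE q. (p, q) \<in> R) else None"
  have "?f p = Some q \<longleftrightarrow> (p, q) \<in> R" for p q
  proof -
    have "(THE q. (p, q) \<in> R) = q" if "(p, q) \<in> R" for q
      using that assms by (blast intro: the_equality dest: pinjD)
    then show ?thesis by auto
  qed
  then show "Map.graph ?f = R" by (auto simp: graph_iff)
qed

lemma sym_semigroup_iff:
  "f \<in> carrier (sym_semigroup N) \<longleftrightarrow> Map.graph f \<subseteq> {1..N} \<times> {1..N} \<and> pinj (Map.graph f)"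
proof -
  have "Map.graph f \<subseteq> {1..N} \<times> {1..N} \<longleftrightarrow> dom f \<subseteq> {1..N} \<and> ran f \<subseteq> {1..N}"
    by (auto simp: Map.graph_def dom_def ran_def)
  moreover have "pinj (Map.graph f) \<longleftrightarrow> inj_on f (dom f)"
    unfolding pinj_def single_valued_def inj_on_def by (auto simp: graph_iff dom_def)
  ultimately show ?thesis by (simp add: sym_semigroup_def)
qed

lemma pinj_semigroup_sym: "pinj_semigroup (sym_semigroup N) Map.graph"
proof
  have ex: "\<exists>z\<in>carrier (sym_semigroup N). Map.graph z = R"
    if "R \<subseteq> {1..N} \<times> {1..N}" "pinj R" for R
    using graph_surj[OF that(2)] that sym_semigroup_iff by metis
  show "inj_on Map.graph (carrier (sym_semigroup N))"
  proof (rule inj_onI, rule ext)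
    fix f g :: "nat \<rightharpoonup> nat" and p assume "Map.graph f = Map.graph g"
    then have "f p = Some q \<longleftrightarrow> g p = Some q" for q by (simp flip: graph_iff)
    then show "f p = g p" by (metis option.exhaust)
  qed
  have mult: "mult (sym_semigroup N) = (\<circ>\<^sub>m)" by (simp add: sym_semigroup_def)
  show "\<exists>z\<in>carrier (sym_semigroup N). Map.graph z = {}"
    by (intro ex pinj_empty) auto
  fix x assume x: "x \<in> carrier (sym_semigroup N)"
  show "\<exists>y\<in>carrier (sym_semigroup N). Map.graph y = (Map.graph x)\<inverse>"
    using x by (intro ex pinj_converse) (auto simp: sym_semigroup_iff)
  show "pinj (Map.graph x)" using x by (simp add: sym_semigroup_iff)
  fix y assume "y \<in> carrier (sym_semigroup N)"
  with x have xy: "x \<in> carrier (sym_semigroup N)" "y \<in> carrier (sym_semigroup N)"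
    by simp_all
  show "Map.graph (x \<cdot>\<^bsub>sym_semigroup N\<^esub> y) = Map.graph y O Map.graph x"
    by (simp add: mult graph_map_comp)
  show "x \<cdot>\<^bsub>sym_semigroup N\<^esub> y \<in> carrier (sym_semigroup N)"
    using xy relcomp_subset_Sigma[of "Map.graph y" "{1..N}" "{1..N}" "Map.graph x" "{1..N}"]
    by (simp add: sym_semigroup_iff mult graph_map_comp pinj_relcomp)
  show "\<exists>z\<in>carrier (sym_semigroup N). Map.graph z = rdiff (Map.graph x) (Map.graph y)"
    using xy by (intro ex pinj_rdiff) (auto simp: sym_semigroup_iff rdiff_def)
  show "\<exists>z\<in>carrier (sym_semigroup N). Map.graph z = radd (Map.graph x) (Map.graph y)"
    using xy by (intro ex pinj_radd) (auto simp: sym_semigroup_iff rdiff_def radd_def)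
qed

lemma sym_bias: shows rel_hom_sym: "rel_hom (sym_bias N) Map.graph" and bias_sym: "bias (sym_bias N)"
proof -
  interpret pinj_semigroup "sym_semigroup N" Map.graph by (rule pinj_semigroup_sym)
  show "rel_hom (sym_bias N) Map.graph"
    unfolding sym_bias_def by (rule rel_hom_bias_of) (rule pinj_semigroup_sym)
  then show "bias (sym_bias N)"
    by (rule faithful_rel_hom_bias) (use rep_inj in \<open>simp add: sym_bias_def bias_of_def\<close>)
qed

lemma finite_vars: "finite (vars t)"
  by (induction t) auto

text \<open>
  A variety is determined by the identities of its members, so it suffices that an identity holding
  in all \<open>\<I>\<^sub>N\<close> holds in all biases.  The empty set of identities gives the other inclusion.
\<close>

theorem generated_by_sym:
  "generated_variety {sym_bias N | N. N \<ge> 1} = {S :: 'a bias_str. bias S}"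
proof (intro equalityI subsetI CollectI)
  fix S :: "'a bias_str" assume "S \<in> generated_variety {sym_bias N | N. N \<ge> 1}"
  moreover have "{sym_bias N | N. N \<ge> 1} \<subseteq> bias_variety {}"
    by (auto simp: bias_variety_def satisfies_def bias_sym)
  ultimately have "S \<in> bias_variety {}" unfolding generated_variety_def by blast
  then show "bias S" by (simp add: bias_variety_def)
next
  fix S :: "'a bias_str" assume "S \<in> {S. bias S}"
  then have S: "bias S" by simp
  have "satisfies S E" if E: "{sym_bias N | N. N \<ge> 1} \<subseteq> bias_variety E" for E
    unfolding satisfies_def
  proof (clarify, rule ccontr)
    fix s t a assume st: "(s, t) \<in> E" and a: "range a \<subseteq> carrier S"
      and ne: "eval_term S a s \<noteq> eval_term S a t"
    obtain N and R :: "nat \<Rightarrow> nat rel" where N: "1 \<le> N"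
      "N \<le> (2 * card (vars s \<union> vars t) + 1) ^ (leaves s + leaves t)"
      and R: "\<And>v. R v \<subseteq> {1..N} \<times> {1..N}" "\<And>v. pinj (R v)"
      and R_ne: "rel_eval R s \<noteq> rel_eval R t"
      by (rule finite_counterexample[OF S _ ne, of "vars s \<union> vars t"])
        (use a finite_vars in auto)
    have "\<exists>f. Map.graph f = R v" for v using graph_surj[OF R(2)] by metis
    then obtain f where f: "Map.graph (f v) = R v" for v by metis
    have fc: "f v \<in> carrier (sym_bias N)" for v
      using R[of v] by (simp add: sym_bias_def bias_of_def sym_semigroup_iff f)
    have "eval_term (sym_bias N) f s = eval_term (sym_bias N) f t"
    proof -
      have "satisfies (sym_bias N) E" using E N(1) by (auto simp: bias_variety_def)
      moreover have "range f \<subseteq> carrier (sym_bias N)" using fc by auto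
      ultimately show ?thesis using st unfolding satisfies_def by blast
    qed
    then show False
      using rel_hom_eval[OF rel_hom_sym, of s f N] rel_hom_eval[OF rel_hom_sym, of t f N] fc f R_ne
      by simp
  qed
  with S show "S \<in> generated_variety {sym_bias N | N. N \<ge> 1}"
    by (auto simp: generated_variety_def bias_variety_def)
qed

section \<open>Free biases\<close>

lemma term_algebra_simps [simp]:
  "t \<in> carrier (term_algebra X) \<longleftrightarrow> vars t \<subseteq> X"
  "s \<cdot>\<^bsub>term_algebra X\<^esub> t = Mult s t" "\<zero>\<^bsub>term_algebra X\<^esub> = Zero" "binv (term_algebra X) t = Inv t"
  "s \<oslash>\<^bsub>term_algebra X\<^esub> t = SDiff s t" "s \<nabla>\<^bsub>term_algebra X\<^esub> t = SAdd s t"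
  by (simp_all add: term_algebra_def)

lemma quotient_simps:
  assumes c: "congruence (term_algebra X) \<theta>" and s: "vars s \<subseteq> X" and t: "vars t \<subseteq> X"
  defines "Q \<equiv> quotient_algebra (term_algebra X) \<theta>"
  shows "\<theta> `` {s} \<cdot>\<^bsub>Q\<^esub> \<theta> `` {t} = \<theta> `` {Mult s t}" "binv Q (\<theta> `` {s}) = \<theta> `` {Inv s}"
    "\<theta> `` {s} \<oslash>\<^bsub>Q\<^esub> \<theta> `` {t} = \<theta> `` {SDiff s t}" "\<theta> `` {s} \<nabla>\<^bsub>Q\<^esub> \<theta> `` {t} = \<theta> `` {SAdd s t}"
    "\<zero>\<^bsub>Q\<^esub> = \<theta> `` {Zero}"
proof -
  let ?C = "carrier (term_algebra X)"
  from c have e: "equiv ?C \<theta>" by (simp add: congruence_def)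
  have c1: "(Inv x, Inv x') \<in> \<theta>" if "(x, x') \<in> \<theta>" for x x'
    using c that by (auto simp: congruence_def)
  have c2: "(Mult x y, Mult x' y') \<in> \<theta>" "(SDiff x y, SDiff x' y') \<in> \<theta>" "(SAdd x y, SAdd x' y') \<in> \<theta>"
    if "(x, x') \<in> \<theta>" "(y, y') \<in> \<theta>" for x x' y y'
    using c that by (auto simp: congruence_def)
  have bin: "(\<Union>x\<in>\<theta> `` {s}. \<Union>y\<in>\<theta> `` {t}. \<theta> `` {f x y}) = \<theta> `` {f s t}"
    if "\<And>x x' y y'. (x, x') \<in> \<theta> \<Longrightarrow> (y, y') \<in> \<theta> \<Longrightarrow> (f x y, f x' y') \<in> \<theta>" for f
    by (rule UN_equiv_class2[OF e e])
      (use s t in \<open>auto simp: congruent2_def intro!: equiv_class_eq[OF e] that\<close>)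
  show "\<theta> `` {s} \<cdot>\<^bsub>Q\<^esub> \<theta> `` {t} = \<theta> `` {Mult s t}" "\<theta> `` {s} \<oslash>\<^bsub>Q\<^esub> \<theta> `` {t} = \<theta> `` {SDiff s t}"
    "\<theta> `` {s} \<nabla>\<^bsub>Q\<^esub> \<theta> `` {t} = \<theta> `` {SAdd s t}"
    unfolding Q_def quotient_algebra_def using bin[OF c2(1)] bin[OF c2(2)] bin[OF c2(3)] by simp_all
  have "(\<Union>x\<in>\<theta> `` {s}. \<theta> `` {Inv x}) = \<theta> `` {Inv s}"
    by (rule UN_equiv_class[OF e])
      (use s in \<open>auto simp: congruent_def intro!: equiv_class_eq[OF e] c1\<close>)
  then show "binv Q (\<theta> `` {s}) = \<theta> `` {Inv s}" by (simp add: Q_def quotient_algebra_def)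
  show "\<zero>\<^bsub>Q\<^esub> = \<theta> `` {Zero}" by (simp add: Q_def quotient_algebra_def)
qed

lemma quotient_carrierE:
  assumes "A \<in> carrier (quotient_algebra (term_algebra X) \<theta>)"
  obtains t where "vars t \<subseteq> X" "A = \<theta> `` {t}"
  using assms by (auto simp: quotient_algebra_def quotient_def)

lemma quotient_carrierI:
  "vars t \<subseteq> X \<Longrightarrow> \<theta> `` {t} \<in> carrier (quotient_algebra (term_algebra X) \<theta>)"
  by (auto simp: quotient_algebra_def quotient_def)

lemma eval_quotient:
  assumes "congruence (term_algebra X) \<theta>" "vars t \<subseteq> X"
  shows "eval_term (quotient_algebra (term_algebra X) \<theta>) (\<lambda>v. \<theta> `` {Var v}) t = \<theta> `` {t}"
  using assms(2)
  by (induction t) (simp_all add: quotient_simps[OF assms(1)] quotient_simps(5)[OF assms(1) assms(2,2)])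

text \<open>
  The kernel of the evaluation of the term algebra at \<open>R\<close>.  Its quotient is isomorphic to the
  algebra generated by the relations \<open>R v\<close> with \<open>v \<in> X\<close>, which is a bias if these are partial
  injections.
\<close>

definition eval_kernel :: "'v set \<Rightarrow> ('v \<Rightarrow> 'p rel) \<Rightarrow> ('v bterm \<times> 'v bterm) set" where
  "eval_kernel X R = {(s, t). vars s \<subseteq> X \<and> vars t \<subseteq> X \<and> rel_eval R s = rel_eval R t}"

lemma congruence_eval_kernel: "congruence (term_algebra X) (eval_kernel X R)"
  unfolding congruence_def
  by (auto simp: eval_kernel_def intro!: equivI refl_onI symI transI)

text \<open>
  A congruence contained in the kernel of an evaluation lets this evaluation factor through the
  quotient.  On a class, all terms have the same value, which is therefore the union of the values.
\<close>

lemma rel_hom_quotient: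
  fixes R :: "'v \<Rightarrow> 'p rel"
  assumes c: "congruence (term_algebra X) \<theta>" and sub: "\<theta> \<subseteq> eval_kernel X R"
    and R: "\<And>v. pinj (R v)"
  defines "\<psi> \<equiv> \<lambda>A. \<Union>t\<in>A. rel_eval R t"
  shows "rel_hom (quotient_algebra (term_algebra X) \<theta>) \<psi>"
    and "vars t \<subseteq> X \<Longrightarrow> \<psi> (\<theta> `` {t}) = rel_eval R t"
proof -
  let ?Q = "quotient_algebra (term_algebra X) \<theta>"
  from c have e: "equiv (carrier (term_algebra X)) \<theta>" by (simp add: congruence_def)
  have \<psi>: "\<psi> (\<theta> `` {t}) = rel_eval R t" if "vars t \<subseteq> X" for t
  proof -
    have "t \<in> \<theta> `` {t}" using equiv_class_self[OF e, of t] that by simp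
    moreover have "rel_eval R t' = rel_eval R t" if "t' \<in> \<theta> `` {t}" for t'
      using that sub by (auto simp: eval_kernel_def)
    ultimately show ?thesis unfolding \<psi>_def by blast
  qed
  then show "vars t \<subseteq> X \<Longrightarrow> \<psi> (\<theta> `` {t}) = rel_eval R t" .
  note op = quotient_simps[OF c]
  have zero: "\<zero>\<^bsub>?Q\<^esub> = \<theta> `` {Zero}" by (rule op(5)[of Zero Zero]) simp_all
  show "rel_hom ?Q \<psi>"
    unfolding rel_hom_def zero
    by (intro conjI ballI; (elim quotient_carrierE)?)
      (simp_all add: op \<psi> quotient_carrierI pinj_rel_eval R)
qed

lemma bias_eval_kernel_quotient:
  assumes "\<And>v. pinj (R v)"
  shows "bias (quotient_algebra (term_algebra X) (eval_kernel X R))"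
proof (rule faithful_rel_hom_bias)
  let ?K = "eval_kernel X R"
  note h = rel_hom_quotient[OF congruence_eval_kernel order_refl assms]
  show "rel_hom (quotient_algebra (term_algebra X) ?K) (\<lambda>A. \<Union>t\<in>A. rel_eval R t)" by (rule h)
  show "inj_on (\<lambda>A. \<Union>t\<in>A. rel_eval R t) (carrier (quotient_algebra (term_algebra X) ?K))"
  proof (rule inj_onI)
    fix A B assume "A \<in> carrier (quotient_algebra (term_algebra X) ?K)"
      "B \<in> carrier (quotient_algebra (term_algebra X) ?K)"
      and eq: "(\<Union>t\<in>A. rel_eval R t) = (\<Union>t\<in>B. rel_eval R t)"
    then obtain s t where st: "vars s \<subseteq> X" "A = ?K `` {s}" "vars t \<subseteq> X" "B = ?K `` {t}"
      by (elim quotient_carrierE)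
    then have "rel_eval R s = rel_eval R t"
      using eq h(2)[OF st(1)] h(2)[OF st(3)] by simp
    then show "A = B" using st by (auto simp: eval_kernel_def)
  qed
qed

text \<open>
  The intersection is taken over a nonempty family of congruences, as the kernel of the evaluation
  at the empty relations belongs to it.
\<close>

lemma congruence_free_congruence: "congruence (term_algebra X) (free_congruence X)"
proof -
  define F where
    "F = {\<theta>. congruence (term_algebra X) \<theta> \<and> bias (quotient_algebra (term_algebra X) \<theta>)}"
  let ?C = "carrier (term_algebra X)"
  have K: "eval_kernel X (\<lambda>_. {} :: nat rel) \<in> F"
    by (simp add: F_def congruence_eval_kernel bias_eval_kernel_quotient pinj_empty)
  have F: "equiv ?C \<theta>" "\<forall>(x, x')\<in>\<theta>. (Inv x, Inv x') \<in> \<theta>"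
    "\<forall>(x, x')\<in>\<theta>. \<forall>(y, y')\<in>\<theta>.
      (Mult x y, Mult x' y') \<in> \<theta> \<and> (SDiff x y, SDiff x' y') \<in> \<theta> \<and> (SAdd x y, SAdd x' y') \<in> \<theta>"
    if "\<theta> \<in> F" for \<theta>
    using that by (simp_all add: F_def congruence_def)
  have "equiv ?C (\<Inter>F)"
  proof (rule equivI)
    show "\<Inter>F \<subseteq> ?C \<times> ?C" using K by (auto simp: eval_kernel_def)
    show "refl_on ?C (\<Inter>F)" using F(1) by (auto simp: equiv_def refl_on_def)
    show "sym (\<Inter>F)"
      using F(1) by (intro sym_INTER[of F "\<lambda>x. x", simplified]) (auto simp: equiv_def)
    show "trans (\<Inter>F)"
      using F(1) by (intro trans_INTER[of F "\<lambda>x. x", simplified]) (auto simp: equiv_def)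
  qed
  moreover have "\<forall>(x, x')\<in>\<Inter>F. (Inv x, Inv x') \<in> \<Inter>F" using F(2) by fast
  moreover have "\<forall>(x, x')\<in>\<Inter>F. \<forall>(y, y')\<in>\<Inter>F.
      (Mult x y, Mult x' y') \<in> \<Inter>F \<and> (SDiff x y, SDiff x' y') \<in> \<Inter>F \<and> (SAdd x y, SAdd x' y') \<in> \<Inter>F"
  proof (clarify, intro conjI InterI)
    fix x x' y y' \<theta> assume "(x, x') \<in> \<Inter>F" "(y, y') \<in> \<Inter>F" "\<theta> \<in> F"
    then have "(x, x') \<in> \<theta>" "(y, y') \<in> \<theta>" "\<theta> \<in> F" by auto
    then show "(Mult x y, Mult x' y') \<in> \<theta>" "(SDiff x y, SDiff x' y') \<in> \<theta>"
      "(SAdd x y, SAdd x' y') \<in> \<theta>" using F(3) by fast+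
  qed
  moreover have "free_congruence X = \<Inter>F" by (simp add: free_congruence_def F_def)
  ultimately show ?thesis by (simp add: congruence_def)
qed

lemma free_congruence_subset:
  assumes "\<And>v. pinj (R v)" shows "free_congruence X \<subseteq> eval_kernel X R"
  unfolding free_congruence_def
  by (rule Inter_lower) (simp add: congruence_eval_kernel bias_eval_kernel_quotient assms)

lemma free_congruence_counterexample:
  assumes s: "vars s \<subseteq> X" and t: "vars t \<subseteq> X" and "(s, t) \<notin> free_congruence X"
    and Y: "finite Y" "vars s \<union> vars t \<subseteq> Y"
  obtains N and R :: "'v \<Rightarrow> nat rel"
  where "N \<le> (2 * card Y + 1) ^ (leaves s + leaves t)"
    "\<And>v. R v \<subseteq> {1..N} \<times> {1..N}" "\<And>v. pinj (R v)" "rel_eval R s \<noteq> rel_eval R t"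
proof -
  from assms(3) obtain \<theta> where c: "congruence (term_algebra X) \<theta>"
    and b: "bias (quotient_algebra (term_algebra X) \<theta>)" and ne: "(s, t) \<notin> \<theta>"
    by (auto simp: free_congruence_def)
  from c have e: "equiv (carrier (term_algebra X)) \<theta>" by (simp add: congruence_def)
  have "\<theta> `` {s} \<noteq> \<theta> `` {t}" using ne eq_equiv_class_iff[OF e] s t by simp
  with eval_quotient[OF c s] eval_quotient[OF c t]
  have ne': "eval_term (quotient_algebra (term_algebra X) \<theta>) (\<lambda>v. \<theta> `` {Var v}) s \<noteq>
      eval_term (quotient_algebra (term_algebra X) \<theta>) (\<lambda>v. \<theta> `` {Var v}) t" by simp
  show thesis
  proof (rule finite_counterexample[OF b _ ne' Y])
    show "\<theta> `` {Var v} \<in> carrier (quotient_algebra (term_algebra X) \<theta>)" if "v \<in> vars s \<union> vars t" for v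
      by (rule quotient_carrierI) (use that s t in auto)
  qed (rule that)
qed

theorem free_bias_residually_finite: "residually_finite (free_bias X)"
  unfolding residually_finite_def
proof (intro ballI impI)
  fix x y assume x: "x \<in> carrier (free_bias X)" and y: "y \<in> carrier (free_bias X)" and ne: "x \<noteq> y"
  let ?F = "free_congruence X"
  note c = congruence_free_congruence[of X]
  obtain s t where st: "vars s \<subseteq> X" "x = ?F `` {s}" "vars t \<subseteq> X" "y = ?F `` {t}"
    using x y unfolding free_bias_def by (elim quotient_carrierE)
  from c have e: "equiv (carrier (term_algebra X)) ?F" by (simp add: congruence_def)
  have "(s, t) \<notin> ?F" using ne eq_equiv_class_iff[OF e] st by simp
  then obtain N and R :: "'a \<Rightarrow> nat rel"
    where "N \<le> (2 * card (vars s \<union> vars t) + 1) ^ (leaves s + leaves t)"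
      and R: "\<And>v. R v \<subseteq> {1..N} \<times> {1..N}" "\<And>v. pinj (R v)" "rel_eval R s \<noteq> rel_eval R t"
    by (rule free_congruence_counterexample[OF st(1,3) _ _ order_refl]) (auto simp: finite_vars)
  define \<psi> where "\<psi> = (\<lambda>A. \<Union>t\<in>A. rel_eval R t)"
  note h = rel_hom_quotient[where R = R, OF c free_congruence_subset[OF R(2)] R(2), folded \<psi>_def free_bias_def]
  \<comment> \<open>a copy of the symmetric bias whose elements are natural numbers\<close>
  define P where "P = {Q :: nat rel. Q \<subseteq> {1..N} \<times> {1..N} \<and> pinj Q}"
  have "finite P" by (rule finite_subset[of _ "Pow ({1..N} \<times> {1..N})"]) (auto simp: P_def)
  then obtain e :: "nat rel \<Rightarrow> nat" where e: "inj_on e P" using finite_imp_inj_to_nat_seg by metis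
  define d where "d = inv_into P e"
  have de: "d (e Q) = Q" if "Q \<in> P" for Q using e that by (simp add: d_def)
  define T :: "nat bias_str" where "T = \<lparr>carrier = e ` P, mult = (\<lambda>a b. e (d b O d a)), bzero = e {},
    binv = (\<lambda>a. e ((d a)\<inverse>)), skew_diff = (\<lambda>a b. e (rdiff (d a) (d b))),
    skew_add = (\<lambda>a b. e (radd (d a) (d b)))\<rparr>"
  have P: "{} \<in> P" "\<And>Q. Q \<in> P \<Longrightarrow> pinj Q" "\<And>Q. Q \<in> P \<Longrightarrow> Q\<inverse> \<in> P"
    "\<And>Q Q'. Q \<in> P \<Longrightarrow> Q' \<in> P \<Longrightarrow> Q O Q' \<in> P"
    "\<And>Q Q'. Q \<in> P \<Longrightarrow> Q' \<in> P \<Longrightarrow> rdiff Q Q' \<in> P" "\<And>Q Q'. Q \<in> P \<Longrightarrow> Q' \<in> P \<Longrightarrow> radd Q Q' \<in> P"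
    unfolding P_def
    by (auto simp: pinj_empty pinj_converse pinj_relcomp pinj_rdiff pinj_radd)
      (auto simp: rdiff_def radd_def)
  have T: "rel_hom T d" unfolding rel_hom_def T_def by (auto simp: P de)
  have "bias T"
    by (rule faithful_rel_hom_bias[OF T]) (auto simp: T_def de intro!: inj_onI)
  moreover have "finite (carrier T)" using \<open>finite P\<close> by (simp add: T_def)
  moreover have "(\<lambda>A. e (\<psi> A)) \<in> bias_hom (free_bias X) T"
  proof -
    have "\<psi> A \<in> P" if "A \<in> carrier (free_bias X)" for A
    proof -
      from that obtain u where "vars u \<subseteq> X" "A = ?F `` {u}"
        unfolding free_bias_def by (rule quotient_carrierE)
      then have "\<psi> A = rel_eval R u" using h(2) by (simp add: \<psi>_def)
      then show ?thesis unfolding P_def using R by (simp add: rel_eval_bound pinj_rel_eval)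
    qed
    with h(1) show ?thesis unfolding bias_hom_def rel_hom_def by (simp add: T_def de)
  qed
  moreover have "e (\<psi> x) \<noteq> e (\<psi> y)"
  proof -
    have "\<psi> x = rel_eval R s" "\<psi> y = rel_eval R t" using st h(2) by (simp_all add: \<psi>_def)
    moreover have "rel_eval R u \<in> P" for u
      unfolding P_def using R by (simp add: rel_eval_bound pinj_rel_eval)
    ultimately show ?thesis using R(3) e by (auto dest: inj_onD)
  qed
  ultimately show "\<exists>(T :: nat bias_str) f. bias T \<and> finite (carrier T) \<and>
      f \<in> bias_hom (free_bias X) T \<and> f x \<noteq> f y" by blast
qed

text \<open>
  If the two terms represent different elements, there is a counterexample on some \<open>{1..N}\<close> with
  \<open>N < m\<close>, and \<open>{1..N} \<subseteq> {..<m}\<close>.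
\<close>

theorem word_problem_iff:
  fixes n :: nat
  assumes s: "vars s \<subseteq> {..<n}" and t: "vars t \<subseteq> {..<n}"
    and m: "(2 * n + 1) ^ (leaves s + leaves t) < m"
  shows "eval_term (free_bias {..<n}) (free_gen {..<n}) s =
      eval_term (free_bias {..<n}) (free_gen {..<n}) t \<longleftrightarrow>
    (\<forall>R. (\<forall>v. R v \<subseteq> {..<m} \<times> {..<m} \<and> pinj (R v)) \<longrightarrow> rel_eval R s = rel_eval R t)"
    (is "?L \<longleftrightarrow> ?R")
proof -
  let ?F = "free_congruence {..<n}"
  have gen: "free_gen {..<n} = (\<lambda>v. ?F `` {Var v})" by (simp add: free_gen_def fun_eq_iff)
  have e: "equiv (carrier (term_algebra {..<n})) ?F"
    using congruence_free_congruence[of "{..<n}"] by (simp add: congruence_def)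
  have L: "?L \<longleftrightarrow> (s, t) \<in> ?F"
    unfolding gen free_bias_def
    using eval_quotient[OF congruence_free_congruence s]
      eval_quotient[OF congruence_free_congruence t] eq_equiv_class_iff[OF e] s t by simp
  show ?thesis
  proof
    assume ?L
    show ?R
    proof (intro allI impI)
      fix R :: "nat \<Rightarrow> nat rel"
      assume "\<forall>v. R v \<subseteq> {..<m} \<times> {..<m} \<and> pinj (R v)"
      then have "(s, t) \<in> eval_kernel {..<n} R"
        using L \<open>?L\<close> free_congruence_subset[of R "{..<n}"] by blast
      then show "rel_eval R s = rel_eval R t" by (simp add: eval_kernel_def)
    qed
  next
    assume R: ?R
    show ?L
    proof (rule ccontr)
      assume "\<not> ?L"
      then obtain N and R :: "nat \<Rightarrow> nat rel"
        where N: "N \<le> (2 * n + 1) ^ (leaves s + leaves t)"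
          and R': "\<And>v. R v \<subseteq> {1..N} \<times> {1..N}" "\<And>v. pinj (R v)" "rel_eval R s \<noteq> rel_eval R t"
        using free_congruence_counterexample[OF s t, of "{..<n}"] L s t by auto
      have "{1..N} \<subseteq> {..<m}" using N m by auto
      then have "R v \<subseteq> {..<m} \<times> {..<m}" for v using R'(1)[of v] by fastforce
      with R R' show False by blast
    qed
  qed
qed

section \<open>Recursive functions and predicates\<close>

text \<open>
  Truth is represented by \<open>0\<close>, so that the minimization operator searches for an argument at which
  the predicate holds.
\<close>

definition recpred :: "nat \<Rightarrow> (nat list \<Rightarrow> bool) \<Rightarrow> bool" where
  "recpred k P \<longleftrightarrow> recursive k (\<lambda>xs. if P xs then 0 else 1)"

named_theorems rec_intros

text \<open>
  The rules below show by resolution that a function or predicate of a list \<open>xs\<close> is recursive,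
  following the syntax of its body.  The variables of the body are \<open>hd xs\<close>, \<open>hd (tl xs)\<close> and so on;
  a variable bound by a quantifier or by \<open>LEAST\<close> becomes the new head, which shifts the others.
\<close>

lemma recursive_vars [rec_intros]:
  "recursive (Suc k) hd"
  "recursive (Suc (Suc k)) (\<lambda>xs. hd (tl xs))"
  "recursive (Suc (Suc (Suc k))) (\<lambda>xs. hd (tl (tl xs)))"
  "recursive (Suc (Suc (Suc (Suc k)))) (\<lambda>xs. hd (tl (tl (tl xs))))"
  "recursive (Suc (Suc (Suc (Suc (Suc k))))) (\<lambda>xs. hd (tl (tl (tl (tl xs)))))"
  "recursive (Suc (Suc (Suc (Suc (Suc (Suc k)))))) (\<lambda>xs. hd (tl (tl (tl (tl (tl xs))))))"
  "recursive (Suc (Suc (Suc (Suc (Suc (Suc (Suc k)))))))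
    (\<lambda>xs. hd (tl (tl (tl (tl (tl (tl xs)))))))"
  "recursive (Suc (Suc (Suc (Suc (Suc (Suc (Suc (Suc k))))))))
    (\<lambda>xs. hd (tl (tl (tl (tl (tl (tl (tl xs))))))))"
  by (rule extensional[OF projection[of 0]] extensional[OF projection[of 1]]
      extensional[OF projection[of 2]] extensional[OF projection[of 3]]
      extensional[OF projection[of 4]] extensional[OF projection[of 5]]
      extensional[OF projection[of 6]] extensional[OF projection[of 7]];
      auto simp: length_Suc_conv numeral_eq_Suc)+

lemma recursive_comp1:
  assumes "recursive (Suc 0) (\<lambda>xs. F (hd xs))" "recursive k f"
  shows "recursive k (\<lambda>xs. F (f xs))"
  using composition[of "[f]" "\<lambda>xs. F (hd xs)" k] assms by simp

lemma recursive_comp2: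
  assumes "recursive (Suc (Suc 0)) (\<lambda>xs. F (hd xs) (hd (tl xs)))" "recursive k f" "recursive k g"
  shows "recursive k (\<lambda>xs. F (f xs) (g xs))"
  using composition[of "[f, g]" "\<lambda>xs. F (hd xs) (hd (tl xs))" k] assms by auto

lemma recursive_comp3:
  assumes "recursive (Suc (Suc (Suc 0))) (\<lambda>xs. F (hd xs) (hd (tl xs)) (hd (tl (tl xs))))"
    "recursive k f" "recursive k g" "recursive k h"
  shows "recursive k (\<lambda>xs. F (f xs) (g xs) (h xs))"
  using composition[of "[f, g, h]" "\<lambda>xs. F (hd xs) (hd (tl xs)) (hd (tl (tl xs)))" k] assms by auto

lemma recursive_tl:
  assumes "recursive k f" shows "recursive (Suc k) (\<lambda>xs. f (tl xs))"
proof (rule extensional)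
  show "recursive (Suc k) (\<lambda>xs. f (map (\<lambda>g. g xs) (map (\<lambda>i xs. xs ! Suc i) [0..<k])))"
    by (rule composition) (use assms in \<open>auto intro: projection\<close>)
  show "f (map (\<lambda>g. g xs) (map (\<lambda>i xs. xs ! Suc i) [0..<k])) = f (tl xs)" if "length xs = Suc k" for xs
    using that by (intro arg_cong[of _ _ f] nth_equalityI) (auto simp: nth_tl)
qed

lemma recursive_Suc [rec_intros]: "recursive k f \<Longrightarrow> recursive k (\<lambda>xs. Suc (f xs))"
proof (rule recursive_comp1[of Suc])
  show "recursive (Suc 0) (\<lambda>xs. Suc (hd xs))"
    by (rule extensional[OF successor[unfolded One_nat_def]]) (auto simp: length_Suc_conv)
qed

lemma recursive_const [rec_intros]: "recursive k (\<lambda>xs. c)"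
  by (induction c) (rule zero, rule recursive_Suc)

lemma recursive_rec_nat:
  assumes "recursive k f" "recursive (Suc (Suc k)) (\<lambda>xs. h (hd xs) (hd (tl xs)) (tl (tl xs)))"
  shows "recursive (Suc k) (\<lambda>xs. rec_nat (f (tl xs)) (\<lambda>n r. h n r (tl xs)) (hd xs))"
  using primitive_recursion[of k f "\<lambda>xs. h (hd xs) (hd (tl xs)) (tl (tl xs))"] assms by simp

lemma recursive_add [rec_intros]:
  "recursive k f \<Longrightarrow> recursive k g \<Longrightarrow> recursive k (\<lambda>xs. f xs + g xs)"
proof (rule recursive_comp2[of "(+)"])
  have "rec_nat y (\<lambda>n r. Suc r) x = x + y" for x y :: nat by (induction x) auto
  then show "recursive (Suc (Suc 0)) (\<lambda>xs. hd xs + hd (tl xs))"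
    using recursive_rec_nat[of "Suc 0" hd "\<lambda>n r ys. Suc r"] by (simp add: rec_intros)
qed

lemma recursive_mult [rec_intros]:
  "recursive k f \<Longrightarrow> recursive k g \<Longrightarrow> recursive k (\<lambda>xs. f xs * g xs)"
proof (rule recursive_comp2[of "(*)"])
  have "rec_nat 0 (\<lambda>n r. r + y) x = x * y" for x y :: nat by (induction x) auto
  then show "recursive (Suc (Suc 0)) (\<lambda>xs. hd xs * hd (tl xs))"
    using recursive_rec_nat[of "Suc 0" "\<lambda>_. 0" "\<lambda>n r ys. r + hd ys"] by (simp add: rec_intros)
qed

lemma recursive_power [rec_intros]:
  "recursive k f \<Longrightarrow> recursive k g \<Longrightarrow> recursive k (\<lambda>xs. f xs ^ g xs)"
proof (rule recursive_comp2[of "\<lambda>x y. y ^ x"])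
  have "rec_nat 1 (\<lambda>n r. r * y) x = y ^ x" for x y :: nat by (induction x) auto
  then show "recursive (Suc (Suc 0)) (\<lambda>xs. hd (tl xs) ^ hd xs)"
    using recursive_rec_nat[of "Suc 0" "\<lambda>_. 1" "\<lambda>n r ys. r * hd ys"] by (simp add: rec_intros)
qed

lemma recursive_minus [rec_intros]:
  "recursive k f \<Longrightarrow> recursive k g \<Longrightarrow> recursive k (\<lambda>xs. f xs - g xs)"
proof (rule recursive_comp2[of "\<lambda>x y. y - x"])
  have "rec_nat 0 (\<lambda>n r. n) x = x - 1" for x :: nat by (cases x) auto
  then have "recursive (Suc 0) (\<lambda>xs. hd xs - 1)"
    using recursive_rec_nat[of 0 "\<lambda>_. 0" "\<lambda>n r ys. n"] by (simp add: rec_intros)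
  then have pred: "recursive (Suc (Suc (Suc 0))) (\<lambda>xs. hd (tl xs) - 1)"
    by (rule recursive_comp1) (rule rec_intros)
  have "rec_nat y (\<lambda>n r. r - 1) x = y - x" for x y :: nat by (induction x) auto
  then show "recursive (Suc (Suc 0)) (\<lambda>xs. hd (tl xs) - hd xs)"
    using recursive_rec_nat[of "Suc 0" hd "\<lambda>n r ys. r - 1"] pred by (simp add: rec_intros)
qed

lemma recpred_eq_0: "recursive k f \<Longrightarrow> recpred k (\<lambda>xs. f xs = 0)"
  unfolding recpred_def
  by (rule extensional[of k "\<lambda>xs. 1 - (1 - f xs)"]) (auto intro!: rec_intros)

lemma recpred_cong: "recpred k P \<Longrightarrow> (\<And>xs. length xs = k \<Longrightarrow> P xs \<longleftrightarrow> Q xs) \<Longrightarrow> recpred k Q"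
  unfolding recpred_def by (erule extensional) simp

lemma recpred_le [rec_intros]:
  "recursive k f \<Longrightarrow> recursive k g \<Longrightarrow> recpred k (\<lambda>xs. f xs \<le> g xs)"
  by (rule recpred_cong[OF recpred_eq_0[of k "\<lambda>xs. f xs - g xs"]]) (auto intro!: rec_intros)

lemma recpred_less [rec_intros]:
  "recursive k f \<Longrightarrow> recursive k g \<Longrightarrow> recpred k (\<lambda>xs. f xs < g xs)"
  unfolding less_eq_Suc_le by (rule rec_intros)+

lemma recpred_eq [rec_intros]:
  "recursive k f \<Longrightarrow> recursive k g \<Longrightarrow> recpred k (\<lambda>xs. f xs = g xs)"
  by (rule recpred_cong[OF recpred_eq_0[of k "\<lambda>xs. (f xs - g xs) + (g xs - f xs)"]])
    (auto intro!: rec_intros)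

lemma recpred_not [rec_intros]: "recpred k P \<Longrightarrow> recpred k (\<lambda>xs. \<not> P xs)"
  unfolding recpred_def
  by (rule extensional[of k "\<lambda>xs. 1 - (if P xs then 0 else 1)"]) (auto intro!: rec_intros)

lemma recpred_conj [rec_intros]:
  assumes "recpred k P" "recpred k Q" shows "recpred k (\<lambda>xs. P xs \<and> Q xs)"
  by (rule recpred_cong[OF recpred_eq_0[OF recursive_add[OF assms[unfolded recpred_def]]]]) auto

lemma recpred_connectives [rec_intros]:
  assumes "recpred k P" "recpred k Q"
  shows "recpred k (\<lambda>xs. P xs \<or> Q xs)" "recpred k (\<lambda>xs. P xs \<longrightarrow> Q xs)"
    "recpred k (\<lambda>xs. P xs \<longleftrightarrow> Q xs)"
proof -
  have "recpred k (\<lambda>xs. \<not> (\<not> P xs \<and> \<not> Q xs))" "recpred k (\<lambda>xs. \<not> (P xs \<and> \<not> Q xs))"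
    "recpred k (\<lambda>xs. \<not> (P xs \<and> \<not> Q xs) \<and> \<not> (\<not> P xs \<and> Q xs))"
    by (intro rec_intros assms)+
  then show "recpred k (\<lambda>xs. P xs \<or> Q xs)" "recpred k (\<lambda>xs. P xs \<longrightarrow> Q xs)"
    "recpred k (\<lambda>xs. P xs \<longleftrightarrow> Q xs)"
    by (auto elim: recpred_cong)
qed

lemma recursive_Least:
  assumes "recpred (Suc k) (\<lambda>xs. P (hd xs) (tl xs))" "\<And>xs. length xs = k \<Longrightarrow> \<exists>n. P n xs"
  shows "recursive k (\<lambda>xs. LEAST n. P n xs)"
proof -
  have "(if P n xs then 0 else 1 :: nat) = 0 \<longleftrightarrow> P n xs" for n xs by simp
  with minimization[of k "\<lambda>xs. if P (hd xs) (tl xs) then 0 else 1"] assms show ?thesis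
    by (simp add: recpred_def)
qed

text \<open>
  Bounded quantifiers reduce to minimization: the search for a witness is stopped at the bound, and
  succeeds if it ends before it.
\<close>

lemma recpred_ex_less [rec_intros]:
  assumes "recursive k b" "recpred (Suc k) (\<lambda>xs. P (hd xs) (tl xs))"
  shows "recpred k (\<lambda>xs. \<exists>z<b xs. P z xs)"
proof -
  have "recursive k (\<lambda>xs. LEAST z. z = b xs \<or> P z xs)"
    by (rule recursive_Least) (auto intro!: rec_intros recursive_tl assms)
  then have "recpred k (\<lambda>xs. (LEAST z. z = b xs \<or> P z xs) < b xs)"
    by (intro rec_intros assms)
  moreover have "(LEAST z. z = b xs \<or> P z xs) < b xs \<longleftrightarrow> (\<exists>z<b xs. P z xs)" for xs
  proof
    assume "(LEAST z. z = b xs \<or> P z xs) < b xs"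
    moreover have "(LEAST z. z = b xs \<or> P z xs) = b xs \<or> P (LEAST z. z = b xs \<or> P z xs) xs"
      by (rule LeastI[of _ "b xs"]) simp
    ultimately show "\<exists>z<b xs. P z xs" by auto
  next
    assume "\<exists>z<b xs. P z xs"
    then obtain z where "z < b xs" "P z xs" by blast
    then show "(LEAST z. z = b xs \<or> P z xs) < b xs"
      using Least_le[of "\<lambda>z. z = b xs \<or> P z xs" z] by auto
  qed
  ultimately show ?thesis by simp
qed

lemma recpred_all_less [rec_intros]:
  assumes "recursive k b" "recpred (Suc k) (\<lambda>xs. P (hd xs) (tl xs))"
  shows "recpred k (\<lambda>xs. \<forall>z<b xs. P z xs)"
  using recpred_not[OF recpred_ex_less[OF assms(1) recpred_not[OF assms(2)]]]
  by (rule recpred_cong) auto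

lemma recursive_triangle: "recursive k f \<Longrightarrow> recursive k (\<lambda>xs. triangle (f xs))"
proof (rule recursive_comp1[of triangle])
  have "rec_nat 0 (\<lambda>n r. r + Suc n) x = triangle x" for x by (induction x) auto
  then show "recursive (Suc 0) (\<lambda>xs. triangle (hd xs))"
    using recursive_rec_nat[of 0 "\<lambda>_. 0" "\<lambda>n r ys. r + Suc n"] by (simp add: rec_intros del: add_Suc_right)
qed

text \<open>
  Curried forms of pairing, unpairing and membership in the finite set coded by the binary digits of
  a number, as needed by rules that match the arguments separately.
\<close>

definition pr :: "nat \<Rightarrow> nat \<Rightarrow> nat" where "pr a b = prod_encode (a, b)"
definition pr1 :: "nat \<Rightarrow> nat" where "pr1 n = fst (prod_decode n)"
definition pr2 :: "nat \<Rightarrow> nat" where "pr2 n = snd (prod_decode n)"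
definition bit :: "nat \<Rightarrow> nat \<Rightarrow> bool" where "bit w x \<longleftrightarrow> x \<in> set_decode w"

lemma pr_simps [simp]: "pr1 (pr a b) = a" "pr2 (pr a b) = b" "pr (pr1 n) (pr2 n) = n"
  by (simp_all add: pr_def pr1_def pr2_def)

lemma pr_eq_iff: "pr a b = pr c d \<longleftrightarrow> a = c \<and> b = d"
  by (simp add: pr_def)

lemma pr_ge: "a + b \<le> pr a b"
proof -
  have "n \<le> triangle n" for n by (induction n) auto
  from this[of "a + b"] show ?thesis by (simp add: pr_def prod_encode_def)
qed

lemma pr_strict_mono: "a \<le> c \<Longrightarrow> b \<le> d \<Longrightarrow> a + b < c + d \<Longrightarrow> pr a b < pr c d"
proof -
  assume *: "a \<le> c" "b \<le> d" "a + b < c + d"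
  have "i \<le> j \<Longrightarrow> triangle i \<le> triangle j" for i j by (induction j) (auto simp: le_Suc_eq)
  from this[of "Suc (a + b)" "c + d"] * show ?thesis by (simp add: pr_def prod_encode_def)
qed

lemma recursive_pr [rec_intros]:
  "recursive k f \<Longrightarrow> recursive k g \<Longrightarrow> recursive k (\<lambda>xs. pr (f xs) (g xs))"
  unfolding pr_def prod_encode_def by (simp add: rec_intros recursive_triangle)

lemma recursive_unpair [rec_intros]:
  assumes "recursive k f"
  shows "recursive k (\<lambda>xs. pr1 (f xs))" "recursive k (\<lambda>xs. pr2 (f xs))"
proof -
  have 1: "(LEAST a. \<exists>b<Suc n. pr a b = n) = pr1 n" for n
  proof (rule Least_equality)
    have "pr2 n < Suc n" using pr_ge[of "pr1 n" "pr2 n"] by simp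
    then show "\<exists>b<Suc n. pr (pr1 n) b = n" using pr_simps(3) by blast
  qed auto
  have 2: "(LEAST b. \<exists>a<Suc n. pr a b = n) = pr2 n" for n
  proof (rule Least_equality)
    have "pr1 n < Suc n" using pr_ge[of "pr1 n" "pr2 n"] by simp
    then show "\<exists>a<Suc n. pr a (pr2 n) = n" using pr_simps(3) by blast
  qed auto
  have ex: "\<exists>a. \<exists>b<Suc n. pr a b = n" "\<exists>b. \<exists>a<Suc n. pr a b = n" for n
    using pr_simps(3)[of n] pr_ge[of "pr1 n" "pr2 n"] by (metis add_leE less_Suc_eq_le pr_simps(3))+
  have "recursive (Suc 0) (\<lambda>xs. LEAST a. \<exists>b<Suc (hd xs). pr a b = hd xs)"
    "recursive (Suc 0) (\<lambda>xs. LEAST b. \<exists>a<Suc (hd xs). pr a b = hd xs)"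
    by (rule recursive_Least; (intro rec_intros ex)?)+
  from this[unfolded 1 2] show "recursive k (\<lambda>xs. pr1 (f xs))" "recursive k (\<lambda>xs. pr2 (f xs))"
    using recursive_comp1 assms by blast+
qed

text \<open>
  The digit at position \<open>x\<close> is set if the quotient by \<open>2 ^ x\<close> is odd; division with remainder is
  expressed by bounded quantifiers.
\<close>

lemma bit_iff: "bit w x \<longleftrightarrow> (\<exists>q<Suc w. \<exists>r<2 ^ x. w = (2 * q + 1) * 2 ^ x + r)"
proof
  assume "bit w x"
  then have "odd (w div 2 ^ x)" by (simp add: bit_def set_decode_def)
  then obtain q where q: "w div 2 ^ x = 2 * q + 1" by (auto elim: oddE)
  have w: "w = (2 * q + 1) * 2 ^ x + w mod 2 ^ x"
    using div_mult_mod_eq[of w "2 ^ x"] by (simp add: q)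
  have "q * 1 \<le> (2 * q + 1) * 2 ^ x" by (intro mult_le_mono) auto
  then have "q < Suc w" using w by linarith
  with w show "\<exists>q<Suc w. \<exists>r<2 ^ x. w = (2 * q + 1) * 2 ^ x + r"
    by (intro exI[of _ q] conjI exI[of _ "w mod 2 ^ x"]) auto
next
  assume "\<exists>q<Suc w. \<exists>r<2 ^ x. w = (2 * q + 1) * 2 ^ x + r"
  then obtain q r where qr: "r < 2 ^ x" "w = (2 * q + 1) * 2 ^ x + r" by blast
  have "w div 2 ^ x = 2 * q + 1 + r div 2 ^ x"
    unfolding qr(2) by (rule div_mult_self3) simp
  then have "w div 2 ^ x = 2 * q + 1" using qr(1) by simp
  then show "bit w x" by (simp add: bit_def set_decode_def)
qed

lemma recpred_bit [rec_intros]: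
  assumes "recursive k f" "recursive k g" shows "recpred k (\<lambda>xs. bit (f xs) (g xs))"
proof -
  have "recpred (Suc (Suc 0)) (\<lambda>xs. bit (hd xs) (hd (tl xs)))"
    unfolding bit_iff by (rule rec_intros)+
  then show ?thesis using assms unfolding recpred_def by (rule recursive_comp2)
qed

lemma bit_set_encode: "finite A \<Longrightarrow> bit (set_encode A) x \<longleftrightarrow> x \<in> A"
  by (simp add: bit_def)

lemma set_encode_less: "A \<subseteq> {..<k} \<Longrightarrow> set_encode A < 2 ^ k"
proof -
  assume "A \<subseteq> {..<k}"
  then have "set_encode A \<le> set_encode {..<k}" by (simp add: set_encode_def sum_mono2)
  also have "\<dots> = 2 ^ k - 1" by (induction k) (simp_all add: set_encode_def lessThan_Suc)
  also have "\<dots> < 2 ^ k" by simp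
  finally show ?thesis .
qed

section \<open>Recognizing codes of terms by a recursive predicate\<close>

text \<open>
  A number \<open>w\<close> codes a table that contains, for each row \<open>u\<close>, a binary relation on numbers.
\<close>

definition entry :: "nat \<Rightarrow> nat \<Rightarrow> nat \<Rightarrow> nat \<Rightarrow> bool" where
  "entry w u p q \<longleftrightarrow> bit w (pr u (pr p q))"

lemma recpred_entry [rec_intros]:
  "recursive k f \<Longrightarrow> recursive k g \<Longrightarrow> recursive k h \<Longrightarrow> recursive k l \<Longrightarrow>
    recpred k (\<lambda>xs. entry (f xs) (g xs) (h xs) (l xs))"
  unfolding entry_def by (intro rec_intros)



lemma term_code_pr [simp]:
  "term_code (Var v) = pr 0 v" "term_code Zero = pr 1 0" "term_code (Inv t) = pr 2 (term_code t)"
  "term_code (Mult s t) = pr 3 (pr (term_code s) (term_code t))"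
  "term_code (SDiff s t) = pr 4 (pr (term_code s) (term_code t))"
  "term_code (SAdd s t) = pr 5 (pr (term_code s) (term_code t))"
  by (simp_all add: pr_def)

lemmas [simp del] = term_code.simps

text \<open>
  Being the code of a term is defined by recursion on the code.  The values at smaller codes are
  taken from a parameter \<open>W\<close>, which is instantiated both by the predicate itself and by a finite
  table of its values.
\<close>

definition wf_step :: "nat \<Rightarrow> (nat \<Rightarrow> bool) \<Rightarrow> nat \<Rightarrow> bool" where
  "wf_step n W u \<longleftrightarrow> pr1 u = 0 \<and> pr2 u < n \<or> u = pr 1 0 \<or> pr1 u = 2 \<and> W (pr2 u) \<or>
    (pr1 u = 3 \<or> pr1 u = 4 \<or> pr1 u = 5) \<and> W (pr1 (pr2 u)) \<and> W (pr2 (pr2 u))"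

definition is_code :: "nat \<Rightarrow> nat \<Rightarrow> bool" where
  "is_code n u \<longleftrightarrow> (\<exists>s. u = term_code s \<and> vars s \<subseteq> {..<n})"

lemma is_code_step: "is_code n u \<longleftrightarrow> wf_step n (is_code n) u"
proof
  assume "is_code n u"
  then obtain s where "u = term_code s" "vars s \<subseteq> {..<n}" by (auto simp: is_code_def)
  then show "wf_step n (is_code n) u" by (cases s) (auto simp: wf_step_def is_code_def)
next
  have u: "u = pr (pr1 u) (pr2 u)" "pr2 u = pr (pr1 (pr2 u)) (pr2 (pr2 u))" by simp_all
  assume "wf_step n (is_code n) u"
  then consider "pr1 u = 0" "pr2 u < n" | "u = pr 1 0" | "pr1 u = 2" "is_code n (pr2 u)"
    | "pr1 u = 3 \<or> pr1 u = 4 \<or> pr1 u = 5" "is_code n (pr1 (pr2 u))" "is_code n (pr2 (pr2 u))"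
    by (auto simp: wf_step_def)
  then show "is_code n u"
  proof cases
    case 1
    then have "u = term_code (Var (pr2 u))" using u(1) by simp
    then show ?thesis using 1 unfolding is_code_def by (intro exI[of _ "Var (pr2 u)"]) simp
  next
    case 2
    then show ?thesis unfolding is_code_def by (intro exI[of _ Zero]) simp
  next
    case 3
    then obtain s where s: "pr2 u = term_code s" "vars s \<subseteq> {..<n}" by (auto simp: is_code_def)
    then have "u = term_code (Inv s)" using u(1) 3 by simp
    then show ?thesis using s unfolding is_code_def by (intro exI[of _ "Inv s"]) simp
  next
    case 4
    then obtain s t where s: "pr1 (pr2 u) = term_code s" "vars s \<subseteq> {..<n}"
      and t: "pr2 (pr2 u) = term_code t" "vars t \<subseteq> {..<n}" by (auto simp: is_code_def)
    then have "u = pr (pr1 u) (pr (term_code s) (term_code t))" by (metis pr_simps(3))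
    then have "u = term_code (Mult s t) \<or> u = term_code (SDiff s t) \<or> u = term_code (SAdd s t)"
      using 4(1) by auto
    then show ?thesis
      using s t unfolding is_code_def
      by (elim disjE) (rule exI, erule conjI, simp)+
  qed
qed

lemma pr2_less: "0 < pr1 u \<Longrightarrow> pr2 u < u"
  and pr1_le: "pr1 u \<le> u" and pr2_le: "pr2 u \<le> u"
  using pr_ge[of "pr1 u" "pr2 u"] by simp_all

lemma components_less:
  assumes "0 < pr1 u" shows "pr2 u < u" "pr1 (pr2 u) < u" "pr2 (pr2 u) < u"
  using pr2_less[OF assms] pr1_le[of "pr2 u"] pr2_le[of "pr2 u"] by simp_all

text \<open>
  Recursion on codes is replaced by a search for a table of all values below \<open>T\<close>, recognized by the
  local condition \<open>wf_step\<close>.  Such a table exists, and its values are forced.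
\<close>

definition wf_tab :: "nat \<Rightarrow> nat \<Rightarrow> nat" where
  "wf_tab n T = (LEAST w. \<forall>u<T. bit w u \<longleftrightarrow> wf_step n (bit w) u)"

lemma wf_step_cong:
  assumes "\<And>v. v < u \<Longrightarrow> W v \<longleftrightarrow> W' v" shows "wf_step n W u \<longleftrightarrow> wf_step n W' u"
  using assms components_less[of u] unfolding wf_step_def by auto

lemma wf_tab_exists: "\<exists>w. \<forall>u<T. bit w u \<longleftrightarrow> wf_step n (bit w) u"
proof -
  define w where "w = set_encode {u \<in> {..<T}. is_code n u}"
  have w: "bit w u \<longleftrightarrow> is_code n u" if "u < T" for u using that by (simp add: w_def bit_set_encode)
  have "bit w u \<longleftrightarrow> wf_step n (bit w) u" if "u < T" for u
    using w that is_code_step[of n u] wf_step_cong[of u "bit w" "is_code n" n] by simp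
  then show ?thesis by blast
qed

lemma bit_wf_tab:
  assumes "u < T" shows "bit (wf_tab n T) u \<longleftrightarrow> is_code n u"
proof -
  have step: "\<forall>u<T. bit (wf_tab n T) u \<longleftrightarrow> wf_step n (bit (wf_tab n T)) u"
    unfolding wf_tab_def by (rule LeastI_ex) (rule wf_tab_exists)
  show ?thesis
    using assms
  proof (induction u rule: less_induct)
    case (less u)
    then have "wf_step n (bit (wf_tab n T)) u \<longleftrightarrow> wf_step n (is_code n) u"
      by (intro wf_step_cong) simp
    then show ?case using step less.prems is_code_step[of n u] by simp
  qed
qed

lemma recursive_wf_tab [rec_intros]:
  "recursive k f \<Longrightarrow> recursive k g \<Longrightarrow> recursive k (\<lambda>xs. wf_tab (f xs) (g xs))"
proof (rule recursive_comp2[of wf_tab])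
  show "recursive (Suc (Suc 0)) (\<lambda>xs. wf_tab (hd xs) (hd (tl xs)))"
    unfolding wf_tab_def
  proof (rule recursive_Least[where P = "\<lambda>w xs. \<forall>u<hd (tl xs). bit w u \<longleftrightarrow> wf_step (hd xs) (bit w) u"])
    show "recpred (Suc (Suc (Suc 0))) (\<lambda>xs. \<forall>u<hd (tl (tl xs)).
        bit (hd xs) u \<longleftrightarrow> wf_step (hd (tl xs)) (bit (hd xs)) u)"
      unfolding wf_step_def by (rule rec_intros)+
  qed (rule wf_tab_exists)
qed

section \<open>Evaluating codes of terms by a recursive function\<close>

text \<open>
  The recursion for the values of terms: \<open>G\<close> gives the relations for the variables, \<open>E\<close> the values
  of the terms with smaller codes, and all points are less than \<open>m\<close>.
\<close>

definition eval_step :: "nat \<Rightarrow> (nat \<Rightarrow> nat \<Rightarrow> nat \<Rightarrow> bool) \<Rightarrow> (nat \<Rightarrow> nat \<Rightarrow> nat \<Rightarrow> bool) \<Rightarrow>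
    nat \<Rightarrow> nat \<Rightarrow> nat \<Rightarrow> bool" where
  "eval_step m G E u p q \<longleftrightarrow>
    pr1 u = 0 \<and> G (pr2 u) p q \<or>
    pr1 u = 2 \<and> E (pr2 u) q p \<or>
    pr1 u = 3 \<and> (\<exists>z<m. E (pr2 (pr2 u)) p z \<and> E (pr1 (pr2 u)) z q) \<or>
    pr1 u = 5 \<and> E (pr2 (pr2 u)) p q \<or>
    (pr1 u = 4 \<or> pr1 u = 5) \<and> E (pr1 (pr2 u)) p q \<and>
      (\<forall>z<m. \<not> E (pr2 (pr2 u)) p z) \<and> (\<forall>z<m. \<not> E (pr2 (pr2 u)) z q)"

lemma eval_step_cong:
  assumes "\<And>v p q. v < u \<Longrightarrow> p < m \<Longrightarrow> q < m \<Longrightarrow> E v p q \<longleftrightarrow> E' v p q" "p < m" "q < m"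
  shows "eval_step m G E u p q \<longleftrightarrow> eval_step m G E' u p q"
proof (cases "pr1 u = 0")
  case False
  with assms components_less[of u] show ?thesis
    by (simp add: eval_step_def cong: conj_cong)
qed (simp add: eval_step_def)

text \<open>
  Variables from \<open>n\<close> on have the empty relation, so that bounded quantifiers can express that all
  these relations are partial injections.
\<close>

definition dec_rel :: "nat \<Rightarrow> nat \<Rightarrow> nat \<Rightarrow> nat \<Rightarrow> nat rel" where
  "dec_rel n m M v = {(p, q). v < n \<and> p < m \<and> q < m \<and> entry M v p q}"

lemma dec_rel_iff: "(p, q) \<in> dec_rel n m M v \<longleftrightarrow> v < n \<and> p < m \<and> q < m \<and> entry M v p q"
  by (simp add: dec_rel_def)

text \<open>
  A table of values also has rows for numbers that do not code terms.  Decoding every number as some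
  term, with \<open>Zero\<close> for unknown tags, provides relations that satisfy the recursion in these rows.
\<close>

function dec_term :: "nat \<Rightarrow> nat bterm" where
  "dec_term u =
    (if pr1 u = 0 then Var (pr2 u)
     else if pr1 u = 2 then Inv (dec_term (pr2 u))
     else if pr1 u = 3 then Mult (dec_term (pr1 (pr2 u))) (dec_term (pr2 (pr2 u)))
     else if pr1 u = 4 then SDiff (dec_term (pr1 (pr2 u))) (dec_term (pr2 (pr2 u)))
     else if pr1 u = 5 then SAdd (dec_term (pr1 (pr2 u))) (dec_term (pr2 (pr2 u)))
     else Zero)"
  by auto
termination by (relation "Wellfounded.measure id") (auto simp: components_less)

declare dec_term.simps [simp del]

lemma dec_term_code [simp]: "dec_term (term_code t) = t"
  by (induction t) (subst dec_term.simps; simp)+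

lemma rel_eval_step:
  assumes R: "\<And>v. R v \<subseteq> {..<m} \<times> {..<m}" and p: "p < m" and q: "q < m"
  shows "(p, q) \<in> rel_eval R (dec_term u) \<longleftrightarrow>
    eval_step m (\<lambda>v p q. (p, q) \<in> R v) (\<lambda>u p q. (p, q) \<in> rel_eval R (dec_term u)) u p q"
proof -
  have b: "(p, q) \<in> rel_eval R t \<Longrightarrow> p < m \<and> q < m" for t p q
    using rel_eval_bound[of R "{..<m}" t] R by auto
  have D: "p \<in> Domain (rel_eval R t) \<longleftrightarrow> (\<exists>z<m. (p, z) \<in> rel_eval R t)"
    "p \<in> Range (rel_eval R t) \<longleftrightarrow> (\<exists>z<m. (z, p) \<in> rel_eval R t)" for t p
    using b by auto
  have O: "(p, q) \<in> rel_eval R t O rel_eval R s \<longleftrightarrow>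
    (\<exists>z<m. (p, z) \<in> rel_eval R t \<and> (z, q) \<in> rel_eval R s)" for s t
    using b by auto
  consider "pr1 u = 0" | "pr1 u = 2" | "pr1 u = 3" | "pr1 u = 4" | "pr1 u = 5"
    | "pr1 u \<noteq> 0" "pr1 u \<noteq> 2" "pr1 u \<noteq> 3" "pr1 u \<noteq> 4" "pr1 u \<noteq> 5" by blast
  then show ?thesis
    by cases (simp_all add: dec_term.simps[of u] eval_step_def radd_def rdiff_def D O disj_commute
        del: Domain_iff Range_iff)
qed

text \<open>
  As for \<open>wf_tab\<close>, the recursion is replaced by the search for a table that satisfies it locally.
\<close>

definition eval_tab :: "nat \<Rightarrow> nat \<Rightarrow> nat \<Rightarrow> nat" where
  "eval_tab M m T = (LEAST w. \<forall>u<T. \<forall>p<m. \<forall>q<m.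
    entry w u p q \<longleftrightarrow> eval_step m (entry M) (entry w) u p q)"

lemma eval_tab_exists:
  "\<exists>w. \<forall>u<T. \<forall>p<m. \<forall>q<m. entry w u p q \<longleftrightarrow> eval_step m (entry M) (entry w) u p q"
proof -
  define R where "R v = {(p, q). p < m \<and> q < m \<and> entry M v p q}" for v
  have R: "R v \<subseteq> {..<m} \<times> {..<m}" for v by (auto simp: R_def)
  let ?A = "(\<lambda>(u, p, q). pr u (pr p q)) ` {(u, p, q) \<in> {..<T} \<times> {..<m} \<times> {..<m}. (p, q) \<in> rel_eval R (dec_term u)}"
  define w where "w = set_encode ?A"
  have "finite ?A" by (rule finite_imageI) (rule finite_subset[of _ "{..<T} \<times> {..<m} \<times> {..<m}"], auto)
  then have w: "entry w u p q \<longleftrightarrow> (p, q) \<in> rel_eval R (dec_term u)" if "u < T" "p < m" "q < m" for u p q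
    using that by (auto simp: w_def entry_def bit_set_encode pr_eq_iff image_iff)
  have "entry w u p q \<longleftrightarrow> eval_step m (entry M) (entry w) u p q" if *: "u < T" "p < m" "q < m" for u p q
  proof -
    have "entry w u p q \<longleftrightarrow>
      eval_step m (\<lambda>v p q. (p, q) \<in> R v) (\<lambda>u p q. (p, q) \<in> rel_eval R (dec_term u)) u p q"
      using w[OF *] rel_eval_step[of R m p q u, OF R] * by simp
    also have "\<dots> \<longleftrightarrow> eval_step m (\<lambda>v p q. (p, q) \<in> R v) (entry w) u p q"
      using w * by (intro eval_step_cong) auto
    also have "\<dots> \<longleftrightarrow> eval_step m (entry M) (entry w) u p q"
      using * by (simp add: eval_step_def R_def)
    finally show ?thesis .
  qed
  then show ?thesis by blast
qed

lemma entry_eval_tab: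
  assumes "vars s \<subseteq> {..<n}" "term_code s < T" "p < m" "q < m"
  shows "entry (eval_tab M m T) (term_code s) p q \<longleftrightarrow> (p, q) \<in> rel_eval (dec_rel n m M) s"
proof -
  let ?w = "eval_tab M m T" and ?R = "\<lambda>v. {(p, q). p < m \<and> q < m \<and> entry M v p q}"
  have R: "?R v \<subseteq> {..<m} \<times> {..<m}" for v by auto
  have step: "\<forall>u<T. \<forall>p<m. \<forall>q<m. entry ?w u p q \<longleftrightarrow> eval_step m (entry M) (entry ?w) u p q"
    unfolding eval_tab_def by (rule LeastI_ex) (rule eval_tab_exists)
  have "entry ?w u p q \<longleftrightarrow> (p, q) \<in> rel_eval ?R (dec_term u)" if "u < T" "p < m" "q < m" for u p q
    using that
  proof (induction u arbitrary: p q rule: less_induct)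
    case (less u)
    have "entry ?w u p q \<longleftrightarrow> eval_step m (entry M) (entry ?w) u p q" using step less.prems by blast
    also have "\<dots> \<longleftrightarrow> eval_step m (\<lambda>v p q. (p, q) \<in> ?R v) (entry ?w) u p q"
      using less.prems by (simp add: eval_step_def)
    also have "\<dots> \<longleftrightarrow> eval_step m (\<lambda>v p q. (p, q) \<in> ?R v) (\<lambda>u p q. (p, q) \<in> rel_eval ?R (dec_term u)) u p q"
      using less by (intro eval_step_cong) auto
    also have "\<dots> \<longleftrightarrow> (p, q) \<in> rel_eval ?R (dec_term u)"
      using rel_eval_step[of ?R m p q u, OF R] less.prems by simp
    finally show ?case .
  qed
  from this[OF assms(2-4)] show ?thesis
    using rel_eval_cong[of s ?R "dec_rel n m M"] assms(1) by (auto simp: dec_rel_def)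
qed

lemma recursive_eval_tab [rec_intros]:
  "recursive k f \<Longrightarrow> recursive k g \<Longrightarrow> recursive k h \<Longrightarrow>
    recursive k (\<lambda>xs. eval_tab (f xs) (g xs) (h xs))"
proof (rule recursive_comp3[of eval_tab])
  show "recursive (Suc (Suc (Suc 0))) (\<lambda>xs. eval_tab (hd xs) (hd (tl xs)) (hd (tl (tl xs))))"
    unfolding eval_tab_def
  proof (rule recursive_Least[where P = "\<lambda>w xs. \<forall>u<hd (tl (tl xs)). \<forall>p<hd (tl xs). \<forall>q<hd (tl xs).
      entry w u p q \<longleftrightarrow> eval_step (hd (tl xs)) (entry (hd xs)) (entry w) u p q"])
    show "recpred (Suc (Suc (Suc (Suc 0)))) (\<lambda>xs. \<forall>u<hd (tl (tl (tl xs))). \<forall>p<hd (tl (tl xs)).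
        \<forall>q<hd (tl (tl xs)). entry (hd xs) u p q \<longleftrightarrow>
          eval_step (hd (tl (tl xs))) (entry (hd (tl xs))) (entry (hd xs)) u p q)"
      unfolding eval_step_def by (rule rec_intros)+
  qed (rule eval_tab_exists)
qed

section \<open>Deciding the word problem\<close>

definition pinj_code :: "nat \<Rightarrow> nat \<Rightarrow> nat \<Rightarrow> bool" where
  "pinj_code n m M \<longleftrightarrow> (\<forall>v<n. \<forall>p<m. \<forall>q<m. \<forall>z<m. entry M v p q \<longrightarrow>
    (entry M v p z \<longrightarrow> q = z) \<and> (entry M v z q \<longrightarrow> p = z))"

lemma pinj_code_iff: "pinj_code n m M \<longleftrightarrow> (\<forall>v. pinj (dec_rel n m M v))"
proof
  assume code: "pinj_code n m M"
  show "\<forall>v. pinj (dec_rel n m M v)"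
  proof (intro allI pinjI)
    show "q = q'" if "(p, q) \<in> dec_rel n m M v" "(p, q') \<in> dec_rel n m M v" for v p q q'
      using code that unfolding pinj_code_def dec_rel_iff by blast
    show "p = p'" if "(p, q) \<in> dec_rel n m M v" "(p', q) \<in> dec_rel n m M v" for v p p' q
      using code that unfolding pinj_code_def dec_rel_iff by blast
  qed
next
  assume pinj: "\<forall>v. pinj (dec_rel n m M v)"
  have "(entry M v p z \<longrightarrow> q = z) \<and> (entry M v z q \<longrightarrow> p = z)"
    if "v < n" "p < m" "q < m" "z < m" "entry M v p q" for v p q z
    using that pinjD[OF pinj[rule_format, of v], of p q z] pinjD'[OF pinj[rule_format, of v], of p q z]
    unfolding dec_rel_iff by blast
  then show "pinj_code n m M" unfolding pinj_code_def by blast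
qed

lemma recpred_pinj_code [rec_intros]:
  assumes "recursive k f" "recursive k g" "recursive k h"
  shows "recpred k (\<lambda>xs. pinj_code (f xs) (g xs) (h xs))"
proof -
  have "recpred (Suc (Suc (Suc 0))) (\<lambda>xs. pinj_code (hd xs) (hd (tl xs)) (hd (tl (tl xs))))"
    unfolding pinj_code_def by (rule rec_intros)+
  then show ?thesis unfolding recpred_def using assms by (rule recursive_comp3)
qed

lemma dec_rel_surj:
  assumes "\<And>v. R v \<subseteq> {..<m} \<times> {..<m}"
  obtains M where "M < 2 ^ pr n (pr m m)" "\<And>v. v < n \<Longrightarrow> dec_rel n m M v = R v"
proof
  let ?A = "(\<lambda>(v, p, q). pr v (pr p q)) ` {(v, p, q). v < n \<and> (p, q) \<in> R v}"
  have sub: "{(v, p, q). v < n \<and> (p, q) \<in> R v} \<subseteq> {..<n} \<times> {..<m} \<times> {..<m}" using assms by auto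
  then have "finite ?A" by (intro finite_imageI) (rule finite_subset, auto)
  then have "entry (set_encode ?A) v p q \<longleftrightarrow> v < n \<and> (p, q) \<in> R v" for v p q
    by (auto simp: entry_def bit_set_encode pr_eq_iff image_iff)
  then show "dec_rel n m (set_encode ?A) v = R v" if "v < n" for v
    using that assms[of v] by (auto simp: dec_rel_def)
  have less: "pr v (pr p q) < pr n (pr m m)" if "v < n" "p < m" "q < m" for v p q
  proof -
    have "pr p q < pr m m" using that by (intro pr_strict_mono) auto
    then show ?thesis using that by (intro pr_strict_mono) auto
  qed
  have "?A \<subseteq> {..<pr n (pr m m)}"
  proof (rule image_subsetI)
    fix x assume "x \<in> {(v, p, q). v < n \<and> (p, q) \<in> R v}"
    with sub have "x \<in> {..<n} \<times> {..<m} \<times> {..<m}" by (rule subsetD)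
    then show "(\<lambda>(v, p, q). pr v (pr p q)) x \<in> {..<pr n (pr m m)}" using less by auto
  qed
  then show "set_encode ?A < 2 ^ pr n (pr m m)" by (rule set_encode_less)
qed

text \<open>
  A number that exceeds the bound of \<open>word_problem_iff\<close>, computed from the codes \<open>x\<close> and \<open>y\<close> of the
  two terms: a term with code \<open>x\<close> has at most \<open>x + 1\<close> leaves.
\<close>

definition points :: "nat \<Rightarrow> nat \<Rightarrow> nat \<Rightarrow> nat" where
  "points n x y = Suc ((2 * n + 1) ^ (x + y + 2))"

text \<open>
  The number \<open>pr n (pr m m)\<close> exceeds the codes of all triples of a variable and two points, so the
  systems of relations are coded by numbers below its power of two.
\<close>

definition answer :: "nat \<Rightarrow> nat \<Rightarrow> nat \<Rightarrow> bool" where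
  "answer n x y \<longleftrightarrow> bit (wf_tab n (Suc x)) x \<and> bit (wf_tab n (Suc y)) y \<and>
    (\<forall>M<2 ^ pr n (pr (points n x y) (points n x y)). pinj_code n (points n x y) M \<longrightarrow>
      (\<forall>p<points n x y. \<forall>q<points n x y.
        entry (eval_tab M (points n x y) (Suc x)) x p q \<longleftrightarrow>
        entry (eval_tab M (points n x y) (Suc y)) y p q))"

lemma recursive_points [rec_intros]:
  "recursive k f \<Longrightarrow> recursive k g \<Longrightarrow> recursive k h \<Longrightarrow>
    recursive k (\<lambda>xs. points (f xs) (g xs) (h xs))"
  unfolding points_def by (intro rec_intros)

lemma recpred_answer:
  "recpred (Suc 0) (\<lambda>xs. answer (pr1 (hd xs)) (pr1 (pr2 (hd xs))) (pr2 (pr2 (hd xs))))"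
  unfolding answer_def by (rule rec_intros)+

lemma leaves_le: "leaves t \<le> Suc (term_code t)"
proof (induction t)
  case (Inv t)
  then show ?case using pr_ge[of 2 "term_code t"] by simp
next
  case (Mult s t)
  then show ?case
    using pr_ge[of 3 "pr (term_code s) (term_code t)"] pr_ge[of "term_code s" "term_code t"] by simp
next
  case (SDiff s t)
  then show ?case
    using pr_ge[of 4 "pr (term_code s) (term_code t)"] pr_ge[of "term_code s" "term_code t"] by simp
next
  case (SAdd s t)
  then show ?case
    using pr_ge[of 5 "pr (term_code s) (term_code t)"] pr_ge[of "term_code s" "term_code t"] by simp
qed simp_all

lemma answer_iff:
  assumes s: "vars s \<subseteq> {..<n}" and t: "vars t \<subseteq> {..<n}"
  shows "answer n (term_code s) (term_code t) \<longleftrightarrow>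
    eval_term (free_bias {..<n}) (free_gen {..<n}) s =
    eval_term (free_bias {..<n}) (free_gen {..<n}) t"
proof -
  define m where "m = points n (term_code s) (term_code t)"
  have m: "(2 * n + 1) ^ (leaves s + leaves t) < m"
  proof -
    have "(2 * n + 1) ^ (leaves s + leaves t) \<le> (2 * n + 1) ^ (term_code s + term_code t + 2)"
      using leaves_le[of s] leaves_le[of t] by (intro power_increasing) auto
    then show ?thesis by (simp add: m_def points_def)
  qed
  have code: "bit (wf_tab n (Suc (term_code u))) (term_code u)" if "vars u \<subseteq> {..<n}" for u
    using that by (auto simp: bit_wf_tab is_code_def)
  have sub: "dec_rel n m M v \<subseteq> {..<m} \<times> {..<m}" for M v by (auto simp: dec_rel_def)
  have "answer n (term_code s) (term_code t) \<longleftrightarrow>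
    (\<forall>M<2 ^ pr n (pr m m). (\<forall>v. pinj (dec_rel n m M v)) \<longrightarrow>
      (\<forall>p<m. \<forall>q<m. (p, q) \<in> rel_eval (dec_rel n m M) s \<longleftrightarrow> (p, q) \<in> rel_eval (dec_rel n m M) t))"
    by (simp add: answer_def code s t pinj_code_iff entry_eval_tab[OF s] entry_eval_tab[OF t]
        flip: m_def)
  also have "\<dots> \<longleftrightarrow> (\<forall>M<2 ^ pr n (pr m m). (\<forall>v. pinj (dec_rel n m M v)) \<longrightarrow>
      rel_eval (dec_rel n m M) s = rel_eval (dec_rel n m M) t)"
  proof -
    have "(\<forall>p<m. \<forall>q<m. (p, q) \<in> A \<longleftrightarrow> (p, q) \<in> B) \<longleftrightarrow> A = B"
      if "A \<subseteq> {..<m} \<times> {..<m}" "B \<subseteq> {..<m} \<times> {..<m}" for A B :: "nat rel"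
      using that by auto
    moreover have "rel_eval (dec_rel n m M) u \<subseteq> {..<m} \<times> {..<m}" for M u
      using sub by (rule rel_eval_bound)
    ultimately show ?thesis by simp
  qed
  also have "\<dots> \<longleftrightarrow> (\<forall>R. (\<forall>v. R v \<subseteq> {..<m} \<times> {..<m} \<and> pinj (R v)) \<longrightarrow> rel_eval R s = rel_eval R t)"
  proof (intro iffI allI impI)
    fix R :: "nat \<Rightarrow> nat rel"
    assume all: "\<forall>M<2 ^ pr n (pr m m). (\<forall>v. pinj (dec_rel n m M v)) \<longrightarrow>
      rel_eval (dec_rel n m M) s = rel_eval (dec_rel n m M) t"
      and R: "\<forall>v. R v \<subseteq> {..<m} \<times> {..<m} \<and> pinj (R v)"
    then obtain M where M: "M < 2 ^ pr n (pr m m)" "\<And>v. v < n \<Longrightarrow> dec_rel n m M v = R v"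
      using dec_rel_surj[of R m n] by blast
    have "pinj (dec_rel n m M v)" for v
    proof (cases "v < n")
      case False
      then have "dec_rel n m M v = {}" by (auto simp: dec_rel_def)
      then show ?thesis by (simp add: pinj_empty)
    qed (use M(2) R in simp)
    with all M(1) have "rel_eval (dec_rel n m M) s = rel_eval (dec_rel n m M) t" by blast
    moreover have "rel_eval (dec_rel n m M) u = rel_eval R u" if "vars u \<subseteq> {..<n}" for u
      using that M(2) by (intro rel_eval_cong) auto
    ultimately show "rel_eval R s = rel_eval R t" using s t by simp
  qed (use sub in blast)
  also have "\<dots> \<longleftrightarrow> eval_term (free_bias {..<n}) (free_gen {..<n}) s =
    eval_term (free_bias {..<n}) (free_gen {..<n}) t"
    by (rule word_problem_iff[OF s t m, symmetric])
  finally show ?thesis .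
qed

theorem word_problem_decidable: "decidable free_bias_word_problem"
proof -
  have iff: "i \<in> free_bias_word_problem \<longleftrightarrow> answer (pr1 i) (pr1 (pr2 i)) (pr2 (pr2 i))" for i
  proof
    assume "i \<in> free_bias_word_problem"
    then obtain n s t where "i = pr n (pr (term_code s) (term_code t))" "vars s \<subseteq> {..<n}"
      "vars t \<subseteq> {..<n}" "eval_term (free_bias {..<n}) (free_gen {..<n}) s =
        eval_term (free_bias {..<n}) (free_gen {..<n}) t"
      by (auto simp: free_bias_word_problem_def pr_def)
    then show "answer (pr1 i) (pr1 (pr2 i)) (pr2 (pr2 i))" by (simp add: answer_iff)
  next
    assume a: "answer (pr1 i) (pr1 (pr2 i)) (pr2 (pr2 i))"
    then have "is_code (pr1 i) (pr1 (pr2 i))" "is_code (pr1 i) (pr2 (pr2 i))"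
      by (simp_all add: answer_def bit_wf_tab)
    then obtain s t where st: "pr1 (pr2 i) = term_code s" "vars s \<subseteq> {..<pr1 i}"
      "pr2 (pr2 i) = term_code t" "vars t \<subseteq> {..<pr1 i}" by (auto simp: is_code_def)
    then have "i = pr (pr1 i) (pr (term_code s) (term_code t))" by (metis pr_simps(3))
    moreover have "eval_term (free_bias {..<pr1 i}) (free_gen {..<pr1 i}) s =
        eval_term (free_bias {..<pr1 i}) (free_gen {..<pr1 i}) t"
      using a st by (simp add: answer_iff)
    ultimately show "i \<in> free_bias_word_problem"
      using st unfolding free_bias_word_problem_def pr_def by blast
  qed
  let ?P = "\<lambda>xs. \<not> answer (pr1 (hd xs)) (pr1 (pr2 (hd xs))) (pr2 (pr2 (hd xs)))"
  have "recursive (Suc 0) (\<lambda>xs. if ?P xs then 0 else 1)"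
    using recpred_not[OF recpred_answer] by (simp only: recpred_def)
  then show ?thesis
    unfolding decidable_def by (intro exI[of _ "\<lambda>xs. if ?P xs then 0 else 1"]) (simp add: iff)
qed

theorem theorem3p8:
  shows "(\<forall>X :: 'v set. residually_finite (free_bias X)) \<and>
    generated_variety {sym_bias N | N. N \<ge> 1} = {S :: 'a bias_str. bias S} \<and>
    decidable free_bias_word_problem"
  using free_bias_residually_finite generated_by_sym word_problem_decidable by blast

end
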